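(* Let $\Omega\subset\mathbb{R}^d$ be a bounded domain (no regularity of $\partial\Omega$ is assumed), let $K\ge 1$, and let $\sigma_n\in M_K(\Omega)$ ($n\in\mathbb{N}$) and $\sigma\in M_K(\Omega)$. For $\delta>0$ put $\Omega_\delta=\{x\in\Omega: d(x,\partial\Omega)<\delta\}$. Assume that $$\lim_{\delta\to 0}\ \delta^{-1}\Big(\limsup_{n\to\infty}\|\sigma_n-\sigma\|_{L^\infty(\Omega_\delta)}\Big)=0$$ and that $\sigma_n$ converges to $\sigma$ in the sense of $G$-convergence. Then $$\lim_{n\to\infty}\|\Lambda_{\sigma_n}-\Lambda_\sigma\|_{H^{1/2}(\partial\Omega)\to H^{-1/2}(\partial\Omega)}=0 .$$
   Context: $M_K(\Omega)$ is the set of measurable, essentially bounded, real symmetric $d\times d$ matrix fields $\sigma$ on $\Omega$ with $\frac1K|\xi|^2\le \sigma(x)\xi\cdot\xi\le K|\xi|^2$ for almost every $x\in\Omega$ and all $\xi\in\mathbb{R}^d$. $G$-convergence: $\sigma_n\in M_K(\Omega)$ $G$-converges to $\sigma\in M_K(\Omega)$ if for every $f\in H^{-1}(\Omega)$ the solutions $u_n\in H^1_0(\Omega)$ of $-\nabla\cdot(\sigma_n\nabla u_n)=f$ converge weakly in $H^1_0(\Omega)$ to the solution $u\in H^1_0(\Omega)$ of $-\nabla\cdot(\sigma\nabla u)=f$. Boundary spaces: $H^{1/2}(\partial\Omega)$ is the trace space of $H^1(\Omega)$, which for an arbitrary bounded domain is understood as the quotient $H^1(\Omega)/H^1_0(\Omega)$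 with the quotient norm; "$u|_{\partial\Omega}=\varphi$" means that $u$ represents the class $\varphi$, and an extension of $\varphi$ is any such representative. $H^{-1/2}(\partial\Omega)$ is the dual of $H^{1/2}(\partial\Omega)$. Dirichlet-to-Neumann map: for $\sigma\in M_K(\Omega)$ and $\varphi\in H^{1/2}(\partial\Omega)$ let $u\in H^1(\Omega)$ be the unique solution of $\nabla\cdot(\sigma\nabla u)=0$ in $\Omega$, $u|_{\partial\Omega}=\varphi$. Then $\Lambda_\sigma:H^{1/2}(\partial\Omega)\to H^{-1/2}(\partial\Omega)$ is defined by $\langle\Lambda_\sigma\varphi,\psi\rangle=\int_\Omega \sigma\nabla u\cdot\nabla\tilde\psi$, where $\tilde\psi\in H^1(\Omega)$ is any extension of $\psi\in H^{1/2}(\partial\Omega)$. *)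

theory Defs
  imports "HOL-Analysis.Analysis" "HOL-Probability.Essential_Supremum"
begin

text \<open>
  Elements of the function spaces over \<open>\<Omega>\<close> are represented by functions on the whole space, of
  which only the values on \<open>\<Omega>\<close> matter. Functions that agree almost everywhere on \<open>\<Omega>\<close> are not
  identified; all norms, functionals and integrals below depend only on the almost-everywhere class.
\<close>

definition partial_deriv :: "'n \<Rightarrow> (real^'n \<Rightarrow> real) \<Rightarrow> real^'n \<Rightarrow> real" where
  "partial_deriv i f x = frechet_derivative f (at x) (axis i 1)"

fun C_k :: "nat \<Rightarrow> (real^'n \<Rightarrow> real) \<Rightarrow> bool" where
  "C_k 0 f \<longleftrightarrow> continuous_on UNIV f"
| "C_k (Suc k) f \<longleftrightarrow> f differentiable_on UNIV \<and> (\<forall>i. C_k k (partial_deriv i f))"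

definition test_functions :: "(real^'n) set \<Rightarrow> (real^'n \<Rightarrow> real) set" where
  "test_functions \<Omega> =
    {\<phi>. (\<forall>k. C_k k \<phi>) \<and> compact (closure {x. \<phi> x \<noteq> 0}) \<and> closure {x. \<phi> x \<noteq> 0} \<subseteq> \<Omega>}"

definition L2 :: "(real^'n) set \<Rightarrow> (real^'n \<Rightarrow> 'b::real_normed_vector) set" where
  "L2 \<Omega> = {f \<in> borel_measurable (lebesgue_on \<Omega>). integrable (lebesgue_on \<Omega>) (\<lambda>x. (norm (f x))\<^sup>2)}"

definition norm_L2 :: "(real^'n) set \<Rightarrow> (real^'n \<Rightarrow> 'b::real_normed_vector) \<Rightarrow> real" where
  "norm_L2 \<Omega> f = sqrt (LINT x|lebesgue_on \<Omega>. (norm (f x))\<^sup>2)"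

definition has_weak_grad ::
    "(real^'n) set \<Rightarrow> (real^'n \<Rightarrow> real) \<Rightarrow> (real^'n \<Rightarrow> real^'n) \<Rightarrow> bool" where
  "has_weak_grad \<Omega> u g \<longleftrightarrow> u \<in> L2 \<Omega> \<and> g \<in> L2 \<Omega> \<and>
    (\<forall>\<phi>\<in>test_functions \<Omega>. \<forall>i.
       (LINT x|lebesgue_on \<Omega>. u x * partial_deriv i \<phi> x) = - (LINT x|lebesgue_on \<Omega>. g x $ i * \<phi> x))"

definition H1 :: "(real^'n) set \<Rightarrow> (real^'n \<Rightarrow> real) set" where
  "H1 \<Omega> = {u. \<exists>g. has_weak_grad \<Omega> u g}"

text \<open>The choice is unique up to null subsets of \<open>\<Omega>\<close> when \<open>\<Omega>\<close> is open and \<open>u \<in> H1 \<Omega>\<close>.\<close>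

definition weak_grad :: "(real^'n) set \<Rightarrow> (real^'n \<Rightarrow> real) \<Rightarrow> real^'n \<Rightarrow> real^'n" where
  "weak_grad \<Omega> u = (SOME g. has_weak_grad \<Omega> u g)"

definition norm_H1 :: "(real^'n) set \<Rightarrow> (real^'n \<Rightarrow> real) \<Rightarrow> real" where
  "norm_H1 \<Omega> u = sqrt ((norm_L2 \<Omega> u)\<^sup>2 + (norm_L2 \<Omega> (weak_grad \<Omega> u))\<^sup>2)"

definition H10 :: "(real^'n) set \<Rightarrow> (real^'n \<Rightarrow> real) set" where
  "H10 \<Omega> = {u \<in> H1 \<Omega>. \<forall>\<epsilon>>0. \<exists>\<phi>\<in>test_functions \<Omega>. norm_H1 \<Omega> (\<lambda>x. u x - \<phi> x) < \<epsilon>}"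

text \<open>The dual of \<open>H10 \<Omega>\<close>; the values of its members outside \<open>H10 \<Omega>\<close> are irrelevant.\<close>

definition Hm1 :: "(real^'n) set \<Rightarrow> ((real^'n \<Rightarrow> real) \<Rightarrow> real) set" where
  "Hm1 \<Omega> = {F.
     (\<forall>u\<in>H10 \<Omega>. \<forall>v\<in>H10 \<Omega>. F (\<lambda>x. u x + v x) = F u + F v) \<and>
     (\<forall>c. \<forall>u\<in>H10 \<Omega>. F (\<lambda>x. c * u x) = c * F u) \<and>
     (\<exists>C. \<forall>u\<in>H10 \<Omega>. \<bar>F u\<bar> \<le> C * norm_H1 \<Omega> u)}"

definition M_K :: "real \<Rightarrow> (real^'n) set \<Rightarrow> (real^'n \<Rightarrow> real^'n^'n) set" where
  "M_K K \<Omega> = {\<sigma> \<in> borel_measurable (lebesgue_on \<Omega>).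
     (\<exists>C. AE x in lebesgue_on \<Omega>. norm (\<sigma> x) \<le> C) \<and>
     (AE x in lebesgue_on \<Omega>. transpose (\<sigma> x) = \<sigma> x) \<and>
     (AE x in lebesgue_on \<Omega>. \<forall>\<xi>.
        1 / K * (norm \<xi>)\<^sup>2 \<le> (\<sigma> x *v \<xi>) \<bullet> \<xi> \<and> (\<sigma> x *v \<xi>) \<bullet> \<xi> \<le> K * (norm \<xi>)\<^sup>2)}"

text \<open>The pointwise norm is the library norm of \<open>real^'n^'n\<close>, i.e. the Frobenius norm.\<close>

definition norm_Linf :: "(real^'n) set \<Rightarrow> (real^'n \<Rightarrow> real^'n^'n) \<Rightarrow> ennreal" where
  "norm_Linf A \<sigma> = esssup (lebesgue_on A) (\<lambda>x. ennreal (norm (\<sigma> x)))"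

definition boundary_layer :: "(real^'n) set \<Rightarrow> real \<Rightarrow> (real^'n) set" where
  "boundary_layer \<Omega> \<delta> = {x \<in> \<Omega>. infdist x (frontier \<Omega>) < \<delta>}"

definition energy ::
    "(real^'n) set \<Rightarrow> (real^'n \<Rightarrow> real^'n^'n) \<Rightarrow> (real^'n \<Rightarrow> real) \<Rightarrow> (real^'n \<Rightarrow> real) \<Rightarrow> real" where
  "energy \<Omega> \<sigma> u v = (LINT x|lebesgue_on \<Omega>. (\<sigma> x *v weak_grad \<Omega> u x) \<bullet> weak_grad \<Omega> v x)"

text \<open>\<open>- div (\<sigma> grad u) = F\<close> in \<open>\<Omega>\<close>, in the weak sense; no boundary condition is included.\<close>

definition weak_solution ::
    "(real^'n) set \<Rightarrow> (real^'n \<Rightarrow> real^'n^'n) \<Rightarrow> ((real^'n \<Rightarrow> real) \<Rightarrow> real) \<Rightarrow> (real^'n \<Rightarrow> real) \<Rightarrow> bool" where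
  "weak_solution \<Omega> \<sigma> F u \<longleftrightarrow> u \<in> H1 \<Omega> \<and> (\<forall>v\<in>H10 \<Omega>. energy \<Omega> \<sigma> u v = F v)"

definition weakly_converges_H10 ::
    "(real^'n) set \<Rightarrow> (nat \<Rightarrow> real^'n \<Rightarrow> real) \<Rightarrow> (real^'n \<Rightarrow> real) \<Rightarrow> bool" where
  "weakly_converges_H10 \<Omega> u_n u \<longleftrightarrow> (\<forall>L\<in>Hm1 \<Omega>. (\<lambda>n. L (u_n n)) \<longlonglongrightarrow> L u)"

text \<open>
  For coefficients in \<open>M_K K \<Omega>\<close> on a bounded open \<open>\<Omega>\<close> the Dirichlet solutions exist and are unique
  up to null sets, so quantifying over all of them amounts to speaking of the solutions.
\<close>

definition G_converges ::
    "(real^'n) set \<Rightarrow> (nat \<Rightarrow> real^'n \<Rightarrow> real^'n^'n) \<Rightarrow> (real^'n \<Rightarrow> real^'n^'n) \<Rightarrow> bool" where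
  "G_converges \<Omega> \<sigma>_n \<sigma> \<longleftrightarrow> (\<forall>F\<in>Hm1 \<Omega>. \<forall>u_n u.
     (\<forall>n. u_n n \<in> H10 \<Omega> \<and> weak_solution \<Omega> (\<sigma>_n n) F (u_n n)) \<and>
     u \<in> H10 \<Omega> \<and> weak_solution \<Omega> \<sigma> F u \<longrightarrow>
     weakly_converges_H10 \<Omega> u_n u)"

definition trace_rel :: "(real^'n) set \<Rightarrow> ((real^'n \<Rightarrow> real) \<times> (real^'n \<Rightarrow> real)) set" where
  "trace_rel \<Omega> = {(u, v). u \<in> H1 \<Omega> \<and> v \<in> H1 \<Omega> \<and> (\<lambda>x. u x - v x) \<in> H10 \<Omega>}"

definition H_half :: "(real^'n) set \<Rightarrow> (real^'n \<Rightarrow> real) set set" where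
  "H_half \<Omega> = H1 \<Omega> // trace_rel \<Omega>"

definition norm_H_half :: "(real^'n) set \<Rightarrow> (real^'n \<Rightarrow> real) set \<Rightarrow> real" where
  "norm_H_half \<Omega> \<phi> = (INF u\<in>\<phi>. norm_H1 \<Omega> u)"

text \<open>
  The dual norm on functionals on \<open>H_half \<Omega>\<close>, and the norm of operators from \<open>H_half \<Omega>\<close> to its dual.
  Both take the value \<open>\<infinity>\<close> when unbounded.
\<close>

definition norm_H_minus_half :: "(real^'n) set \<Rightarrow> ((real^'n \<Rightarrow> real) set \<Rightarrow> real) \<Rightarrow> ennreal" where
  "norm_H_minus_half \<Omega> L = (SUP \<psi>\<in>{\<psi> \<in> H_half \<Omega>. norm_H_half \<Omega> \<psi> \<le> 1}. ennreal \<bar>L \<psi>\<bar>)"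

definition boundary_op_norm ::
    "(real^'n) set \<Rightarrow> ((real^'n \<Rightarrow> real) set \<Rightarrow> (real^'n \<Rightarrow> real) set \<Rightarrow> real) \<Rightarrow> ennreal" where
  "boundary_op_norm \<Omega> T =
     (SUP \<phi>\<in>{\<phi> \<in> H_half \<Omega>. norm_H_half \<Omega> \<phi> \<le> 1}. norm_H_minus_half \<Omega> (T \<phi>))"

text \<open>
  \<open>DtN \<Omega> \<sigma> \<phi> \<psi>\<close> is the pairing of the image of \<open>\<phi>\<close> with \<open>\<psi>\<close>. The members of a class \<open>\<phi>\<close> are exactly
  its extensions to \<open>\<Omega>\<close>, so \<open>u \<in> \<phi>\<close> is the boundary condition. The value does not depend on the
  choices: the solution \<open>u\<close> is unique up to null sets, and two extensions of \<open>\<psi>\<close> differ by an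
  element of \<open>H10 \<Omega>\<close>.
\<close>

definition DtN ::
    "(real^'n) set \<Rightarrow> (real^'n \<Rightarrow> real^'n^'n) \<Rightarrow> (real^'n \<Rightarrow> real) set \<Rightarrow> (real^'n \<Rightarrow> real) set \<Rightarrow> real" where
  "DtN \<Omega> \<sigma> \<phi> \<psi> =
     energy \<Omega> \<sigma> (SOME u. u \<in> \<phi> \<and> weak_solution \<Omega> \<sigma> (\<lambda>_. 0) u) (SOME w. w \<in> \<psi>)"

end

theory Submission
  imports Defs "HOL-Library.Function_Algebras" "HOL-Library.Diagonal_Subsequence"
    "HOL-Probability.Probability_Measure"
begin

text \<open>
Call a function \<open>\<sigma>\<close>-harmonic if it solves \<open>div (\<sigma> grad u) = 0\<close> weakly. Let \<open>u\<close> be \<open>\<sigma>_n n\<close>-harmonic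
with boundary class \<open>\<phi>\<close> and \<open>v\<close> be \<open>\<sigma>\<close>-harmonic with boundary class \<open>\<psi>\<close>. By symmetry of the coefficients
the difference of the two Dirichlet-to-Neumann maps, applied to \<open>\<phi>\<close> and paired with \<open>\<psi>\<close>, is
\<open>\<integral> (\<sigma>_n n - \<sigma>) grad u \<bullet> grad v\<close> (\<open>DtN_difference\<close>). Classes of norm at most 1 have harmonic extensions
that are bounded in \<open>H1\<close> by a constant depending only on \<open>K\<close> and \<open>\<Omega>\<close> (\<open>harmonic_extension_bound\<close>).
So it suffices that this integral tends to 0 along all bounded sequences of such \<open>u\<close>, \<open>v\<close>, and by weak
compactness both sequences may be assumed to converge weakly in \<open>H1\<close>.

Let \<open>\<theta>\<close> be a smooth cutoff that is 1 outside the boundary layer of width \<open>\<delta>\<close>, vanishes near the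
boundary and has gradient at most \<open>4 / \<delta>\<close>. The products \<open>\<theta> u\<close> and \<open>\<theta> v\<close> lie in \<open>H10\<close> however bad the
boundary is (\<open>cutoff_H10\<close>). Testing the equation of each function with the cut-off other one gives
\<open>\<integral> (\<sigma>_n n - \<sigma>) grad u \<bullet> grad v
   = \<integral> (1 - \<theta>) (\<sigma>_n n - \<sigma>) grad u \<bullet> grad v - \<integral> v (\<sigma>_n n - \<sigma>) grad u \<bullet> grad \<theta>
     + \<integral> \<sigma> grad \<theta> \<bullet> (u grad v - v grad u)\<close>.
The first two integrals extend over the layer only, and are at most the supremum of \<open>\<sigma>_n n - \<sigma>\<close> there
times \<open>1 + 4 / \<delta>\<close> times a constant: this is what the factor \<open>1 / \<delta>\<close> in the hypothesis controls. In the
third one \<open>grad \<theta>\<close> has compact support in \<open>\<Omega>\<close>, so by Rellich's theorem one factor converges strongly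
while the other converges weakly, and the integral converges to the one formed with the weak limits
(\<open>cutoff_flux_continuous\<close>). If both weak limits are \<open>\<sigma>\<close>-harmonic, that one is 0 by the same testing
argument (\<open>Green_cutoff\<close>).

It remains to see that the weak limit \<open>u0\<close> of \<open>\<sigma>_n n\<close>-harmonic functions \<open>u n\<close> is \<open>\<sigma>\<close>-harmonic
(\<open>harmonic_limit\<close>); here G-convergence enters, and the same identity does the work. For a test function
\<open>\<phi>\<close> let \<open>F = - div (\<sigma> grad \<phi>)\<close>, and let \<open>z n\<close> in \<open>H10\<close> solve \<open>- div (\<sigma>_n n grad (z n)) = F\<close>; by
G-convergence \<open>z n\<close> tends to \<open>\<phi>\<close> weakly. Then \<open>F (\<theta> u n) = \<integral> \<sigma>_n n grad \<theta> \<bullet> (u n grad (z n) - z n grad (u n))\<close>.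
Replacing \<open>\<sigma>_n n\<close> by \<open>\<sigma>\<close> on the right costs an error that is small with \<open>\<delta>\<close>, and afterwards the right hand
side tends to 0, because the layer does not meet the support of \<open>\<phi>\<close> and the limit of \<open>z n\<close> is \<open>\<phi>\<close>. The left
hand side tends to \<open>F (\<theta> u0) = F u0\<close>. Hence \<open>F u0 = \<integral> \<sigma> grad \<phi> \<bullet> grad u0\<close> vanishes.

The analysis behind this is built from two sources. An abstract theory of complete spaces with a
positive semidefinite form provides the solutions of Dirichlet problems, weakly convergent
subsequences, and the density of test functions in the square-integrable functions as a consequence of
the fundamental lemma of the calculus of variations. And a single estimate for averages of translates
(\<open>nn_integral_square_average_le\<close>) yields the convergence of mollifications, Poincare's inequality,
Rellich's theorem, and the fact that \<open>\<theta> u\<close> is a limit of test functions.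
\<close>

section \<open>Complete spaces with a positive semidefinite form\<close>

text \<open>
Pointwise operations make function spaces instances of the abstract theory of this section.
\<close>

instantiation "fun" :: (type, real_vector) real_vector
begin
definition scaleR_fun :: "real \<Rightarrow> ('a \<Rightarrow> 'b) \<Rightarrow> 'a \<Rightarrow> 'b" where
  "scaleR_fun c f = (\<lambda>x. c *\<^sub>R f x)"
instance
  by standard (auto simp: scaleR_fun_def plus_fun_def fun_eq_iff algebra_simps)
end

text \<open>
The form is only positive semidefinite, because functions that agree almost everywhere are not
identified. The carrier is a set so that one space of functions can carry several forms: below, the
inner product of \<open>H1\<close> and the energies of different coefficient fields.
\<close>

locale semi_inner_space =
  fixes V :: "'v::real_vector set" and ip :: "'v \<Rightarrow> 'v \<Rightarrow> real"
  assumes subspace_V: "subspace V"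
    and ip_commute: "x \<in> V \<Longrightarrow> y \<in> V \<Longrightarrow> ip x y = ip y x"
    and ip_add_left: "x \<in> V \<Longrightarrow> y \<in> V \<Longrightarrow> z \<in> V \<Longrightarrow> ip (x + y) z = ip x z + ip y z"
    and ip_scale_left: "x \<in> V \<Longrightarrow> y \<in> V \<Longrightarrow> ip (c *\<^sub>R x) y = c * ip x y"
    and ip_self_nonneg: "x \<in> V \<Longrightarrow> 0 \<le> ip x x"
begin

definition nrm :: "'v \<Rightarrow> real" where "nrm x = sqrt (ip x x)"

lemma V_add: "x \<in> V \<Longrightarrow> y \<in> V \<Longrightarrow> x + y \<in> V"
  and V_diff: "x \<in> V \<Longrightarrow> y \<in> V \<Longrightarrow> x - y \<in> V"
  and V_scale: "x \<in> V \<Longrightarrow> c *\<^sub>R x \<in> V"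
  and V_zero: "0 \<in> V"
  and V_uminus: "x \<in> V \<Longrightarrow> - x \<in> V"
  using subspace_V by (auto simp: subspace_add subspace_diff subspace_scale subspace_0 subspace_neg)

lemmas V_closed = V_add V_diff V_scale V_zero V_uminus

lemma ip_add_right: "x \<in> V \<Longrightarrow> y \<in> V \<Longrightarrow> z \<in> V \<Longrightarrow> ip x (y + z) = ip x y + ip x z"
  by (metis V_add ip_add_left ip_commute)

lemma ip_scale_right: "x \<in> V \<Longrightarrow> y \<in> V \<Longrightarrow> ip x (c *\<^sub>R y) = c * ip x y"
  by (metis V_scale ip_scale_left ip_commute)

lemma ip_uminus_left: "x \<in> V \<Longrightarrow> y \<in> V \<Longrightarrow> ip (- x) y = - ip x y"
  using ip_scale_left[of x y "-1"] by simp

lemma ip_uminus_right: "x \<in> V \<Longrightarrow> y \<in> V \<Longrightarrow> ip x (- y) = - ip x y"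
  using ip_scale_right[of x y "-1"] by simp

lemma ip_diff_left: "x \<in> V \<Longrightarrow> y \<in> V \<Longrightarrow> z \<in> V \<Longrightarrow> ip (x - y) z = ip x z - ip y z"
  using ip_add_left[of x "- y" z] by (simp add: V_closed ip_uminus_left)

lemma ip_diff_right: "x \<in> V \<Longrightarrow> y \<in> V \<Longrightarrow> z \<in> V \<Longrightarrow> ip x (y - z) = ip x y - ip x z"
  using ip_add_right[of x y "- z"] by (simp add: V_closed ip_uminus_right)

lemmas ip_simps = ip_add_left ip_add_right ip_scale_left ip_scale_right ip_diff_left ip_diff_right

lemma nrm_nonneg: "x \<in> V \<Longrightarrow> 0 \<le> nrm x"
  by (simp add: nrm_def ip_self_nonneg)

lemma nrm_sq: "x \<in> V \<Longrightarrow> (nrm x)\<^sup>2 = ip x x"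
  by (simp add: nrm_def ip_self_nonneg)

lemma ip_quadratic:
  assumes "x \<in> V" "y \<in> V"
  shows "ip (x + t *\<^sub>R y) (x + t *\<^sub>R y) = ip x x + 2 * t * ip x y + t\<^sup>2 * ip y y"
  using assms by (simp add: V_closed ip_simps ip_commute[of y x] power2_eq_square algebra_simps)

text \<open>
Near \<open>0\<close> the linear term dominates the quadratic one. This is the step from minimality to the
Euler--Lagrange equation.
\<close>

lemma linear_coeff_zero_if_nonneg:
  fixes b c :: real
  assumes "\<And>t. 0 \<le> 2 * t * b + t\<^sup>2 * c"
  shows "b = 0"
proof (rule ccontr)
  assume b: "b \<noteq> 0"
  define t where "t = - b / (\<bar>c\<bar> + 1)"
  have t_mult: "t * (\<bar>c\<bar> + 1) = - b" by (simp add: t_def add_nonneg_eq_0_iff)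
  have "0 \<le> 2 * t * b + t\<^sup>2 * c" by (rule assms)
  also have "\<dots> \<le> 2 * t * b + t\<^sup>2 * (\<bar>c\<bar> + 1)"
    by (intro add_left_mono mult_left_mono) auto
  also have "t\<^sup>2 * (\<bar>c\<bar> + 1) = - t * b"
    using t_mult by (simp add: power2_eq_square mult.assoc)
  also have "2 * t * b + - t * b = - (b\<^sup>2 / (\<bar>c\<bar> + 1))"
    by (simp add: t_def power2_eq_square)
  finally show False using b by (auto simp: field_simps)
qed

lemma ip_Cauchy_Schwarz:
  assumes x: "x \<in> V" and y: "y \<in> V"
  shows "\<bar>ip x y\<bar> \<le> nrm x * nrm y"
proof -
  have q: "0 \<le> ip x x + 2 * t * ip x y + t\<^sup>2 * ip y y" for t
    using ip_self_nonneg[of "x + t *\<^sub>R y"] ip_quadratic[OF x y] x y by (simp add: V_closed)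
  have "(ip x y)\<^sup>2 \<le> ip x x * ip y y"
  proof (cases "ip y y = 0")
    case True
    have "ip y x = 0"
      using ip_quadratic[OF y x] ip_self_nonneg V_closed True x y
      by (intro linear_coeff_zero_if_nonneg[of _ "ip x x"])
        (metis add_0 )
    then show ?thesis using True ip_commute[OF x y] by simp
  next
    case False
    then have p: "ip y y > 0" using ip_self_nonneg[OF y] by simp
    show ?thesis using q[of "- ip x y / ip y y"] p
      by (simp add: power2_eq_square field_simps)
  qed
  then have "sqrt ((ip x y)\<^sup>2) \<le> sqrt (ip x x * ip y y)" by (rule real_sqrt_le_mono)
  then show ?thesis by (simp add: nrm_def real_sqrt_mult)
qed

lemma nrm_triangle:
  assumes x: "x \<in> V" and y: "y \<in> V"
  shows "nrm (x + y) \<le> nrm x + nrm y"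
proof (rule power2_le_imp_le)
  have "(nrm (x + y))\<^sup>2 = ip x x + 2 * ip x y + ip y y"
    using x y by (simp add: nrm_sq V_closed ip_simps ip_commute[of y x])
  also have "\<dots> \<le> (nrm x)\<^sup>2 + 2 * (nrm x * nrm y) + (nrm y)\<^sup>2"
    using ip_Cauchy_Schwarz[OF x y] by (simp add: nrm_sq x y)
  finally show "(nrm (x + y))\<^sup>2 \<le> (nrm x + nrm y)\<^sup>2"
    by (simp add: power2_eq_square algebra_simps)
qed (use nrm_nonneg x y in auto)

lemma nrm_scale: "x \<in> V \<Longrightarrow> nrm (c *\<^sub>R x) = \<bar>c\<bar> * nrm x"
  by (simp add: nrm_def ip_simps V_closed real_sqrt_mult flip: mult.assoc power2_eq_square)

lemma nrm_minus_commute: "x \<in> V \<Longrightarrow> y \<in> V \<Longrightarrow> nrm (x - y) = nrm (y - x)"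
  by (simp add: nrm_def ip_simps V_closed ip_commute)

lemma nrm_diff_triangle:
  "x \<in> V \<Longrightarrow> y \<in> V \<Longrightarrow> z \<in> V \<Longrightarrow> nrm (x - z) \<le> nrm (x - y) + nrm (y - z)"
  using nrm_triangle[of "x - y" "y - z"] by (simp add: V_closed)

lemma nrm_triangle_sub:
  "x \<in> V \<Longrightarrow> y \<in> V \<Longrightarrow> nrm x \<le> nrm (x - y) + nrm y"
  using nrm_triangle[of "x - y" y] by (simp add: V_closed)

end

locale semi_hilbert_space = semi_inner_space +
  assumes complete_V: "(\<And>n. X n \<in> V) \<Longrightarrow> (\<And>e. e > 0 \<Longrightarrow> \<exists>N. \<forall>m\<ge>N. \<forall>n\<ge>N. nrm (X m - X n) < e)
     \<Longrightarrow> \<exists>x\<in>V. (\<lambda>n. nrm (X n - x)) \<longlonglongrightarrow> 0"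
begin

text \<open>
The representing vector minimizes \<open>ip v v - 2 * F v\<close>; by the parallelogram law every minimizing sequence
is Cauchy. With the energy of a coefficient field as form this is the solution of the Dirichlet problem.
\<close>

lemma Riesz_representation:
  assumes add: "\<And>x y. x \<in> V \<Longrightarrow> y \<in> V \<Longrightarrow> F (x + y) = F x + F y"
    and scale: "\<And>c x. x \<in> V \<Longrightarrow> F (c *\<^sub>R x) = c * F x"
    and bd: "\<And>x. x \<in> V \<Longrightarrow> \<bar>F x\<bar> \<le> C * nrm x"
  shows "\<exists>u\<in>V. \<forall>v\<in>V. F v = ip u v"
proof -
  define J where "J v = ip v v - 2 * F v" for v
  have J_ge: "J v \<ge> - C\<^sup>2" if "v \<in> V" for v
  proof -
    have "J v \<ge> (nrm v)\<^sup>2 - 2 * (C * nrm v)"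
      using bd[OF that] by (simp add: J_def nrm_sq that)
    moreover have "(nrm v)\<^sup>2 - 2 * (C * nrm v) + C\<^sup>2 = (nrm v - C)\<^sup>2"
      by (simp add: power2_eq_square algebra_simps)
    ultimately show ?thesis using zero_le_power2[of "nrm v - C"] by linarith
  qed
  define m where "m = (INF v\<in>V. J v)"
  have bdd: "bdd_below (J ` V)" using J_ge by (auto intro!: bdd_belowI2)
  have m_le: "m \<le> J v" if "v \<in> V" for v
    unfolding m_def by (rule cINF_lower[OF bdd that])
  have par: "(nrm (x - y))\<^sup>2 \<le> 2 * J x + 2 * J y - 4 * m" if x: "x \<in> V" and y: "y \<in> V" for x y
  proof -
    have "J ((1/2) *\<^sub>R (x + y)) \<ge> m" by (intro m_le V_closed x y)
    moreover have "J ((1/2) *\<^sub>R (x + y)) = (ip x x + 2 * ip x y + ip y y) / 4 - F x - F y"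
      using x y by (simp add: J_def ip_simps V_closed scale add ip_commute[of y x] field_simps)
    moreover have "(nrm (x - y))\<^sup>2 = ip x x - 2 * ip x y + ip y y"
      using x y by (simp add: nrm_sq V_closed ip_simps ip_commute[of y x])
    ultimately show ?thesis by (simp add: J_def algebra_simps)
  qed
  have "\<exists>v\<in>V. J v < m + 1 / real (Suc n)" for n
  proof -
    have "(INF v\<in>V. J v) < m + 1 / real (Suc n)" by (simp add: m_def)
    then show ?thesis using V_zero by (subst (asm) cINF_less_iff) (use bdd in auto)
  qed
  then obtain X where XV: "\<And>n. X n \<in> V" and XJ: "\<And>n. J (X n) < m + 1 / real (Suc n)"
    by metis
  have cau: "\<exists>N. \<forall>i\<ge>N. \<forall>j\<ge>N. nrm (X i - X j) < e" if e: "e > 0" for e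
  proof -
    obtain N :: nat where N: "1 / real (Suc N) < e\<^sup>2 / 4"
      using nat_approx_posE[of "e\<^sup>2/4"] e by auto
    have "nrm (X i - X j) < e" if ij: "i \<ge> N" "j \<ge> N" for i j
    proof (rule power2_less_imp_less)
      have "1 / real (Suc i) \<le> 1 / real (Suc N)" "1 / real (Suc j) \<le> 1 / real (Suc N)"
        using ij by (auto simp: field_simps)
      then show "(nrm (X i - X j))\<^sup>2 < e\<^sup>2"
        using par[OF XV XV, of i j] XJ[of i] XJ[of j] N by linarith
    qed (use e in auto)
    then show ?thesis by blast
  qed
  obtain u where u: "u \<in> V" and lim: "(\<lambda>n. nrm (X n - u)) \<longlonglongrightarrow> 0"
    using complete_V[of X, OF XV cau] by blast
  have Ju: "J u \<le> m"
  proof -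
    have est: "J u \<le> m + 1 / real (Suc n) + (nrm (X n - u) * nrm (X n - u)
        + 2 * (nrm (X n - u) * nrm u) + 2 * \<bar>C\<bar> * nrm (X n - u)) + 0"  for n
    proof -
      let ?d = "X n - u"
      have d: "?d \<in> V" by (intro V_closed XV u)
      have "J (X n) = J (u + ?d)" by simp
      also have "\<dots> = J u + ip ?d ?d + 2 * ip ?d u - 2 * F ?d"
        unfolding J_def add[OF u d] using u d by (simp only: V_closed ip_simps ip_commute[of u ?d]) simp
      finally have "J u = J (X n) - ip ?d ?d - 2 * ip ?d u + 2 * F ?d" by simp
      moreover have "\<bar>F ?d\<bar> \<le> \<bar>C\<bar> * nrm ?d"
        using bd[OF d] nrm_nonneg[OF d] by (meson abs_ge_self dual_order.trans mult_right_mono)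
      moreover have "ip ?d ?d = nrm ?d * nrm ?d" using nrm_sq[OF d] by (simp add: power2_eq_square)
      moreover have "ip ?d ?d \<ge> 0" by (rule ip_self_nonneg[OF d])
      ultimately show ?thesis using XJ[of n] ip_Cauchy_Schwarz[OF d u] by linarith
    qed
    have "(\<lambda>n. m + 1 / real (Suc n) + (nrm (X n - u) * nrm (X n - u)
        + 2 * (nrm (X n - u) * nrm u) + 2 * \<bar>C\<bar> * nrm (X n - u)) + 0) \<longlonglongrightarrow>
       m + 0 + (0 * 0 + 2 * (0 * nrm u) + 2 * \<bar>C\<bar> * 0) + 0"
      by (intro tendsto_intros lim LIMSEQ_Suc[OF lim_1_over_n])
    from LIMSEQ_le_const[OF this] est show ?thesis by (simp add: exI[of _ 0])
  qed
  have "F v = ip u v" if v: "v \<in> V" for v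
  proof -
    have "0 \<le> 2 * t * (ip u v - F v) + t\<^sup>2 * ip v v" for t
    proof -
      have "J u \<le> J (u + t *\<^sub>R v)" using Ju m_le[of "u + t *\<^sub>R v"] u v by (auto simp: V_closed)
      then show ?thesis
        using u v by (simp add: J_def ip_quadratic add scale V_closed algebra_simps)
    qed
    from linear_coeff_zero_if_nonneg[OF this] show ?thesis by simp
  qed
  with u show ?thesis by blast
qed

text \<open>
The space \<open>H10\<close> is of this form, with the test functions as \<open>M\<close>.
\<close>

definition cl :: "'a set \<Rightarrow> 'a set" where
  "cl M = {x \<in> V. \<forall>e>0. \<exists>m\<in>M. nrm (x - m) < e}"

lemma cl_closed:
  assumes M: "M \<subseteq> V" and X: "\<And>n. X n \<in> cl M" and x: "x \<in> V" and lim: "(\<lambda>n. nrm (X n - x)) \<longlonglongrightarrow> 0"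
  shows "x \<in> cl M"
  unfolding cl_def
proof (intro CollectI conjI allI impI x)
  fix e :: real assume e: "e > 0"
  obtain n where n: "nrm (X n - x) < e/2"
    using order_tendstoD(2)[OF lim, of "e/2"] e by (auto simp: eventually_sequentially)
  obtain m where m: "m \<in> M" "nrm (X n - m) < e/2" and Xn: "X n \<in> V"
    using X[of n] e unfolding cl_def by (auto dest!: spec[of _ "e/2"])
  have "nrm (x - m) \<le> nrm (x - X n) + nrm (X n - m)"
    using nrm_diff_triangle[OF x Xn] m M by auto
  then show "\<exists>m\<in>M. nrm (x - m) < e"
    using m n nrm_minus_commute[OF x Xn] by (intro bexI[of _ m]) auto
qed

lemma cl_subset: "M \<subseteq> V \<Longrightarrow> M \<subseteq> cl M"
proof
  fix x assume "M \<subseteq> V" "x \<in> M"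
  moreover have "nrm (x - x) = 0" using ip_scale_left[of 0 0 0] V_zero by (simp add: nrm_def)
  ultimately have "x \<in> V" "\<forall>e>0. \<exists>m\<in>M. nrm (x - m) < e" by (blast, force)
  then show "x \<in> cl M" unfolding cl_def by blast
qed

lemma subspace_cl:
  assumes M: "M \<subseteq> V" and sub: "subspace M"
  shows "subspace (cl M)"
proof (rule subspaceI)
  show "0 \<in> cl M" using cl_subset[OF M] subspace_0[OF sub] by auto
next
  fix x y assume x: "x \<in> cl M" and y: "y \<in> cl M"
  show "x + y \<in> cl M" unfolding cl_def
  proof (intro CollectI conjI allI impI)
    show "x + y \<in> V" using x y by (auto simp: cl_def V_closed)
    fix e :: real assume "e > 0"
    then have "e/2 > 0" by simp
    then obtain m m' where m: "m \<in> M" "nrm (x - m) < e/2" "m' \<in> M" "nrm (y - m') < e/2"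
      using x y unfolding cl_def by blast
    have "nrm ((x - m) + (y - m')) \<le> nrm (x - m) + nrm (y - m')"
      using m x y M by (intro nrm_triangle V_closed) (auto simp: cl_def)
    then show "\<exists>m\<in>M. nrm (x + y - m) < e"
      using m sub by (intro bexI[of _ "m + m'"]) (auto simp: subspace_add algebra_simps)
  qed
next
  fix c x assume x: "x \<in> cl M"
  show "c *\<^sub>R x \<in> cl M" unfolding cl_def
  proof (intro CollectI conjI allI impI)
    show "c *\<^sub>R x \<in> V" using x by (auto simp: cl_def V_closed)
    fix e :: real assume e: "e > 0"
    then have "e / (\<bar>c\<bar> + 1) > 0" by simp
    then obtain m where m: "m \<in> M" "nrm (x - m) < e / (\<bar>c\<bar> + 1)"
      using x unfolding cl_def by blast
    have d: "x - m \<in> V" using m x M by (auto simp: cl_def intro!: V_closed)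
    have "nrm (c *\<^sub>R (x - m)) \<le> (\<bar>c\<bar> + 1) * nrm (x - m)"
      using d nrm_nonneg[OF d] by (auto simp: nrm_scale intro!: mult_right_mono)
    also have "\<dots> < e" using m(2) by (simp add: field_simps)
    finally show "\<exists>m\<in>M. nrm (c *\<^sub>R x - m) < e"
      using m sub by (intro bexI[of _ "c *\<^sub>R m"]) (auto simp: subspace_scale scaleR_diff_right)
  qed
qed

lemma semi_hilbert_cl:
  assumes M: "M \<subseteq> V" and sub: "subspace M"
  shows "semi_hilbert_space (cl M) ip"
proof -
  have clV: "cl M \<subseteq> V" by (auto simp: cl_def)
  interpret S: semi_inner_space "cl M" ip
  proof
    show "subspace (cl M)" by (rule subspace_cl[OF M sub])
    fix x y z c assume "x \<in> cl M"
    then have x: "x \<in> V" using clV by auto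
    show "0 \<le> ip x x" by (rule ip_self_nonneg[OF x])
    assume "y \<in> cl M"
    then have y: "y \<in> V" using clV by auto
    show "ip x y = ip y x" by (rule ip_commute[OF x y])
    show "ip (c *\<^sub>R x) y = c * ip x y" by (rule ip_scale_left[OF x y])
    assume "z \<in> cl M"
    then have z: "z \<in> V" using clV by auto
    show "ip (x + y) z = ip x z + ip y z" by (rule ip_add_left[OF x y z])
  qed
  show ?thesis
  proof
    fix X :: "nat \<Rightarrow> 'a"
    assume X: "\<And>n. X n \<in> cl M" and c: "\<And>e. e > 0 \<Longrightarrow> \<exists>N. \<forall>m\<ge>N. \<forall>n\<ge>N. S.nrm (X m - X n) < e"
    obtain x where "x \<in> V" "(\<lambda>n. nrm (X n - x)) \<longlonglongrightarrow> 0"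
      using complete_V[of X] X clV c by (meson subsetD)
    with cl_closed[of M X, OF M X] show "\<exists>x\<in>cl M. (\<lambda>n. S.nrm (X n - x)) \<longlonglongrightarrow> 0" by blast
  qed
qed

lemma orthogonal_projection_on_cl:
  assumes M: "M \<subseteq> V" and sub: "subspace M" and y: "y \<in> V"
  shows "\<exists>p\<in>cl M. \<forall>m\<in>cl M. ip y m = ip p m"
proof -
  interpret S: semi_hilbert_space "cl M" ip by (rule semi_hilbert_cl[OF M sub])
  have clV: "x \<in> cl M \<Longrightarrow> x \<in> V" for x by (auto simp: cl_def)
  show ?thesis
  proof (rule S.Riesz_representation[where F = "ip y" and C = "nrm y"])
    show "\<bar>ip y x\<bar> \<le> nrm y * nrm x" if "x \<in> cl M" for x
      by (rule ip_Cauchy_Schwarz[OF y clV[OF that]])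
  qed (simp_all add: ip_add_right ip_scale_right y clV)
qed

text \<open>
The difference of \<open>f\<close> and its projection is orthogonal to \<open>M\<close>.
\<close>

lemma dense_if_orthogonal_trivial:
  assumes M: "M \<subseteq> V" and sub: "subspace M"
    and orth: "\<And>f. f \<in> V \<Longrightarrow> (\<And>m. m \<in> M \<Longrightarrow> ip f m = 0) \<Longrightarrow> ip f f = 0"
    and f: "f \<in> V" and e: "e > 0"
  shows "\<exists>m\<in>M. nrm (f - m) < e"
proof -
  obtain p where p: "p \<in> cl M" "\<forall>m\<in>cl M. ip f m = ip p m"
    using orthogonal_projection_on_cl[OF M sub f] by blast
  have pV: "p \<in> V" using p by (auto simp: cl_def)
  have "ip (f - p) (f - p) = 0"
    using p cl_subset[OF M] M f pV by (intro orth V_closed) (auto simp: ip_diff_left subset_iff)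
  then have 0: "nrm (f - p) = 0" by (simp add: nrm_def)
  obtain m where m: "m \<in> M" "nrm (p - m) < e" using p e by (auto simp: cl_def)
  then show ?thesis using nrm_diff_triangle[OF f pV, of m] M 0 by (intro bexI[of _ m]) auto
qed

text \<open>
A diagonal argument yields a subsequence whose inner products with every member of the sequence
converge. By boundedness this extends to the closed span of the sequence, where the limit is represented
by a vector; other directions enter only through their projection to that span.
\<close>

lemma weakly_convergent_subsequence:
  assumes X: "\<And>n. X n \<in> V" and R: "\<And>n. nrm (X n) \<le> R"
  shows "\<exists>r x. strict_mono (r::nat\<Rightarrow>nat) \<and> x \<in> V \<and> (\<forall>y\<in>V. (\<lambda>k. ip (X (r k)) y) \<longlonglongrightarrow> ip x y)"
proof -
  have bdd: "\<bar>ip (X n) y\<bar> \<le> R * nrm y" if "y \<in> V" for n y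
    by (rule order_trans[OF ip_Cauchy_Schwarz[OF X that] mult_right_mono[OF R nrm_nonneg[OF that]]])
  interpret D: subseqs "\<lambda>m s. convergent (\<lambda>k. ip (X (s k)) (X m))"
  proof
    fix m and s :: "nat \<Rightarrow> nat" assume "strict_mono s"
    have "bounded (range (\<lambda>k. ip (X (s k)) (X m)))"
      using bdd[OF X] by (auto simp: bounded_iff)
    from bounded_imp_convergent_subsequence[OF this]
    show "\<exists>r'. strict_mono r' \<and> convergent (\<lambda>k. ip (X ((s \<circ> r') k)) (X m))"
      by (auto simp: o_def convergent_def)
  qed
  define r where "r = D.diagseq"
  have r: "strict_mono r" unfolding r_def by (rule D.subseq_diagseq)
  have rX: "convergent (\<lambda>k. ip (X (r k)) (X m))" for m
  proof -
    have "convergent (\<lambda>k. ip (X ((D.diagseq \<circ> (+) (Suc m)) k)) (X m))"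
    proof (rule D.diagseq_holds)
      fix n s r' assume "strict_mono (r'::nat\<Rightarrow>nat)" "convergent (\<lambda>k. ip (X (s k)) (X n))"
      then show "convergent (\<lambda>k. ip (X ((s \<circ> r') k)) (X n))"
        using convergent_subseq_convergent[of "\<lambda>k. ip (X (s k)) (X n)" r'] by (simp add: o_def)
    qed
    then show ?thesis
      using convergent_ignore_initial_segment[of "\<lambda>k. ip (X (r k)) (X m)" "Suc m"]
      by (simp add: r_def o_def add.commute)
  qed
  define M where "M = span (range X)"
  have sub: "subspace M" by (simp add: M_def)
  have MV: "M \<subseteq> V" unfolding M_def by (rule span_minimal[OF _ subspace_V]) (use X in auto)
  have conv_M: "convergent (\<lambda>k. ip (X (r k)) y)" if "y \<in> M" for y
  proof -
    have "subspace {y\<in>V. convergent (\<lambda>k. ip (X (r k)) y)}"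
    proof (rule subspaceI)
      show "0 \<in> {y\<in>V. convergent (\<lambda>k. ip (X (r k)) y)}"
        using ip_scale_right[of _ 0 0] X by (simp add: V_zero convergent_const)
    next
      fix x y assume "x \<in> {y\<in>V. convergent (\<lambda>k. ip (X (r k)) y)}" "y \<in> {y\<in>V. convergent (\<lambda>k. ip (X (r k)) y)}"
      then show "x + y \<in> {y\<in>V. convergent (\<lambda>k. ip (X (r k)) y)}"
        using convergent_add[of "\<lambda>k. ip (X (r k)) x" "\<lambda>k. ip (X (r k)) y"]
        by (simp add: V_add ip_add_right X)
    next
      fix c x assume "x \<in> {y\<in>V. convergent (\<lambda>k. ip (X (r k)) y)}"
      then show "c *\<^sub>R x \<in> {y\<in>V. convergent (\<lambda>k. ip (X (r k)) y)}"
        using convergent_mult[OF convergent_const, of "\<lambda>k. ip (X (r k)) x" c]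
        by (simp add: V_scale ip_scale_right X)
    qed
    then have "M \<subseteq> {y\<in>V. convergent (\<lambda>k. ip (X (r k)) y)}"
      unfolding M_def using rX X by (intro span_minimal) auto
    with that show ?thesis by auto
  qed
  have conv_cl: "convergent (\<lambda>k. ip (X (r k)) y)" if y: "y \<in> cl M" for y
  proof (rule Cauchy_convergent, rule metric_CauchyI)
    fix e :: real assume e: "e > 0"
    have yV: "y \<in> V" using y by (simp add: cl_def)
    have R0: "R \<ge> 0" using R[of 0] nrm_nonneg[OF X, of 0] by linarith
    have "e / (4 * (R + 1)) > 0" using e R0 by simp
    then obtain m where m: "m \<in> M" "nrm (y - m) < e / (4 * (R + 1))"
      using y by (auto simp: cl_def)
    have mV: "m \<in> V" using m MV by auto
    have d: "y - m \<in> V" by (intro V_closed yV mV)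
    have small: "\<bar>ip (X n) y - ip (X n) m\<bar> < e/4" for n
    proof -
      have "\<bar>ip (X n) y - ip (X n) m\<bar> \<le> R * nrm (y - m)"
        using bdd[OF d, of n] by (simp add: ip_simps X yV mV)
      also have "\<dots> \<le> (R + 1) * nrm (y - m)" using nrm_nonneg[OF d] by (simp add: algebra_simps)
      also have "\<dots> < e/4" using m(2) R0 by (simp add: field_simps)
      finally show ?thesis .
    qed
    obtain N where N: "\<And>i j. i \<ge> N \<Longrightarrow> j \<ge> N \<Longrightarrow> dist (ip (X (r i)) m) (ip (X (r j)) m) < e/4"
      using convergent_Cauchy[OF conv_M[OF m(1)]] e by (meson metric_CauchyD divide_pos_pos zero_less_numeral)
    show "\<exists>N. \<forall>i\<ge>N. \<forall>j\<ge>N. dist (ip (X (r i)) y) (ip (X (r j)) y) < e"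
    proof (intro exI[of _ N] allI impI)
      fix i j assume "i \<ge> N" "j \<ge> N"
      from N[OF this] small[of "r i"] small[of "r j"] e
      show "dist (ip (X (r i)) y) (ip (X (r j)) y) < e"
        unfolding dist_real_def by linarith
    qed
  qed
  interpret S: semi_hilbert_space "cl M" ip by (rule semi_hilbert_cl[OF MV sub])
  have clV: "x \<in> cl M \<Longrightarrow> x \<in> V" for x by (auto simp: cl_def)
  define F where "F y = lim (\<lambda>k. ip (X (r k)) y)" for y
  have F: "(\<lambda>k. ip (X (r k)) y) \<longlonglongrightarrow> F y" if "y \<in> cl M" for y
    unfolding F_def using conv_cl[OF that] by (simp add: convergent_LIMSEQ_iff)
  have "\<exists>x\<in>cl M. \<forall>y\<in>cl M. F y = ip x y"
  proof (rule S.Riesz_representation[where C = R])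
    fix x y assume xy: "x \<in> cl M" "y \<in> cl M"
    have "(\<lambda>k. ip (X (r k)) (x + y)) \<longlonglongrightarrow> F x + F y"
      using tendsto_add[OF F[OF xy(1)] F[OF xy(2)]] xy by (simp add: ip_simps clV X)
    then show "F (x + y) = F x + F y" using F[OF S.V_add[OF xy]] LIMSEQ_unique by blast
  next
    fix c x assume x: "x \<in> cl M"
    have "(\<lambda>k. ip (X (r k)) (c *\<^sub>R x)) \<longlonglongrightarrow> c * F x"
      using tendsto_mult_left[OF F[OF x], of c] x by (simp add: ip_simps clV X)
    then show "F (c *\<^sub>R x) = c * F x" using F[OF S.V_scale[OF x]] LIMSEQ_unique by blast
  next
    fix x assume x: "x \<in> cl M"
    show "\<bar>F x\<bar> \<le> R * S.nrm x"
      using tendsto_rabs[OF F[OF x]] bdd[OF clV[OF x]]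
      by (intro LIMSEQ_le_const2[where X = "\<lambda>k. \<bar>ip (X (r k)) x\<bar>"]) auto
  qed
  then obtain x where x: "x \<in> cl M" and Fx: "\<And>y. y \<in> cl M \<Longrightarrow> F y = ip x y" by blast
  have XM: "X k \<in> cl M" for k
    using cl_subset[OF MV] by (auto simp: M_def span_base)
  have "(\<lambda>k. ip (X (r k)) y) \<longlonglongrightarrow> ip x y" if y: "y \<in> V" for y
  proof -
    obtain p where p: "p \<in> cl M" "\<forall>m\<in>cl M. ip y m = ip p m"
      using orthogonal_projection_on_cl[OF MV sub y] by blast
    have "ip (X k) y = ip (X k) p" for k
      using p XM[of k] y X by (metis ip_commute clV)
    moreover have "ip x y = ip x p" using p x y by (metis ip_commute clV)
    ultimately show ?thesis using F[OF p(1)] Fx[OF p(1)] by simp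
  qed
  then show ?thesis using r clV[OF x] by blast
qed

end

section \<open>Smooth functions\<close>

definition smooth :: "(real^'n \<Rightarrow> real) \<Rightarrow> bool" where
  "smooth f \<longleftrightarrow> (\<forall>k. C_k k f)"

definition grad :: "(real^'n \<Rightarrow> real) \<Rightarrow> real^'n \<Rightarrow> real^'n" where
  "grad f x = (\<chi> i. partial_deriv i f x)"

lemma partial_derivI:
  assumes "(f has_derivative D) (at x)"
  shows "partial_deriv i f x = D (axis i 1)"
  unfolding partial_deriv_def using frechet_derivative_at[OF assms] by simp

lemma linear_eq_inner_axis:
  fixes D :: "real^'n \<Rightarrow> real"
  assumes "linear D"
  shows "D h = (\<chi> i. D (axis i 1)) \<bullet> h"
proof -
  have "D h = D (\<Sum>i\<in>UNIV. (h $ i) *\<^sub>R axis i 1)"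
    using basis_expansion[of h] by (simp add: scalar_mult_eq_scaleR)
  also have "\<dots> = (\<Sum>i\<in>UNIV. h $ i * D (axis i 1))"
    by (simp add: linear_sum[OF assms] linear_scale[OF assms])
  also have "\<dots> = (\<chi> i. D (axis i 1)) \<bullet> h"
    unfolding inner_vec_def inner_real_def by (rule sum.cong) (auto simp only: vec_lambda_beta mult.commute)
  finally show ?thesis .
qed

lemma has_derivative_grad:
  assumes "f differentiable (at x)"
  shows "(f has_derivative (\<lambda>h. grad f x \<bullet> h)) (at x)"
proof -
  obtain D where D: "(f has_derivative D) (at x)" using assms by (auto simp: differentiable_def)
  have "D = (\<lambda>h. grad f x \<bullet> h)"
    unfolding grad_def partial_derivI[OF D]
    by (rule ext) (rule linear_eq_inner_axis[OF has_derivative_linear[OF D]])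
  with D show ?thesis by simp
qed

lemma C_k_Suc_imp: "C_k (Suc k) f \<Longrightarrow> C_k k f"
proof (induction k arbitrary: f)
  case 0 then show ?case by (auto intro: differentiable_imp_continuous_on)
next
  case (Suc k) then show ?case by auto
qed

lemma smooth_partial: "smooth f \<Longrightarrow> smooth (partial_deriv i f)"
  unfolding smooth_def using C_k.simps(2) by blast

lemma smooth_differentiable: "smooth f \<Longrightarrow> f differentiable (at x)"
  unfolding smooth_def using C_k.simps(2)[of 0 f]
  by (metis UNIV_I differentiable_on_def)

lemma smooth_continuous: "smooth f \<Longrightarrow> continuous_on A f"
  unfolding smooth_def by (metis C_k.simps(1) continuous_on_subset subset_UNIV)

lemma smooth_has_derivative: "smooth f \<Longrightarrow> (f has_derivative (\<lambda>h. grad f x \<bullet> h)) (at x)"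
  by (rule has_derivative_grad[OF smooth_differentiable])

lemma smooth_continuous_grad:
  assumes "smooth f" shows "continuous_on A (grad f)"
  unfolding grad_def[abs_def] by (intro continuous_intros smooth_continuous smooth_partial assms)

lemma partial_deriv_add:
  assumes "f differentiable (at x)" "g differentiable (at x)"
  shows "partial_deriv i (\<lambda>x. f x + g x) x = partial_deriv i f x + partial_deriv i g x"
  using partial_derivI[OF has_derivative_add[OF has_derivative_grad has_derivative_grad, OF assms]]
  by (simp add: grad_def inner_axis)

lemma partial_deriv_mult:
  assumes "f differentiable (at x)" "g differentiable (at x)"
  shows "partial_deriv i (\<lambda>x. f x * g x) x = partial_deriv i f x * g x + f x * partial_deriv i g x"
  using partial_derivI[OF has_derivative_mult[OF has_derivative_grad has_derivative_grad, OF assms]]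
  by (simp add: grad_def inner_axis)

lemma partial_deriv_const: "partial_deriv i (\<lambda>x. c) = (\<lambda>x. 0)"
  using partial_derivI[OF has_derivative_const] by (auto simp: fun_eq_iff)

lemma partial_deriv_translate:
  assumes "f differentiable (at (x - c))"
  shows "partial_deriv i (\<lambda>y. f (y - c)) x = partial_deriv i f (x - c)"
proof -
  have "((\<lambda>y. f (y - c)) has_derivative (\<lambda>h. grad f (x - c) \<bullet> (h - 0))) (at x)"
    by (rule has_derivative_compose[of "\<lambda>y. y - c" "\<lambda>h. h - 0" x UNIV f])
       (auto intro!: derivative_eq_intros has_derivative_grad[OF assms])
  from partial_derivI[OF this] show ?thesis by (simp add: grad_def inner_axis)
qed

lemma C_k_const: "C_k k (\<lambda>x. c)"
  by (induction k arbitrary: c) (auto simp: partial_deriv_const)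

lemma differentiable_on_UNIV: "f differentiable_on UNIV \<longleftrightarrow> (\<forall>x. f differentiable (at x))"
  by (simp add: differentiable_on_def)

lemma C_k_add: "C_k k f \<Longrightarrow> C_k k g \<Longrightarrow> C_k k (\<lambda>x. f x + g x)"
proof (induction k arbitrary: f g)
  case 0 then show ?case by (auto intro: continuous_on_add)
next
  case (Suc k)
  then have "partial_deriv i (\<lambda>x. f x + g x) = (\<lambda>x. partial_deriv i f x + partial_deriv i g x)" for i
    by (auto simp: fun_eq_iff differentiable_on_UNIV intro!: partial_deriv_add)
  with Suc show ?case by (auto simp: differentiable_on_UNIV)
qed

lemma C_k_mult: "C_k k f \<Longrightarrow> C_k k g \<Longrightarrow> C_k k (\<lambda>x. f x * g x)"
proof (induction k arbitrary: f g)
  case 0 then show ?case by (auto intro: continuous_on_mult)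
next
  case (Suc k)
  then have "partial_deriv i (\<lambda>x. f x * g x) = (\<lambda>x. partial_deriv i f x * g x + f x * partial_deriv i g x)" for i
    by (auto simp: fun_eq_iff differentiable_on_UNIV intro!: partial_deriv_mult)
  with Suc C_k_Suc_imp[OF Suc.prems(1)] C_k_Suc_imp[OF Suc.prems(2)] show ?case
    by (auto simp: differentiable_on_UNIV intro!: C_k_add)
qed

lemma C_k_translate: "C_k k f \<Longrightarrow> C_k k (\<lambda>y. f (y - c))"
proof (induction k arbitrary: f)
  case 0 then show ?case by (auto intro!: continuous_on_compose2[of UNIV f] continuous_intros)
next
  case (Suc k)
  then have "partial_deriv i (\<lambda>y. f (y - c)) = (\<lambda>y. partial_deriv i f (y - c))" for i
    by (auto simp: fun_eq_iff differentiable_on_UNIV partial_deriv_translate)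
  moreover have "(\<lambda>y. f (y - c)) differentiable (at x)" for x
    using differentiable_chain_at[of "\<lambda>y. y - c" x f] Suc.prems
    by (auto simp: differentiable_on_UNIV o_def)
  ultimately show ?case using Suc by (simp add: differentiable_on_UNIV)
qed

lemma smooth_const: "smooth (\<lambda>x. c)" by (simp add: smooth_def C_k_const)
lemma smooth_add: "smooth f \<Longrightarrow> smooth g \<Longrightarrow> smooth (\<lambda>x. f x + g x)" by (simp add: smooth_def C_k_add)
lemma smooth_mult: "smooth f \<Longrightarrow> smooth g \<Longrightarrow> smooth (\<lambda>x. f x * g x)" by (simp add: smooth_def C_k_mult)
lemma smooth_translate: "smooth f \<Longrightarrow> smooth (\<lambda>y. f (y - c))" by (simp add: smooth_def C_k_translate)

lemma smooth_prod:
  assumes "finite I" "\<And>i. i \<in> I \<Longrightarrow> smooth (f i)"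
  shows "smooth (\<lambda>x. \<Prod>i\<in>I. f i x)"
  using assms by (induction I rule: finite_induct) (auto simp: smooth_const intro: smooth_mult)

lemma grad_nth: "grad f x $ i = partial_deriv i f x" by (simp add: grad_def)

section \<open>Test functions\<close>

lemma test_functionsI:
  assumes "smooth f" "compact S" "S \<subseteq> \<Omega>" "\<And>x. x \<notin> S \<Longrightarrow> f x = 0"
  shows "f \<in> test_functions \<Omega>"
proof -
  have "closure {x. f x \<noteq> 0} \<subseteq> S"
    using assms by (intro closure_minimal compact_imp_closed) auto
  moreover from this have "compact (closure {x. f x \<noteq> 0})"
    using compact_Int_closed[OF assms(2) closed_closure] by (metis inf.absorb2)
  ultimately show ?thesis using assms unfolding test_functions_def smooth_def by auto
qed

lemma test_smooth: "f \<in> test_functions \<Omega> \<Longrightarrow> smooth f"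
  by (simp add: test_functions_def smooth_def)

text \<open>
The same compact set serves for \<open>f\<close> and its derivatives, as \<open>f\<close> vanishes near every point outside its
support.
\<close>

lemma test_functionsE:
  assumes "f \<in> test_functions \<Omega>"
  obtains S where "compact S" "S \<subseteq> \<Omega>" "\<And>x. x \<notin> S \<Longrightarrow> f x = 0" "\<And>x i. x \<notin> S \<Longrightarrow> partial_deriv i f x = 0"
proof
  let ?S = "closure {x. f x \<noteq> 0}"
  show "compact ?S" "?S \<subseteq> \<Omega>" using assms by (auto simp: test_functions_def)
  show *: "f x = 0" if "x \<notin> ?S" for x
    using that closure_subset[of "{x. f x \<noteq> 0}"] by auto
  show "partial_deriv i f x = 0" if x: "x \<notin> ?S" for x i
  proof -
    have "(f has_derivative (\<lambda>h. 0)) (at x)"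
    proof (rule has_derivative_transform_within_open[of "\<lambda>x. 0" _ x UNIV "- ?S"])
      show "((\<lambda>x. 0) has_derivative (\<lambda>h. 0)) (at x)" by simp
      show "open (- ?S)" by (rule open_Compl[OF closed_closure])
      show "x \<in> - ?S" using x by simp
      show "0 = f y" if "y \<in> - ?S" for y using *[of y] that by simp
    qed
    from partial_derivI[OF this] show ?thesis by simp
  qed
qed

lemma test_partial:
  assumes "f \<in> test_functions \<Omega>" shows "partial_deriv i f \<in> test_functions \<Omega>"
proof -
  obtain S where S: "compact S" "S \<subseteq> \<Omega>" "\<And>x i. x \<notin> S \<Longrightarrow> partial_deriv i f x = 0"
    using test_functionsE[OF assms] by metis
  show ?thesis by (rule test_functionsI[OF smooth_partial[OF test_smooth[OF assms]] S])
qed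

lemma test_mult_smooth:
  assumes "f \<in> test_functions \<Omega>" "smooth g" shows "(\<lambda>x. f x * g x) \<in> test_functions \<Omega>"
proof -
  obtain S where S: "compact S" "S \<subseteq> \<Omega>" "\<And>x. x \<notin> S \<Longrightarrow> f x = 0"
    using test_functionsE[OF assms(1)] by metis
  show ?thesis
    by (rule test_functionsI[OF smooth_mult[OF test_smooth[OF assms(1)] assms(2)] S(1,2)]) (simp add: S(3))
qed

lemma test_add:
  assumes "f \<in> test_functions \<Omega>" "g \<in> test_functions \<Omega>" shows "(\<lambda>x. f x + g x) \<in> test_functions \<Omega>"
proof -
  obtain S T where S: "compact S" "S \<subseteq> \<Omega>" "\<And>x. x \<notin> S \<Longrightarrow> f x = 0"
    and T: "compact T" "T \<subseteq> \<Omega>" "\<And>x. x \<notin> T \<Longrightarrow> g x = 0"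
    by (metis assms test_functionsE)
  show ?thesis
    by (rule test_functionsI[of _ "S \<union> T" \<Omega>]) (use S T in \<open>auto intro!: smooth_add test_smooth[OF assms(1)] test_smooth[OF assms(2)]\<close>)
qed

lemma test_scale: "f \<in> test_functions \<Omega> \<Longrightarrow> (\<lambda>x. c * f x) \<in> test_functions \<Omega>"
  using test_mult_smooth[of f \<Omega> "\<lambda>_. c"] by (simp add: smooth_const mult.commute)

lemma test_zero: "(\<lambda>x. 0) \<in> test_functions \<Omega>"
  by (rule test_functionsI[of _ "{}"]) (auto simp: smooth_const)

lemma subspace_test: "subspace (test_functions \<Omega>)"
  unfolding subspace_def
  using test_zero test_add test_scale by (auto simp: plus_fun_def scaleR_fun_def zero_fun_def)

section \<open>Bump functions on boxes\<close>

text \<open>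
For \<open>p = 1\<close> this is the classical smooth function \<open>exp (- 1 / t)\<close>, extended by \<open>0\<close>. The polynomial factor
closes the family under differentiation, so that smoothness of all its members follows by one induction.
\<close>

definition hump :: "real poly \<Rightarrow> real \<Rightarrow> real" where
  "hump p t = (if t \<le> 0 then 0 else poly p (inverse t) * exp (- inverse t))"

lemma poly_times_exp_tendsto_0: "((\<lambda>s. poly p s * exp (- s)) \<longlongrightarrow> (0::real)) at_top"
proof -
  have "((\<lambda>s. \<Sum>i\<le>degree p. coeff p i * (s ^ i / exp s)) \<longlongrightarrow> (\<Sum>i\<le>degree p. coeff p i * 0)) at_top"
    by (intro tendsto_intros tendsto_power_div_exp_0)
  then show ?thesis
    by (simp add: poly_altdef sum_distrib_right exp_minus divide_inverse mult.assoc)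
qed

lemma hump_tendsto_0: "((\<lambda>t. hump p t) \<longlongrightarrow> 0) (at 0)"
proof (rule filterlim_split_at)
  show "((\<lambda>t. hump p t) \<longlongrightarrow> 0) (at_left 0)"
    by (rule tendsto_eventually) (auto simp: eventually_at_filter hump_def)
  have "((\<lambda>t. poly p (inverse t) * exp (- inverse t)) \<longlongrightarrow> 0) (at_right 0)"
    by (rule filterlim_compose[OF poly_times_exp_tendsto_0 filterlim_inverse_at_top_right])
  then show "((\<lambda>t. hump p t) \<longlongrightarrow> 0) (at_right 0)"
    by (rule Lim_transform_eventually) (auto simp: eventually_at_filter hump_def)
qed

definition hump_deriv :: "real poly \<Rightarrow> real poly" where
  "hump_deriv p = [:0, 0, 1:] * (p - pderiv p)"

text \<open>
At \<open>0\<close> the difference quotient of \<open>hump p\<close> is again a hump, with polynomial \<open>[:0, 1:] * p\<close>, and tends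
to \<open>0\<close>.
\<close>

lemma hump_has_derivative: "(hump p has_real_derivative hump (hump_deriv p) t) (at t)"
proof -
  consider "t < 0" | "t = 0" | "t > 0" by linarith
  then show ?thesis
  proof cases
    case 1
    have "((\<lambda>t. 0) has_real_derivative 0) (at t)" by simp
    then show ?thesis
      using 1 has_field_derivative_transform_within_open[of "\<lambda>t. 0" 0 t "{..<0}" "hump p"]
      by (auto simp: hump_def)
  next
    case 2
    have "((\<lambda>h. hump ([:0,1:] * p) h) \<longlongrightarrow> 0) (at 0)" by (rule hump_tendsto_0)
    then have "((\<lambda>h. (hump p (0 + h) - hump p 0) / h) \<longlongrightarrow> 0) (at 0)"
      by (rule Lim_transform_eventually) (auto simp: eventually_at_filter hump_def field_simps)
    then show ?thesis using 2 by (simp add: DERIV_def hump_def)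
  next
    case 3
    have "((\<lambda>t. poly p (inverse t) * exp (- inverse t)) has_real_derivative
        poly p (inverse t) * (exp (- inverse t) * (inverse t)\<^sup>2)
        + poly (pderiv p) (inverse t) * (- (inverse t)\<^sup>2) * exp (- inverse t)) (at t)"
      using 3 by (auto intro!: derivative_eq_intros DERIV_chain2[OF poly_DERIV] simp: power2_eq_square)
    also have "poly p (inverse t) * (exp (- inverse t) * (inverse t)\<^sup>2)
        + poly (pderiv p) (inverse t) * (- (inverse t)\<^sup>2) * exp (- inverse t) = hump (hump_deriv p) t"
      using 3 by (simp add: hump_def hump_deriv_def power2_eq_square algebra_simps)
    finally show ?thesis
      using 3 has_field_derivative_transform_within_open[of _ _ t "{0<..}" "hump p"]
      by (auto simp: hump_def)
  qed
qed

lemma hump_affine_has_derivative: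
  "((\<lambda>x::real^'n. hump p (c * x $ j + d)) has_derivative
     (\<lambda>h. hump (hump_deriv p) (c * x $ j + d) * (c * h $ j))) (at x)"
proof -
  have "((\<lambda>x::real^'n. c * x $ j + d) has_derivative (\<lambda>h. c * h $ j)) (at x)"
    by (auto intro!: derivative_eq_intros bounded_linear_imp_has_derivative bounded_linear_vec_nth)
  from has_derivative_compose[OF this hump_has_derivative[THEN has_field_derivative_imp_has_derivative]]
  show ?thesis by (simp add: mult.commute)
qed

lemma C_k_hump_affine: "C_k k (\<lambda>x::real^'n. hump p (c * x $ j + d))"
proof (induction k arbitrary: p)
  case 0
  show ?case
    unfolding C_k.simps
    by (intro continuous_at_imp_continuous_on ballI) (rule has_derivative_continuous[OF hump_affine_has_derivative])
next
  case (Suc k)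
  have "partial_deriv i (\<lambda>x::real^'n. hump p (c * x $ j + d)) =
     (\<lambda>x. (c * axis i 1 $ j) * hump (hump_deriv p) (c * x $ j + d))" for i
    using partial_derivI[OF hump_affine_has_derivative, of i p c j d] by (auto simp: fun_eq_iff)
  moreover have "(\<lambda>x::real^'n. hump p (c * x $ j + d)) differentiable_on UNIV"
    unfolding differentiable_on_UNIV differentiable_def
    by (intro allI exI) (rule hump_affine_has_derivative)
  ultimately show ?case using C_k_mult[OF C_k_const Suc.IH] by auto
qed

text \<open>
The parameter \<open>m\<close> sharpens the bump: for \<open>t > 0\<close> the factor \<open>exp (- 1 / (m t))\<close> tends to \<open>1\<close> as \<open>m\<close> grows, so
that the bumps tend to the indicator function of the box.
\<close>

definition box_bump :: "real \<Rightarrow> real^'n \<Rightarrow> real^'n \<Rightarrow> real^'n \<Rightarrow> real" where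
  "box_bump m a b x = (\<Prod>j\<in>UNIV. hump 1 (m * x $ j + - m * a $ j) * hump 1 (- m * x $ j + m * b $ j))"

lemma hump1_bounds: "0 \<le> hump 1 t" "hump 1 t \<le> 1"
  by (auto simp: hump_def)

lemma box_bump_bounds: "0 \<le> box_bump m a b x" "box_bump m a b x \<le> 1"
  unfolding box_bump_def
  by (auto intro!: prod_nonneg prod_le_1 mult_nonneg_nonneg mult_le_one hump1_bounds)

lemma box_bump_nonzero:
  assumes "m > 0"
  shows "box_bump m a b x \<noteq> 0 \<longleftrightarrow> x \<in> box a b"
proof -
  have 1: "m * x $ j + - m * a $ j \<le> 0 \<longleftrightarrow> x $ j \<le> a $ j" for j
    using assms by simp
  have 2: "- m * x $ j + m * b $ j \<le> 0 \<longleftrightarrow> b $ j \<le> x $ j" for j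
    using assms by simp
  show ?thesis
    unfolding box_bump_def mem_box_cart hump_def 1 2 by (auto simp: not_le)
qed

lemma box_bump_test:
  assumes "m > 0" "cbox a b \<subseteq> \<Omega>"
  shows "box_bump m a b \<in> test_functions \<Omega>"
proof (rule test_functionsI[OF _ compact_cbox assms(2)])
  show "smooth (box_bump m a b)"
    unfolding box_bump_def[abs_def]
    by (intro smooth_prod smooth_mult) (auto simp only: smooth_def finite intro!: C_k_hump_affine)
  show "box_bump m a b x = 0" if "x \<notin> cbox a b" for x
    using box_bump_nonzero[OF assms(1), of a b x] that box_subset_cbox by blast
qed

lemma box_bump_tendsto:
  "(\<lambda>m. box_bump (real (Suc m)) a b x) \<longlonglongrightarrow> indicator (box a b) x"
proof (cases "x \<in> box a b")
  case True
  have lim: "(\<lambda>m. hump 1 (real (Suc m) * t)) \<longlonglongrightarrow> 1" if t: "t > 0" for t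
  proof -
    have "(\<lambda>m. exp (- (inverse (real (Suc m)) * inverse t))) \<longlonglongrightarrow> exp (- (0 * inverse t))"
      by (intro tendsto_intros LIMSEQ_inverse_real_of_nat)
    then show ?thesis using t by (simp add: hump_def mult_le_0_iff)
  qed
  have "(\<lambda>m. \<Prod>j\<in>UNIV. hump 1 (real (Suc m) * (x $ j - a $ j)) * hump 1 (real (Suc m) * (b $ j - x $ j)))
     \<longlonglongrightarrow> (\<Prod>j::'a\<in>UNIV. 1 * 1)"
    using True by (intro tendsto_prod tendsto_mult lim) (auto simp: mem_box_cart)
  moreover have "real (Suc m) * (x $ j - a $ j) = real (Suc m) * x $ j + - real (Suc m) * a $ j"
     "real (Suc m) * (b $ j - x $ j) = - real (Suc m) * x $ j + real (Suc m) * b $ j" for m j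
    by (simp_all add: algebra_simps)
  ultimately show ?thesis using True unfolding box_bump_def by simp
next
  case False
  then have "box_bump (real (Suc m)) a b x = 0" for m
    using box_bump_nonzero[of "real (Suc m)" a b x] by auto
  then show ?thesis using False by simp
qed

section \<open>Square-integrable functions\<close>

definition ipL2 :: "(real^'n) set \<Rightarrow> (real^'n \<Rightarrow> 'b::euclidean_space) \<Rightarrow> (real^'n \<Rightarrow> 'b) \<Rightarrow> real" where
  "ipL2 \<Omega> f g = (LINT x|lebesgue_on \<Omega>. f x \<bullet> g x)"

lemma L2_measurable: "f \<in> L2 \<Omega> \<Longrightarrow> f \<in> borel_measurable (lebesgue_on \<Omega>)"
  and L2_integrable_sq: "f \<in> L2 \<Omega> \<Longrightarrow> integrable (lebesgue_on \<Omega>) (\<lambda>x. (norm (f x))\<^sup>2)"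
  by (simp_all add: L2_def)

lemma integrable_norm_mult_L2:
  assumes f: "f \<in> L2 \<Omega>" and g: "g \<in> L2 \<Omega>"
  shows "integrable (lebesgue_on \<Omega>) (\<lambda>x. norm (f x) * norm (g x))"
proof (rule Bochner_Integration.integrable_bound)
  show "integrable (lebesgue_on \<Omega>) (\<lambda>x. (norm (f x))\<^sup>2 + (norm (g x))\<^sup>2)"
    using f g by (intro Bochner_Integration.integrable_add L2_integrable_sq)
  show "(\<lambda>x. norm (f x) * norm (g x)) \<in> borel_measurable (lebesgue_on \<Omega>)"
    using L2_measurable[OF f] L2_measurable[OF g] by measurable
  have "a * b \<le> a\<^sup>2 + b\<^sup>2" if "a \<ge> 0" "b \<ge> 0" for a b :: real
    using sum_squares_bound[of a b] mult_nonneg_nonneg[OF that] by linarith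
  then show "AE x in lebesgue_on \<Omega>. norm (norm (f x) * norm (g x)) \<le> norm ((norm (f x))\<^sup>2 + (norm (g x))\<^sup>2)"
    by (auto intro!: AE_I2)
qed

lemma integrable_L2_product:
  fixes h :: "real^'n \<Rightarrow> real"
  assumes f: "f \<in> L2 \<Omega>" and g: "g \<in> L2 \<Omega>" and h: "h \<in> borel_measurable (lebesgue_on \<Omega>)"
    and b: "AE x in lebesgue_on \<Omega>. norm (h x) \<le> C * (norm (f x) * norm (g x))"
  shows "integrable (lebesgue_on \<Omega>) h"
proof (rule Bochner_Integration.integrable_bound)
  show "integrable (lebesgue_on \<Omega>) (\<lambda>x. C * (norm (f x) * norm (g x)))"
    by (intro integrable_mult_right integrable_norm_mult_L2 f g)
qed (use h b in \<open>auto elim!: eventually_mono\<close>)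

lemma integrable_inner_L2:
  fixes f g :: "real^'n \<Rightarrow> 'b::euclidean_space"
  assumes f: "f \<in> L2 \<Omega>" and g: "g \<in> L2 \<Omega>"
  shows "integrable (lebesgue_on \<Omega>) (\<lambda>x. f x \<bullet> g x)"
proof (rule integrable_L2_product[OF f g, where C = 1])
  show "(\<lambda>x. f x \<bullet> g x) \<in> borel_measurable (lebesgue_on \<Omega>)"
    using L2_measurable[OF f] L2_measurable[OF g] by measurable
qed (auto intro!: AE_I2 simp: Cauchy_Schwarz_ineq2)

lemma norm_L2_nonneg: "0 \<le> norm_L2 A f"
  by (simp add: norm_L2_def integral_nonneg_AE)

lemma L2_dominated:
  fixes h :: "real^'n \<Rightarrow> 'b::euclidean_space" and f :: "real^'n \<Rightarrow> 'c::euclidean_space"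
  assumes f: "f \<in> L2 \<Omega>" and h: "h \<in> borel_measurable (lebesgue_on \<Omega>)" and C: "C \<ge> 0"
    and b: "AE x in lebesgue_on \<Omega>. norm (h x) \<le> C * norm (f x)"
  shows "h \<in> L2 \<Omega>" and "norm_L2 \<Omega> h \<le> C * norm_L2 \<Omega> f"
proof -
  have b2: "AE x in lebesgue_on \<Omega>. (norm (h x))\<^sup>2 \<le> C\<^sup>2 * (norm (f x))\<^sup>2"
    using b by eventually_elim (metis norm_ge_zero power_mono power_mult_distrib)
  have i: "integrable (lebesgue_on \<Omega>) (\<lambda>x. C\<^sup>2 * (norm (f x))\<^sup>2)"
    by (intro integrable_mult_right L2_integrable_sq f)
  have hi: "integrable (lebesgue_on \<Omega>) (\<lambda>x. (norm (h x))\<^sup>2)"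
    by (rule Bochner_Integration.integrable_bound[OF i]) (use h b2 in \<open>auto elim!: eventually_mono\<close>)
  then show "h \<in> L2 \<Omega>" using h by (simp add: L2_def)
  have "(LINT x|lebesgue_on \<Omega>. (norm (h x))\<^sup>2) \<le> (LINT x|lebesgue_on \<Omega>. C\<^sup>2 * (norm (f x))\<^sup>2)"
    by (rule integral_mono_AE[OF hi i b2])
  then have "norm_L2 \<Omega> h \<le> sqrt (C\<^sup>2 * (LINT x|lebesgue_on \<Omega>. (norm (f x))\<^sup>2))"
    unfolding norm_L2_def by simp
  then show "norm_L2 \<Omega> h \<le> C * norm_L2 \<Omega> f" using C by (simp add: norm_L2_def real_sqrt_mult)
qed

lemma L2_AE_cong:
  fixes h :: "real^'n \<Rightarrow> 'b::euclidean_space"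
  assumes f: "f \<in> L2 \<Omega>" and h: "h \<in> borel_measurable (lebesgue_on \<Omega>)"
    and b: "AE x in lebesgue_on \<Omega>. h x = f x"
  shows "h \<in> L2 \<Omega>" and "norm_L2 \<Omega> h = norm_L2 \<Omega> f"
proof -
  have "AE x in lebesgue_on \<Omega>. norm (h x) \<le> 1 * norm (f x)" using b by eventually_elim simp
  from L2_dominated[OF f h _ this] show "h \<in> L2 \<Omega>" by simp
  show "norm_L2 \<Omega> h = norm_L2 \<Omega> f"
    unfolding norm_L2_def
    by (intro arg_cong[where f = sqrt] integral_cong_AE)
       (use f h b in \<open>auto simp: L2_def elim!: eventually_mono\<close>)
qed

lemma L2_add:
  fixes f g :: "real^'n \<Rightarrow> 'b::euclidean_space"
  assumes f: "f \<in> L2 \<Omega>" and g: "g \<in> L2 \<Omega>"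
  shows "(\<lambda>x. f x + g x) \<in> L2 \<Omega>"
proof -
  have m[measurable]: "f \<in> borel_measurable (lebesgue_on \<Omega>)" "g \<in> borel_measurable (lebesgue_on \<Omega>)"
    using f g by (auto simp: L2_def)
  have "integrable (lebesgue_on \<Omega>) (\<lambda>x. (norm (f x + g x))\<^sup>2)"
  proof (rule Bochner_Integration.integrable_bound)
    show "integrable (lebesgue_on \<Omega>) (\<lambda>x. 2 * (norm (f x))\<^sup>2 + 2 * (norm (g x))\<^sup>2)"
      using f g by (intro Bochner_Integration.integrable_add integrable_mult_right L2_integrable_sq)
    have "(norm (a + b))\<^sup>2 \<le> 2 * (norm a)\<^sup>2 + 2 * (norm b)\<^sup>2" for a b :: 'b
    proof -
      have "(norm (a + b))\<^sup>2 \<le> (norm a + norm b)\<^sup>2" by (intro power_mono norm_triangle_ineq) simp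
      also have "\<dots> \<le> 2 * (norm a)\<^sup>2 + 2 * (norm b)\<^sup>2"
        using sum_squares_bound[of "norm a" "norm b"] by (simp add: power2_sum)
      finally show ?thesis .
    qed
    then show "AE x in lebesgue_on \<Omega>. norm ((norm (f x + g x))\<^sup>2) \<le> norm (2 * (norm (f x))\<^sup>2 + 2 * (norm (g x))\<^sup>2)"
      by (auto intro!: AE_I2)
  qed measurable
  then show ?thesis by (simp add: L2_def)
qed

lemma L2_scale:
  fixes f :: "real^'n \<Rightarrow> 'b::euclidean_space"
  assumes f: "f \<in> L2 \<Omega>"
  shows "(\<lambda>x. c *\<^sub>R f x) \<in> L2 \<Omega>"
  by (rule L2_dominated(1)[OF f, where C = "\<bar>c\<bar>"]) (use L2_measurable[OF f] in auto)

lemma L2_zero: "(\<lambda>x. 0) \<in> L2 \<Omega>" by (simp add: L2_def)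

lemma subspace_L2: "subspace (L2 \<Omega> :: (real^'n \<Rightarrow> 'b::euclidean_space) set)"
  unfolding subspace_def using L2_zero L2_add L2_scale
  by (auto simp: plus_fun_def scaleR_fun_def zero_fun_def)

lemma L2_diff:
  fixes f g :: "real^'n \<Rightarrow> 'b::euclidean_space"
  assumes f: "f \<in> L2 \<Omega>" and g: "g \<in> L2 \<Omega>"
  shows "(\<lambda>x. f x - g x) \<in> L2 \<Omega>"
  using subspace_diff[OF subspace_L2 assms] by (simp add: fun_diff_def)

lemma nn_integral_norm_sq_L2:
  assumes "f \<in> L2 \<Omega>"
  shows "(\<integral>\<^sup>+x. ennreal ((norm (f x))\<^sup>2) \<partial>lebesgue_on \<Omega>) = ennreal ((norm_L2 \<Omega> f)\<^sup>2)"
  using nn_integral_eq_integral[OF L2_integrable_sq[OF assms]] by (simp add: norm_L2_def)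

lemma L2_if_nn_integral_le:
  fixes f :: "real^'n \<Rightarrow> 'b::euclidean_space"
  assumes f: "f \<in> borel_measurable (lebesgue_on \<Omega>)" and C: "C \<ge> 0"
    and le: "(\<integral>\<^sup>+x. ennreal ((norm (f x))\<^sup>2) \<partial>lebesgue_on \<Omega>) \<le> ennreal (C\<^sup>2)"
  shows "f \<in> L2 \<Omega>" and "norm_L2 \<Omega> f \<le> C"
proof -
  have "integrable (lebesgue_on \<Omega>) (\<lambda>x. (norm (f x))\<^sup>2)"
    by (rule integrableI_bounded) (use f le in \<open>auto simp: le_less_trans[OF _ ennreal_less_top]\<close>)
  then show L: "f \<in> L2 \<Omega>" using f by (simp add: L2_def)
  have "(norm_L2 \<Omega> f)\<^sup>2 \<le> C\<^sup>2"
    using le unfolding nn_integral_norm_sq_L2[OF L] by (simp add: ennreal_le_iff)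
  then show "norm_L2 \<Omega> f \<le> C" using C by (rule power2_le_imp_le)
qed

lemma ipL2_semi_inner: "semi_inner_space (L2 \<Omega> :: (real^'n \<Rightarrow> 'b::euclidean_space) set) (ipL2 \<Omega>)"
proof
  fix x y z :: "real^'n \<Rightarrow> 'b" and c
  assume x: "x \<in> L2 \<Omega>"
  show "0 \<le> ipL2 \<Omega> x x" by (simp add: ipL2_def integral_nonneg_AE)
  assume y: "y \<in> L2 \<Omega>"
  show "ipL2 \<Omega> x y = ipL2 \<Omega> y x" by (simp add: ipL2_def inner_commute)
  show "ipL2 \<Omega> (c *\<^sub>R x) y = c * ipL2 \<Omega> x y" by (simp add: ipL2_def scaleR_fun_def)
  assume z: "z \<in> L2 \<Omega>"
  show "ipL2 \<Omega> (x + y) z = ipL2 \<Omega> x z + ipL2 \<Omega> y z"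
    using integrable_inner_L2[OF x z] integrable_inner_L2[OF y z]
    by (simp add: ipL2_def plus_fun_def inner_add_left)
qed (rule subspace_L2)

lemma nrm_ipL2: "semi_inner_space.nrm (ipL2 \<Omega>) = norm_L2 \<Omega>"
  unfolding semi_inner_space.nrm_def[OF ipL2_semi_inner] fun_eq_iff
  by (simp add: norm_L2_def ipL2_def power2_norm_eq_inner)

text \<open>
Take a subsequence whose increments have norm at most \<open>(1/4)^k\<close>. Weighting the squared increments with
\<open>4^k\<close> still leaves an integrable sum, so almost everywhere the increments are \<open>O((1/2)^k)\<close> and the
subsequence converges. Fatou's lemma then turns pointwise into mean-square convergence.
\<close>

theorem Riesz_Fischer:
  fixes X :: "nat \<Rightarrow> real^'n \<Rightarrow> 'b::euclidean_space"
  assumes X: "\<And>n. X n \<in> L2 \<Omega>"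
    and Cau: "\<And>e. e > 0 \<Longrightarrow> \<exists>N. \<forall>m\<ge>N. \<forall>n\<ge>N. norm_L2 \<Omega> (\<lambda>x. X m x - X n x) < e"
  shows "\<exists>f\<in>L2 \<Omega>. (\<lambda>n. norm_L2 \<Omega> (\<lambda>x. X n x - f x)) \<longlonglongrightarrow> 0"
proof -
  let ?M = "lebesgue_on \<Omega>"
  note [measurable] = L2_measurable[OF X]
  have "\<forall>k. \<exists>N. \<forall>m\<ge>N. \<forall>n\<ge>N. norm_L2 \<Omega> (\<lambda>x. X m x - X n x) < (1/4)^k"
    by (intro allI Cau) simp
  then obtain N where N: "\<And>k m n. m \<ge> N k \<Longrightarrow> n \<ge> N k \<Longrightarrow> norm_L2 \<Omega> (\<lambda>x. X m x - X n x) < (1/4)^k"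
    by metis
  \<comment> \<open>The sum makes \<open>r\<close> dominate every \<open>N i\<close> with \<open>i \<le> k\<close>; the summand \<open>k\<close> makes it unbounded.\<close>
  define r where "r k = (\<Sum>i\<le>k. N i) + k" for k
  have r_ge: "r k \<ge> N k" "r (Suc k) \<ge> N k" "r k \<ge> k" for k
  proof -
    have "N k \<le> (\<Sum>i\<le>k. N i)" by (rule member_le_sum) auto
    then show "r k \<ge> N k" "r (Suc k) \<ge> N k" "r k \<ge> k" by (auto simp: r_def)
  qed
  define D where "D k x = X (r (Suc k)) x - X (r k) x" for k x
  have DL: "D k \<in> L2 \<Omega>" for k unfolding D_def by (intro L2_diff X)
  have [measurable]: "D k \<in> borel_measurable ?M" for k by (rule L2_measurable[OF DL])
  have ND: "norm_L2 \<Omega> (D k) \<le> (1/4)^k" for k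
    using N[OF r_ge(2) r_ge(1), of k] by (simp add: D_def[abs_def])
  have "(\<integral>\<^sup>+x. (\<Sum>k. ennreal (4^k * (norm (D k x))\<^sup>2)) \<partial>?M) = (\<Sum>k. \<integral>\<^sup>+x. ennreal (4^k * (norm (D k x))\<^sup>2) \<partial>?M)"
    by (rule nn_integral_suminf) measurable
  also have "\<dots> \<le> (\<Sum>k. ennreal ((1/4)^k))"
  proof (rule suminf_le)
    fix k
    have "(\<integral>\<^sup>+x. ennreal (4^k * (norm (D k x))\<^sup>2) \<partial>?M) = (\<integral>\<^sup>+x. ennreal (4^k) * ennreal ((norm (D k x))\<^sup>2) \<partial>?M)"
      by (simp add: ennreal_mult)
    also have "\<dots> = ennreal (4^k) * ennreal ((norm_L2 \<Omega> (D k))\<^sup>2)"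
      by (subst nn_integral_cmult) (auto simp: nn_integral_norm_sq_L2[OF DL])
    also have "\<dots> \<le> ennreal (4^k * ((1/4)^k)\<^sup>2)"
    proof -
      have "0 \<le> norm_L2 \<Omega> (D k)" by (simp add: norm_L2_def integral_nonneg_AE)
      then have "(norm_L2 \<Omega> (D k))\<^sup>2 \<le> ((1/4)^k)\<^sup>2" using ND by (intro power_mono)
      then show ?thesis by (subst ennreal_mult[symmetric]) (auto intro!: ennreal_leI mult_left_mono)
    qed
    also have "4^k * ((1/4::real)^k)\<^sup>2 = (1/4)^k"
      by (simp add: power2_eq_square power_mult_distrib[symmetric] flip: mult.assoc)
    finally show "(\<integral>\<^sup>+x. ennreal (4^k * (norm (D k x))\<^sup>2) \<partial>?M) \<le> ennreal ((1/4)^k)" .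
  qed auto
  also have "\<dots> < \<infinity>"
    using summable_geometric[of "1/4::real"] by (simp add: suminf_ennreal_eq[OF _ summable_sums] ennreal_less_top)
  finally have fin: "(\<integral>\<^sup>+x. (\<Sum>k. ennreal (4^k * (norm (D k x))\<^sup>2)) \<partial>?M) \<noteq> \<infinity>" by simp
  have "AE x in ?M. (\<Sum>k. ennreal (4^k * (norm (D k x))\<^sup>2)) \<noteq> \<infinity>"
    by (rule nn_integral_PInf_AE[OF _ fin]) measurable
  then have conv: "AE x in ?M. convergent (\<lambda>k. X (r k) x)"
  proof eventually_elim
    case (elim x)
    then have "summable (\<lambda>k. 4^k * (norm (D k x))\<^sup>2)"
      by (intro summable_suminf_not_top) auto
    then have "Bseq (\<lambda>k. 4^k * (norm (D k x))\<^sup>2)"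
      using summable_LIMSEQ_zero convergentI convergent_imp_Bseq by blast
    then obtain C where C: "C > 0" "\<And>k. norm (4^k * (norm (D k x))\<^sup>2) \<le> C" by (auto elim: BseqE)
    have bD: "norm (D k x) \<le> sqrt C * (1/2)^k" for k
    proof -
      have "(2^k * norm (D k x))\<^sup>2 = 4^k * (norm (D k x))\<^sup>2"
        using power_mult_distrib[of "2::real" 2 k] by (simp add: power_mult_distrib power2_eq_square)
      then have "(2^k * norm (D k x))\<^sup>2 \<le> C" using C(2)[of k] by simp
      then have "2^k * norm (D k x) \<le> sqrt C" by (rule real_le_rsqrt)
      then show ?thesis by (simp add: field_simps power_one_over)
    qed
    have "summable (\<lambda>k. sqrt C * (1/2::real)^k)"
      by (intro summable_mult summable_geometric) simp
    then have "summable (\<lambda>k. D k x)"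
      by (rule summable_comparison_test'[where N = 0]) (rule bD)
    then have "convergent (\<lambda>n. \<Sum>k<n. D k x)" unfolding summable_iff_convergent .
    from convergent_add[OF convergent_const[of "X (r 0) x"] this] show ?case
      unfolding D_def sum_lessThan_telescope[of "\<lambda>k. X (r k) x"] by simp
  qed
  define f where "f x = lim (\<lambda>k. X (r k) x)" for x
  have fm[measurable]: "f \<in> borel_measurable ?M" unfolding f_def by measurable
  have est: "X n - f \<in> L2 \<Omega> \<and> norm_L2 \<Omega> (X n - f) \<le> e"
    if e: "e > 0" and K: "\<And>m. m \<ge> K \<Longrightarrow> norm_L2 \<Omega> (\<lambda>x. X n x - X m x) < e" for n e K
  proof -
    have "(\<integral>\<^sup>+x. ennreal ((norm ((X n - f) x))\<^sup>2) \<partial>?M)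
        = (\<integral>\<^sup>+x. liminf (\<lambda>k. ennreal ((norm (X n x - X (r k) x))\<^sup>2)) \<partial>?M)"
    proof (rule nn_integral_cong_AE, use conv in eventually_elim)
      case (elim x)
      then have "(\<lambda>k. X (r k) x) \<longlonglongrightarrow> f x" by (simp add: f_def convergent_LIMSEQ_iff)
      then have "(\<lambda>k. ennreal ((norm (X n x - X (r k) x))\<^sup>2)) \<longlonglongrightarrow> ennreal ((norm (X n x - f x))\<^sup>2)"
        by (intro tendsto_intros)
      from lim_imp_Liminf[OF _ this] show ?case by (simp add: fun_diff_def)
    qed
    also have "\<dots> \<le> liminf (\<lambda>k. \<integral>\<^sup>+x. ennreal ((norm (X n x - X (r k) x))\<^sup>2) \<partial>?M)"
      by (rule nn_integral_liminf) measurable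
    also have "\<dots> \<le> ennreal (e\<^sup>2)"
    proof (rule Liminf_le)
      show "\<forall>\<^sub>F k in sequentially. (\<integral>\<^sup>+x. ennreal ((norm (X n x - X (r k) x))\<^sup>2) \<partial>?M) \<le> ennreal (e\<^sup>2)"
      proof (rule eventually_sequentiallyI[of K])
        fix k assume "K \<le> k"
        then have "norm_L2 \<Omega> (\<lambda>x. X n x - X (r k) x) < e" using r_ge(3)[of k] by (intro K) auto
        moreover have "0 \<le> norm_L2 \<Omega> (\<lambda>x. X n x - X (r k) x)" by (simp add: norm_L2_def integral_nonneg_AE)
        ultimately show "(\<integral>\<^sup>+x. ennreal ((norm (X n x - X (r k) x))\<^sup>2) \<partial>?M) \<le> ennreal (e\<^sup>2)"
          using nn_integral_norm_sq_L2[OF L2_diff[OF X X]] by (auto intro!: ennreal_leI power_mono)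
      qed
    qed simp
    finally have "(\<integral>\<^sup>+x. ennreal ((norm ((X n - f) x))\<^sup>2) \<partial>?M) \<le> ennreal (e\<^sup>2)" .
    from L2_if_nn_integral_le[OF _ _ this] e show ?thesis by (simp add: fun_diff_def)
  qed
  obtain n0 where n0: "\<And>m n. m \<ge> n0 \<Longrightarrow> n \<ge> n0 \<Longrightarrow> norm_L2 \<Omega> (\<lambda>x. X m x - X n x) < 1"
    using Cau[of 1] by auto
  have "X n0 - f \<in> L2 \<Omega>" using est[of 1 n0 n0] n0 by auto
  from L2_diff[OF X[of n0] this] have fL: "f \<in> L2 \<Omega>" by (simp add: fun_diff_def)
  have "(\<lambda>n. norm_L2 \<Omega> (\<lambda>x. X n x - f x)) \<longlonglongrightarrow> 0"
  proof (rule LIMSEQ_I)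
    fix e :: real assume "e > 0"
    then have "e/2 > 0" by simp
    from Cau[OF this] obtain K where K: "\<And>m n. m \<ge> K \<Longrightarrow> n \<ge> K \<Longrightarrow> norm_L2 \<Omega> (\<lambda>x. X m x - X n x) < e/2"
      by auto
    have "norm (norm_L2 \<Omega> (\<lambda>x. X n x - f x) - 0) < e" if "n \<ge> K" for n
    proof -
      have "norm_L2 \<Omega> (X n - f) \<le> e/2" using est[OF \<open>e/2 > 0\<close>, of K n] K that by auto
      moreover have "0 \<le> norm_L2 \<Omega> (X n - f)" by (simp add: norm_L2_def integral_nonneg_AE)
      ultimately show ?thesis using \<open>e > 0\<close> by (simp add: fun_diff_def)
    qed
    then show "\<exists>no. \<forall>n\<ge>no. norm (norm_L2 \<Omega> (\<lambda>x. X n x - f x) - 0) < e" by blast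
  qed
  with fL show ?thesis by blast
qed

interpretation L2: semi_hilbert_space "L2 \<Omega> :: (real^'n \<Rightarrow> 'b::euclidean_space) set" "ipL2 \<Omega>"
  rewrites "semi_inner_space.nrm (ipL2 \<Omega>) = norm_L2 \<Omega>" for \<Omega>
proof -
  show "semi_hilbert_space (L2 \<Omega> :: (real^'n \<Rightarrow> 'b) set) (ipL2 \<Omega>)"
    unfolding semi_hilbert_space_def semi_hilbert_space_axioms_def nrm_ipL2
    by (intro conjI allI impI ipL2_semi_inner) (simp add: fun_diff_def Riesz_Fischer)
qed (rule nrm_ipL2)

lemma norm_L2_triangle:
  fixes f g :: "real^'n \<Rightarrow> 'b::euclidean_space"
  assumes "f \<in> L2 \<Omega>" "g \<in> L2 \<Omega>"
  shows "norm_L2 \<Omega> (\<lambda>x. f x + g x) \<le> norm_L2 \<Omega> f + norm_L2 \<Omega> g"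
  using L2.nrm_triangle[OF assms] by (simp add: plus_fun_def)

section \<open>The fundamental lemma of the calculus of variations\<close>

lemma smooth_measurable: "smooth f \<Longrightarrow> f \<in> borel_measurable borel"
  by (rule borel_measurable_continuous_onI[OF smooth_continuous])

lemma borel_measurable_lebesgue_on: "f \<in> borel_measurable borel \<Longrightarrow> f \<in> borel_measurable (lebesgue_on A)"
  by (intro measurable_restrict_space1 measurable_completion) simp

lemma compact_support_bounded:
  fixes f :: "real^'n \<Rightarrow> real"
  assumes "continuous_on UNIV f" "compact S" "\<And>x. x \<notin> S \<Longrightarrow> f x = 0"
  obtains B where "B > 0" "\<And>x. \<bar>f x\<bar> \<le> B"
proof -
  have "bounded (f ` S)"
    by (intro compact_imp_bounded compact_continuous_image continuous_on_subset[OF assms(1)] assms(2)) simp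
  then obtain B where B: "B > 0" "\<And>x. x \<in> S \<Longrightarrow> \<bar>f x\<bar> \<le> B"
    by (auto simp: bounded_pos)
  have "\<bar>f x\<bar> \<le> B" for x using B assms(3)[of x] by (cases "x \<in> S") auto
  with B(1) show thesis by (rule that)
qed

lemma test_bounded:
  assumes "f \<in> test_functions \<Omega>"
  obtains B where "B > 0" "\<And>x. \<bar>f x\<bar> \<le> B"
proof -
  obtain S where "compact S" "\<And>x. x \<notin> S \<Longrightarrow> f x = 0" using test_functionsE[OF assms] by metis
  then show thesis
    using compact_support_bounded[OF smooth_continuous[OF test_smooth[OF assms]]] that by metis
qed

locale bounded_open =
  fixes \<Omega> :: "(real^'n) set"
  assumes open_\<Omega>: "open \<Omega>" and bounded_\<Omega>: "bounded \<Omega>"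
begin

abbreviation "\<mu> \<equiv> lebesgue_on \<Omega>"

lemma lmeasurable_\<Omega>: "\<Omega> \<in> lmeasurable"
  by (rule lmeasurable_open[OF bounded_\<Omega> open_\<Omega>])

lemma \<Omega>_sets: "\<Omega> \<in> sets lebesgue" "\<Omega> \<inter> space lebesgue \<in> sets lebesgue" "\<Omega> \<in> sets borel"
  using lmeasurable_\<Omega> open_\<Omega> by auto

sublocale finite_measure \<mu>
  by (rule finite_measure_lebesgue_on[OF lmeasurable_\<Omega>])

lemma L2_bounded_measurable:
  fixes f :: "real^'n \<Rightarrow> 'b::euclidean_space"
  assumes "f \<in> borel_measurable \<mu>" "AE x in \<mu>. norm (f x) \<le> C"
  shows "f \<in> L2 \<Omega>"
proof -
  have "integrable \<mu> (\<lambda>x. (norm (f x))\<^sup>2)"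
  proof (rule integrable_const_bound)
    show "AE x in \<mu>. norm ((norm (f x))\<^sup>2) \<le> C\<^sup>2"
      using assms(2) by eventually_elim (simp add: power_mono)
  qed (use assms in measurable)
  then show ?thesis using assms by (simp add: L2_def)
qed

lemma L2_one: "(\<lambda>x. 1::real) \<in> L2 \<Omega>"
  by (rule L2_bounded_measurable[where C = 1]) auto

lemma L2_integrable: "f \<in> L2 \<Omega> \<Longrightarrow> integrable \<mu> (f :: real^'n \<Rightarrow> real)"
  using integrable_inner_L2[OF _ L2_one, of f] by simp

lemma test_measurable: "\<phi> \<in> test_functions \<Omega> \<Longrightarrow> \<phi> \<in> borel_measurable \<mu>"
  by (rule borel_measurable_lebesgue_on[OF smooth_measurable[OF test_smooth]])

lemma test_L2:
  assumes "\<phi> \<in> test_functions \<Omega>" shows "\<phi> \<in> L2 \<Omega>"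
proof -
  obtain B where "\<And>x. \<bar>\<phi> x\<bar> \<le> B" using test_bounded[OF assms] by metis
  then show ?thesis by (intro L2_bounded_measurable[where C = B] test_measurable assms) auto
qed

lemma integral_zero_on_box:
  fixes f :: "real^'n \<Rightarrow> real"
  assumes f: "f \<in> L2 \<Omega>" and 0: "\<And>\<phi>. \<phi> \<in> test_functions \<Omega> \<Longrightarrow> (LINT x|\<mu>. f x * \<phi> x) = 0"
    and ab: "cbox a b \<subseteq> \<Omega>"
  shows "(LINT x|\<mu>. f x * indicator (box a b) x) = 0"
proof -
  have "(\<lambda>m. LINT x|\<mu>. f x * box_bump (real (Suc m)) a b x) \<longlonglongrightarrow> (LINT x|\<mu>. f x * indicator (box a b) x)"
  proof (rule integral_dominated_convergence)
    show "integrable \<mu> (\<lambda>x. \<bar>f x\<bar>)" using L2_integrable[OF f] by (rule integrable_abs)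
    show "AE x in \<mu>. (\<lambda>m. f x * box_bump (real (Suc m)) a b x) \<longlonglongrightarrow> f x * indicator (box a b) x"
      by (intro AE_I2 tendsto_mult_left box_bump_tendsto)
    show "AE x in \<mu>. norm (f x * box_bump (real (Suc m)) a b x) \<le> \<bar>f x\<bar>" for m
      using box_bump_bounds[of "real (Suc m)" a b] by (auto intro!: AE_I2 simp: abs_mult mult_left_le)
    show "(\<lambda>x. f x * indicator (box a b) x) \<in> borel_measurable \<mu>"
      by (intro borel_measurable_times L2_measurable f borel_measurable_lebesgue_on) simp
    show "(\<lambda>x. f x * box_bump (real (Suc m)) a b x) \<in> borel_measurable \<mu>" for m
      by (intro borel_measurable_times L2_measurable f test_measurable box_bump_test ab) simp
  qed
  moreover have "(LINT x|\<mu>. f x * box_bump (real (Suc m)) a b x) = 0" for m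
    by (intro 0 box_bump_test ab) simp
  ultimately show ?thesis by (simp add: LIMSEQ_const_iff)
qed

lemma integrable_times_indicator_borel:
  fixes f :: "real^'n \<Rightarrow> real"
  assumes f: "integrable \<mu> f" and A: "A \<in> sets borel"
  shows "integrable \<mu> (\<lambda>x. f x * indicator A x)"
proof (rule Bochner_Integration.integrable_bound[OF f])
  show "(\<lambda>x. f x * indicator A x) \<in> borel_measurable \<mu>"
    using A by (intro borel_measurable_times borel_measurable_integrable[OF f] borel_measurable_lebesgue_on) simp
qed (auto intro!: AE_I2 simp: indicator_def)

text \<open>
Open boxes are stable under intersection, so \<open>f\<close> restricted to the box has integral \<open>0\<close> over every open
box, hence by Dynkin's lemma over every Borel set. A Lebesgue measurable set is Borel up to a null set.
\<close>

lemma AE_zero_on_box: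
  fixes f :: "real^'n \<Rightarrow> real"
  assumes f: "f \<in> L2 \<Omega>" and 0: "\<And>\<phi>. \<phi> \<in> test_functions \<Omega> \<Longrightarrow> (LINT x|\<mu>. f x * \<phi> x) = 0"
    and cd: "cbox c d \<subseteq> \<Omega>"
  shows "AE x in \<mu>. x \<in> box c d \<longrightarrow> f x = 0"
proof -
  define F where "F x = f x * indicator (box c d) x" for x
  have Fi: "integrable \<mu> F"
    unfolding F_def by (rule integrable_times_indicator_borel[OF L2_integrable[OF f]]) simp
  note [measurable] = borel_measurable_integrable[OF Fi]
  have box0: "(LINT x|\<mu>. F x * indicator (box a b) x) = 0" for a b
  proof -
    obtain a' b' where ab': "box c d \<inter> box a b = box a' b'" using box_Int_box by blast
    have eq: "F x * indicator (box a b) x = f x * indicator (box a' b') x" for x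
      unfolding ab'[symmetric] F_def by (simp add: indicator_inter_arith)
    show ?thesis
    proof (cases "box a' b' = {}")
      case True then show ?thesis unfolding eq by simp
    next
      case False
      have "cbox a' b' = closure (box a' b')" using False by (rule closure_box[symmetric])
      also have "\<dots> \<subseteq> closure (box c d)" unfolding ab'[symmetric] by (intro closure_mono) auto
      also have "\<dots> \<subseteq> cbox c d" by (intro closure_minimal box_subset_cbox closed_cbox)
      finally show ?thesis unfolding eq using cd by (intro integral_zero_on_box f 0) auto
    qed
  qed
  have FA: "integrable \<mu> (\<lambda>x. F x * indicator A x)" if "A \<in> sets borel" for A
    by (rule integrable_times_indicator_borel[OF Fi that])
  have F0: "(LINT x|\<mu>. F x) = 0"
  proof -
    have "(\<lambda>x. F x * indicator (box c d) x) = F" by (simp add: F_def indicator_def fun_eq_iff)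
    then show ?thesis using box0[of c d] by metis
  qed
  have borel0: "(LINT x|\<mu>. F x * indicator A x) = 0" if A: "A \<in> sets borel" for A
  proof -
    let ?G = "range (\<lambda>(a, b). box a b :: (real^'n) set)"
    have "Int_stable ?G" by (auto simp: Int_stable_def box_Int_box)
    moreover have "?G \<subseteq> Pow UNIV" by auto
    moreover have "A \<in> sigma_sets UNIV ?G" using A unfolding borel_eq_box by simp
    ultimately show ?thesis
    proof (induction rule: sigma_sets_induct_disjoint)
      case (basic A) then show ?case using box0 by auto
    next
      case empty then show ?case by simp
    next
      case (compl A)
      then have A: "A \<in> sets borel" unfolding borel_eq_box by simp
      have "(LINT x|\<mu>. F x * indicator (UNIV - A) x) = (LINT x|\<mu>. F x - F x * indicator A x)"
        by (intro Bochner_Integration.integral_cong) (auto simp: indicator_def)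
      also have "\<dots> = 0" using Fi FA[OF A] compl F0 by simp
      finally show ?case .
    next
      case (union A)
      then have A: "A i \<in> sets borel" for i unfolding borel_eq_box by auto
      have "(\<lambda>n. LINT x|\<mu>. (\<Sum>i<n. F x * indicator (A i) x)) \<longlonglongrightarrow> (LINT x|\<mu>. F x * indicator (\<Union>i. A i) x)"
      proof (rule integral_dominated_convergence)
        show "integrable \<mu> (\<lambda>x. \<bar>F x\<bar>)" using Fi by (rule integrable_abs)
        show "AE x in \<mu>. (\<lambda>n. \<Sum>i<n. F x * indicator (A i) x) \<longlonglongrightarrow> F x * indicator (\<Union>i. A i) x"
        proof (rule AE_I2)
          fix x
          have "(\<lambda>i. indicator (A i) x) sums (indicator (\<Union>i. A i) x :: real)"
            by (rule indicator_sums) (use union(1) in \<open>auto simp: disjoint_family_on_def\<close>)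
          from sums_mult[OF this, of "F x"] show "(\<lambda>n. \<Sum>i<n. F x * indicator (A i) x) \<longlonglongrightarrow> F x * indicator (\<Union>i. A i) x"
            by (simp add: sums_def)
        qed
        show "AE x in \<mu>. norm (\<Sum>i<n. F x * indicator (A i) x) \<le> \<bar>F x\<bar>" for n
        proof (rule AE_I2)
          fix x
          have "(\<Sum>i<n. F x * indicator (A i) x) = F x * indicator (\<Union>i<n. A i) x"
            by (subst indicator_UN_disjoint)
               (use union(1) in \<open>auto simp: disjoint_family_on_def sum_distrib_left\<close>)
          moreover have "norm (F x * indicator (\<Union>i<n. A i) x) \<le> \<bar>F x\<bar>" by (simp add: indicator_def)
          ultimately show "norm (\<Sum>i<n. F x * indicator (A i) x) \<le> \<bar>F x\<bar>" by presburger
        qed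
        show "(\<lambda>x. F x * indicator (\<Union>i. A i) x) \<in> borel_measurable \<mu>"
          using A by (intro borel_measurable_integrable FA) auto
        show "(\<lambda>x. \<Sum>i<n. F x * indicator (A i) x) \<in> borel_measurable \<mu>" for n
          by (intro borel_measurable_sum borel_measurable_integrable FA A)
      qed
      moreover have "(LINT x|\<mu>. (\<Sum>i<n. F x * indicator (A i) x)) = 0" for n
        unfolding Bochner_Integration.integral_sum[OF FA[OF A]] using union(3) by (intro sum.neutral) auto
      ultimately show ?case by (simp add: LIMSEQ_const_iff)
    qed
  qed
  have "AE x in \<mu>. F x = 0"
  proof (rule density_unique_real[OF Fi])
    fix A assume "A \<in> sets \<mu>"
    then have "A \<in> sets (completion lborel)" by (auto simp: sets_restrict_space_iff \<Omega>_sets)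
    then obtain S N N' where A: "A = S \<union> N" "N \<subseteq> N'" "N' \<in> null_sets lborel" "S \<in> sets lborel"
      by (rule sets_completionE)
    have "AE x in lebesgue. x \<notin> N'" by (intro AE_completion AE_not_in A)
    then have "AE x in \<mu>. x \<notin> N'"
      unfolding AE_restrict_space_iff[OF \<Omega>_sets(2)] by eventually_elim simp
    then have "AE x in \<mu>. indicator A x *\<^sub>R F x = F x * indicator S x"
      by eventually_elim (use A in \<open>auto simp: indicator_def\<close>)
    then have "(LINT x:A|\<mu>. F x) = (LINT x|\<mu>. F x * indicator S x)"
      unfolding set_lebesgue_integral_def
      using \<open>A \<in> sets \<mu>\<close> FA[of S] A(4) by (intro integral_cong_AE) auto
    also have "\<dots> = 0" using borel0[of S] A(4) by simp
    finally show "(LINT x:A|\<mu>. F x) = (LINT x:A|\<mu>. 0)" by (simp add: set_lebesgue_integral_def)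
  qed simp
  then show ?thesis by eventually_elim (auto simp: F_def)
qed

text \<open>
Countably many closed boxes exhaust \<open>\<Omega>\<close>, and their faces are null sets.
\<close>

theorem fundamental_lemma:
  fixes f :: "real^'n \<Rightarrow> real"
  assumes f: "f \<in> L2 \<Omega>" and 0: "\<And>\<phi>. \<phi> \<in> test_functions \<Omega> \<Longrightarrow> (LINT x|\<mu>. f x * \<phi> x) = 0"
  shows "AE x in \<mu>. f x = 0"
proof -
  obtain D where D: "countable D" "D \<subseteq> Pow \<Omega>" "\<And>X. X \<in> D \<Longrightarrow> \<exists>a b. X = cbox a b" "\<Union>D = \<Omega>"
    using open_countable_Union_open_cbox[OF open_\<Omega>] by metis
  have "AE x in \<mu>. x \<in> X \<longrightarrow> f x = 0" if X: "X \<in> D" for X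
  proof -
    obtain a b where ab: "X = cbox a b" using D X by blast
    have "AE x in lebesgue. x \<notin> cbox a b - box a b"
      using negligible_frontier_interval[of a b] by (intro AE_not_in) (simp add: negligible_iff_null_sets)
    then have "AE x in \<mu>. x \<notin> cbox a b - box a b"
      unfolding AE_restrict_space_iff[OF \<Omega>_sets(2)] by eventually_elim simp
    moreover have "AE x in \<mu>. x \<in> box a b \<longrightarrow> f x = 0"
      by (intro AE_zero_on_box f 0) (use D X ab in auto)
    ultimately show ?thesis by eventually_elim (auto simp: ab)
  qed
  then have "AE x in \<mu>. \<forall>X\<in>D. x \<in> X \<longrightarrow> f x = 0" by (intro AE_ball_countable' D)
  moreover have "AE x in \<mu>. x \<in> \<Omega>" by (intro AE_I2) simp
  ultimately show ?thesis by eventually_elim (use D in auto)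
qed

text \<open>
By the fundamental lemma only null functions are orthogonal to all test functions.
\<close>

lemma test_dense_L2:
  fixes f :: "real^'n \<Rightarrow> real"
  assumes f: "f \<in> L2 \<Omega>" and e: "e > 0"
  shows "\<exists>\<phi>\<in>test_functions \<Omega>. norm_L2 \<Omega> (\<lambda>x. f x - \<phi> x) < e"
proof -
  have "\<exists>m\<in>test_functions \<Omega>. norm_L2 \<Omega> (f - m) < e"
  proof (rule L2.dense_if_orthogonal_trivial[OF _ subspace_test _ f e])
    show "test_functions \<Omega> \<subseteq> L2 \<Omega>" using test_L2 by auto
    fix g :: "real^'n \<Rightarrow> real"
    assume g: "g \<in> L2 \<Omega>" and "\<And>m. m \<in> test_functions \<Omega> \<Longrightarrow> ipL2 \<Omega> g m = 0"
    then have "AE x in \<mu>. g x = 0" by (intro fundamental_lemma) (auto simp: ipL2_def)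
    then have "AE x in \<mu>. g x \<bullet> g x = 0" by eventually_elim simp
    then show "ipL2 \<Omega> g g = 0" unfolding ipL2_def by (rule integral_eq_zero_AE)
  qed
  then show ?thesis by (simp add: fun_diff_def)
qed

end

section \<open>Averages of translates\<close>

text \<open>
The difference of the two sides is the variance.
\<close>

lemma (in prob_space) square_expectation_le:
  assumes [measurable]: "f \<in> borel_measurable M"
  shows "ennreal ((\<integral>x. f x \<partial>M)\<^sup>2) \<le> (\<integral>\<^sup>+x. ennreal ((f x)\<^sup>2) \<partial>M)"
proof (cases "(\<integral>\<^sup>+x. ennreal ((f x)\<^sup>2) \<partial>M) = \<infinity>")
  case True then show ?thesis by simp
next
  case False
  then have sq: "integrable M (\<lambda>x. (f x)\<^sup>2)"
    by (intro integrableI_bounded) (auto simp: less_top)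
  then have f: "integrable M f"
    by (rule square_integrable_imp_integrable[OF assms])
  have "0 \<le> variance f" by (rule variance_positive)
  also have "\<dots> = expectation (\<lambda>x. (f x)\<^sup>2) - (expectation f)\<^sup>2"
    by (rule variance_eq[OF f sq])
  finally show ?thesis
    using nn_integral_eq_integral[OF sq] by (simp add: ennreal_leI)
qed

text \<open>
An average of functions has at most the mean square of its constituents, by Jensen's inequality and
Tonelli's theorem. All estimates for translations and mollifications below are instances, with translates
of one function as constituents and a mollifier or the uniform distribution on \<open>{0..1}\<close> as weight.
\<close>

lemma nn_integral_square_average_le:
  fixes F :: "real^'n \<Rightarrow> 's \<Rightarrow> real"
  assumes "prob_space \<nu>"
    and F: "(\<lambda>(x, s). F x s) \<in> borel_measurable (lborel \<Otimes>\<^sub>M \<nu>)"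
    and B: "AE s in \<nu>. (\<integral>\<^sup>+x. ennreal ((F x s)\<^sup>2) \<partial>lborel) \<le> B"
  shows "(\<integral>\<^sup>+x. ennreal ((\<integral>s. F x s \<partial>\<nu>)\<^sup>2) \<partial>lborel) \<le> B"
proof -
  interpret prob_space \<nu> by fact
  interpret P: pair_sigma_finite "lborel :: (real^'n) measure" \<nu> ..
  have Fx: "F x \<in> borel_measurable \<nu>" for x
    using measurable_compose_Pair1[OF _ F, of x] by simp
  have "(\<integral>\<^sup>+x. ennreal ((\<integral>s. F x s \<partial>\<nu>)\<^sup>2) \<partial>lborel) \<le> (\<integral>\<^sup>+x. \<integral>\<^sup>+s. ennreal ((F x s)\<^sup>2) \<partial>\<nu> \<partial>lborel)"
    by (intro nn_integral_mono square_expectation_le Fx)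
  also have "\<dots> = (\<integral>\<^sup>+s. \<integral>\<^sup>+x. ennreal ((F x s)\<^sup>2) \<partial>lborel \<partial>\<nu>)"
  proof (rule P.Fubini'[symmetric])
    have "(\<lambda>z. ennreal (((\<lambda>(x, s). F x s) z)\<^sup>2)) \<in> borel_measurable (lborel \<Otimes>\<^sub>M \<nu>)"
      using F by measurable
    then show "(\<lambda>(x, s). ennreal ((F x s)\<^sup>2)) \<in> borel_measurable (lborel \<Otimes>\<^sub>M \<nu>)"
      by (simp add: case_prod_beta)
  qed
  also have "\<dots> \<le> (\<integral>\<^sup>+s. B \<partial>\<nu>)" by (rule nn_integral_mono_AE[OF B])
  also have "\<dots> = B" by (simp add: emeasure_space_1)
  finally show ?thesis .
qed

lemma nn_integral_translate:
  fixes f :: "real^'n \<Rightarrow> ennreal"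
  assumes "f \<in> borel_measurable borel"
  shows "(\<integral>\<^sup>+x. f (x + h) \<partial>lborel) = (\<integral>\<^sup>+x. f x \<partial>lborel)"
proof -
  have "(\<integral>\<^sup>+x. f x \<partial>lborel) = (\<integral>\<^sup>+x. f x \<partial>(distr lborel borel ((+) h)))" by (simp add: lborel_distr_plus)
  also have "\<dots> = (\<integral>\<^sup>+x. f (h + x) \<partial>lborel)" using assms by (subst nn_integral_distr) auto
  finally show ?thesis by (simp add: add.commute)
qed

lemma integral_translate:
  fixes f :: "real^'n \<Rightarrow> real"
  assumes "f \<in> borel_measurable borel"
  shows "(\<integral>x. f (x + h) \<partial>lborel) = (\<integral>x. f x \<partial>lborel)"
proof -
  have "(\<integral>x. f x \<partial>lborel) = (\<integral>x. f x \<partial>(distr lborel borel ((+) h)))" by (simp add: lborel_distr_plus)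
  also have "\<dots> = (\<integral>x. f (h + x) \<partial>lborel)" using assms by (subst integral_distr) auto
  finally show ?thesis by (simp add: add.commute)
qed

lemma grad_measurable: "smooth \<phi> \<Longrightarrow> grad \<phi> \<in> borel_measurable borel"
  by (rule borel_measurable_continuous_onI[OF smooth_continuous_grad])

text \<open>
The increment is the average of the directional derivatives along the segment from \<open>x\<close> to \<open>x + h\<close>, and
integrals are invariant under translation.
\<close>

lemma translation_estimate:
  fixes \<phi> :: "real^'n \<Rightarrow> real"
  assumes \<phi>: "smooth \<phi>"
  shows "(\<integral>\<^sup>+x. ennreal ((\<phi> (x + h) - \<phi> x)\<^sup>2) \<partial>lborel)
    \<le> ennreal ((norm h)\<^sup>2) * (\<integral>\<^sup>+x. ennreal ((norm (grad \<phi> x))\<^sup>2) \<partial>lborel)"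
proof -
  define \<nu> where "\<nu> = restrict_space lborel {0..1::real}"
  have \<nu>: "prob_space \<nu>"
    by (rule prob_spaceI) (simp add: \<nu>_def emeasure_restrict_space space_restrict_space)
  note [measurable] = grad_measurable[OF \<phi>]
  have t[measurable]: "(\<lambda>t. t) \<in> \<nu> \<rightarrow>\<^sub>M borel"
    unfolding \<nu>_def by (intro measurable_restrict_space1) simp
  define F where "F x t = grad \<phi> (x + t *\<^sub>R h) \<bullet> h" for x and t :: real
  have FTC: "(\<integral>t. F x t \<partial>\<nu>) = \<phi> (x + h) - \<phi> x" for x
  proof -
    have "(\<integral>t. F x t \<partial>\<nu>) = (\<integral>t. indicator {0..1} t *\<^sub>R F x t \<partial>lborel)"
      unfolding \<nu>_def by (rule integral_restrict_space) simp
    also have "\<dots> = \<phi> (x + 1 *\<^sub>R h) - \<phi> (x + 0 *\<^sub>R h)"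
    proof (rule integral_FTC_Icc)
      show "continuous_on {0..1} (F x)"
        unfolding F_def by (intro continuous_intros continuous_on_compose2[OF smooth_continuous_grad[OF \<phi>, of UNIV]]) auto
      fix t :: real
      have "((\<lambda>t. \<phi> (x + t *\<^sub>R h)) has_derivative (\<lambda>s. grad \<phi> (x + t *\<^sub>R h) \<bullet> (s *\<^sub>R h))) (at t)"
        by (rule has_derivative_compose[of "\<lambda>t. x + t *\<^sub>R h" "\<lambda>s. s *\<^sub>R h" t UNIV \<phi>, OF _ smooth_has_derivative[OF \<phi>]])
           (auto intro!: derivative_eq_intros)
      then have "((\<lambda>t. \<phi> (x + t *\<^sub>R h)) has_vector_derivative F x t) (at t)"
        by (simp add: has_vector_derivative_def F_def)
      then show "((\<lambda>t. \<phi> (x + t *\<^sub>R h)) has_vector_derivative F x t) (at t within {0..1})"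
        by (rule has_vector_derivative_at_within)
    qed simp
    finally show ?thesis by simp
  qed
  let ?G = "\<integral>\<^sup>+x. ennreal ((norm (grad \<phi> x))\<^sup>2) \<partial>lborel"
  have "(\<integral>\<^sup>+x. ennreal ((\<integral>t. F x t \<partial>\<nu>)\<^sup>2) \<partial>lborel) \<le> ennreal ((norm h)\<^sup>2) * ?G"
  proof (rule nn_integral_square_average_le[OF \<nu>])
    show "(\<lambda>(x, t). F x t) \<in> borel_measurable (lborel \<Otimes>\<^sub>M \<nu>)" unfolding F_def by measurable
    show "AE t in \<nu>. (\<integral>\<^sup>+x. ennreal ((F x t)\<^sup>2) \<partial>lborel) \<le> ennreal ((norm h)\<^sup>2) * ?G"
    proof (rule AE_I2)
      fix t
      have "(\<integral>\<^sup>+x. ennreal ((F x t)\<^sup>2) \<partial>lborel) \<le> (\<integral>\<^sup>+x. ennreal ((norm h)\<^sup>2) * ennreal ((norm (grad \<phi> (x + t *\<^sub>R h)))\<^sup>2) \<partial>lborel)"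
      proof (rule nn_integral_mono)
        fix x
        have "(F x t)\<^sup>2 = \<bar>F x t\<bar>\<^sup>2" by simp
        also have "\<dots> \<le> (norm (grad \<phi> (x + t *\<^sub>R h)) * norm h)\<^sup>2"
          unfolding F_def by (intro power_mono Cauchy_Schwarz_ineq2) simp
        finally have "(F x t)\<^sup>2 \<le> (norm h)\<^sup>2 * (norm (grad \<phi> (x + t *\<^sub>R h)))\<^sup>2"
          by (simp add: power_mult_distrib mult.commute)
        then show "ennreal ((F x t)\<^sup>2) \<le> ennreal ((norm h)\<^sup>2) * ennreal ((norm (grad \<phi> (x + t *\<^sub>R h)))\<^sup>2)"
          by (simp add: ennreal_mult'[symmetric] ennreal_leI)
      qed
      also have "\<dots> = ennreal ((norm h)\<^sup>2) * (\<integral>\<^sup>+x. ennreal ((norm (grad \<phi> (x + t *\<^sub>R h)))\<^sup>2) \<partial>lborel)"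
        by (rule nn_integral_cmult) measurable
      also have "(\<integral>\<^sup>+x. ennreal ((norm (grad \<phi> (x + t *\<^sub>R h)))\<^sup>2) \<partial>lborel) = ?G"
        by (rule nn_integral_translate[of "\<lambda>x. ennreal ((norm (grad \<phi> x))\<^sup>2)"]) measurable
      finally show "(\<integral>\<^sup>+x. ennreal ((F x t)\<^sup>2) \<partial>lborel) \<le> ennreal ((norm h)\<^sup>2) * ?G" .
    qed
  qed
  then show ?thesis unfolding FTC .
qed

section \<open>Mollifiers\<close>

definition mollifier :: "real \<Rightarrow> (real^'n \<Rightarrow> real) \<Rightarrow> bool" where
  "mollifier \<epsilon> \<eta> \<longleftrightarrow> \<eta> \<in> test_functions (ball 0 \<epsilon>) \<and> (\<forall>x. 0 \<le> \<eta> x) \<and> integral\<^sup>L lborel \<eta> = 1"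

lemma test_integrable_lborel:
  assumes "\<phi> \<in> test_functions \<Omega>"
  shows "integrable lborel \<phi>"
proof -
  obtain S where S: "compact S" "\<And>x. x \<notin> S \<Longrightarrow> \<phi> x = 0" using test_functionsE[OF assms] by metis
  have "integrable lborel (\<lambda>x. indicator S x *\<^sub>R \<phi> x)"
    by (rule borel_integrable_compact[OF S(1) smooth_continuous[OF test_smooth[OF assms]]])
  moreover have "(\<lambda>x. indicator S x *\<^sub>R \<phi> x) = \<phi>" using S(2) by (auto simp: fun_eq_iff indicator_def)
  ultimately show ?thesis by simp
qed

lemma mollifier_exists:
  assumes "\<epsilon> > 0" shows "\<exists>\<eta> :: real^'n \<Rightarrow> real. mollifier \<epsilon> \<eta>"
proof -
  have "0 \<in> ball (0::real^'n) \<epsilon>" using assms by simp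
  then obtain a b where ab: "cbox a b \<subseteq> ball (0::real^'n) \<epsilon>" "0 \<in> box a b"
    by (rule open_contains_cbox[OF open_ball])
  let ?b = "box_bump 1 a b"
  have t: "?b \<in> test_functions (ball 0 \<epsilon>)" by (rule box_bump_test) (use ab in auto)
  have i: "integrable lborel ?b" by (rule test_integrable_lborel[OF t])
  have "integral\<^sup>L lborel ?b \<noteq> 0"
  proof
    assume "integral\<^sup>L lborel ?b = 0"
    then have "AE x in lborel. ?b x = 0"
      using integral_nonneg_eq_0_iff_AE[OF i AE_I2[OF box_bump_bounds(1)]] by simp
    then have "AE x in lborel. x \<notin> box a b" by eventually_elim (use box_bump_nonzero[of 1 a b] in auto)
    then have "emeasure lborel (box a b) = 0" by (subst (asm) AE_iff_measurable[of "box a b"]) auto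
    then have "negligible (box a b)" by (simp add: negligible_iff_emeasure0)
    then show False using open_not_negligible[OF open_box, of a b] ab(2) by blast
  qed
  moreover have "integral\<^sup>L lborel ?b \<ge> 0" by (rule integral_nonneg_AE[OF AE_I2[OF box_bump_bounds(1)]])
  ultimately have c: "integral\<^sup>L lborel ?b > 0" by simp
  define \<eta> where "\<eta> x = (1 / integral\<^sup>L lborel ?b) * ?b x" for x
  have "mollifier \<epsilon> \<eta>"
    unfolding mollifier_def
  proof (intro conjI allI)
    show "\<eta> \<in> test_functions (ball 0 \<epsilon>)" unfolding \<eta>_def[abs_def] by (rule test_scale[OF t])
    show "0 \<le> \<eta> x" for x unfolding \<eta>_def using c box_bump_bounds(1)[of 1 a b x] by simp
    show "integral\<^sup>L lborel \<eta> = 1" unfolding \<eta>_def[abs_def] using c i by simp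
  qed
  then show ?thesis by blast
qed

context
  fixes \<epsilon> :: real and \<eta> :: "real^'n \<Rightarrow> real"
  assumes \<eta>: "mollifier \<epsilon> \<eta>"
begin

lemma mollifier_measurable: "\<eta> \<in> borel_measurable borel"
  using \<eta> test_smooth smooth_measurable unfolding mollifier_def by blast

lemma mollifier_prob: "prob_space (density lborel (\<lambda>x. ennreal (\<eta> x)))"
proof (rule prob_spaceI)
  have "(\<integral>\<^sup>+x. ennreal (\<eta> x) \<partial>lborel) = ennreal (integral\<^sup>L lborel \<eta>)"
    using \<eta> unfolding mollifier_def by (intro nn_integral_eq_integral test_integrable_lborel) auto
  then show "emeasure (density lborel (\<lambda>x. ennreal (\<eta> x))) (space (density lborel (\<lambda>x. ennreal (\<eta> x)))) = 1"
    using \<eta> mollifier_measurable unfolding mollifier_def by (simp add: emeasure_density)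
qed

lemma integral_mollifier_density:
  assumes "f \<in> borel_measurable borel"
  shows "(\<integral>h. f h \<partial>density lborel (\<lambda>x. ennreal (\<eta> x))) = (\<integral>h. \<eta> h * f h \<partial>lborel)"
  using \<eta> mollifier_measurable assms unfolding mollifier_def by (subst integral_density) auto

text \<open>
Young's inequality: mollification averages the translates of \<open>f\<close>, which all have the same mean square.
\<close>

lemma nn_integral_mollified_le:
  fixes f :: "real^'n \<Rightarrow> real"
  assumes f[measurable]: "f \<in> borel_measurable borel"
  shows "(\<integral>\<^sup>+x. ennreal ((\<integral>h. \<eta> h * f (x + h) \<partial>lborel)\<^sup>2) \<partial>lborel) \<le> (\<integral>\<^sup>+x. ennreal ((f x)\<^sup>2) \<partial>lborel)"
proof -
  let ?\<nu> = "density lborel (\<lambda>x. ennreal (\<eta> x))"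
  have "(\<integral>\<^sup>+x. ennreal ((\<integral>h. f (x + h) \<partial>?\<nu>)\<^sup>2) \<partial>lborel) \<le> (\<integral>\<^sup>+x. ennreal ((f x)\<^sup>2) \<partial>lborel)"
  proof (rule nn_integral_square_average_le[OF mollifier_prob])
    show "(\<lambda>(x, h). f (x + h)) \<in> borel_measurable (lborel \<Otimes>\<^sub>M ?\<nu>)" by measurable
    show "AE h in ?\<nu>. (\<integral>\<^sup>+x. ennreal ((f (x + h))\<^sup>2) \<partial>lborel) \<le> (\<integral>\<^sup>+x. ennreal ((f x)\<^sup>2) \<partial>lborel)"
      by (rule AE_I2, subst nn_integral_translate[of "\<lambda>x. ennreal ((f x)\<^sup>2)"]) auto
  qed
  then show ?thesis by (subst (asm) integral_mollifier_density) auto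
qed

text \<open>
Mollification changes \<open>\<phi>\<close> by an average of increments over distances less than \<open>\<epsilon>\<close>.
\<close>

lemma nn_integral_mollified_diff_le:
  fixes \<phi> :: "real^'n \<Rightarrow> real"
  assumes \<phi>: "\<phi> \<in> test_functions \<Omega>"
  shows "(\<integral>\<^sup>+x. ennreal (((\<integral>h. \<eta> h * \<phi> (x + h) \<partial>lborel) - \<phi> x)\<^sup>2) \<partial>lborel)
     \<le> ennreal (\<epsilon>\<^sup>2) * (\<integral>\<^sup>+x. ennreal ((norm (grad \<phi> x))\<^sup>2) \<partial>lborel)"
proof -
  let ?\<nu> = "density lborel (\<lambda>x. ennreal (\<eta> x))"
  let ?G = "\<integral>\<^sup>+x. ennreal ((norm (grad \<phi> x))\<^sup>2) \<partial>lborel"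
  interpret prob_space ?\<nu> by (rule mollifier_prob)
  note [measurable] = smooth_measurable[OF test_smooth[OF \<phi>]] mollifier_measurable
  obtain B where B: "\<And>x. \<bar>\<phi> x\<bar> \<le> B" using test_bounded[OF \<phi>] by metis
  have "(\<integral>\<^sup>+x. ennreal ((\<integral>h. \<phi> (x + h) - \<phi> x \<partial>?\<nu>)\<^sup>2) \<partial>lborel) \<le> ennreal (\<epsilon>\<^sup>2) * ?G"
  proof (rule nn_integral_square_average_le[OF mollifier_prob])
    show "(\<lambda>(x, h). \<phi> (x + h) - \<phi> x) \<in> borel_measurable (lborel \<Otimes>\<^sub>M ?\<nu>)" by measurable
    show "AE h in ?\<nu>. (\<integral>\<^sup>+x. ennreal ((\<phi> (x + h) - \<phi> x)\<^sup>2) \<partial>lborel) \<le> ennreal (\<epsilon>\<^sup>2) * ?G"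
    proof (subst AE_density)
      show "AE h in lborel. 0 < ennreal (\<eta> h) \<longrightarrow> (\<integral>\<^sup>+x. ennreal ((\<phi> (x + h) - \<phi> x)\<^sup>2) \<partial>lborel) \<le> ennreal (\<epsilon>\<^sup>2) * ?G"
      proof (intro AE_I2 impI)
        fix h assume "0 < ennreal (\<eta> h)"
        then have "\<eta> h \<noteq> 0" by auto
        then have "h \<in> ball 0 \<epsilon>"
          using \<eta> test_functionsE[of \<eta> "ball 0 \<epsilon>"] unfolding mollifier_def by (metis subsetD)
        then have "ennreal ((norm h)\<^sup>2) \<le> ennreal (\<epsilon>\<^sup>2)" by (intro ennreal_leI power_mono) auto
        then show "(\<integral>\<^sup>+x. ennreal ((\<phi> (x + h) - \<phi> x)\<^sup>2) \<partial>lborel) \<le> ennreal (\<epsilon>\<^sup>2) * ?G"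
          using translation_estimate[OF test_smooth[OF \<phi>], of h]
          by (meson dual_order.trans mult_right_mono zero_le)
      qed
    qed measurable
  qed
  moreover have "(\<integral>h. \<phi> (x + h) - \<phi> x \<partial>?\<nu>) = (\<integral>h. \<eta> h * \<phi> (x + h) \<partial>lborel) - \<phi> x" for x
  proof -
    have i: "integrable ?\<nu> (\<lambda>h. \<phi> (x + h))"
      by (rule integrable_const_bound[where B = B]) (use B in auto)
    have "(\<integral>h. \<phi> (x + h) - \<phi> x \<partial>?\<nu>) = (\<integral>h. \<phi> (x + h) \<partial>?\<nu>) - (\<integral>h. \<phi> x \<partial>?\<nu>)"
      by (rule Bochner_Integration.integral_diff[OF i]) simp
    also have "(\<integral>h. \<phi> (x + h) \<partial>?\<nu>) = (\<integral>h. \<eta> h * \<phi> (x + h) \<partial>lborel)"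
      by (rule integral_mollifier_density) measurable
    also have "(\<integral>h. \<phi> x \<partial>?\<nu>) = \<phi> x" using prob_space by (simp del: space_density)
    finally show ?thesis .
  qed
  ultimately show ?thesis by simp
qed

end

section \<open>Mollification on a bounded open set\<close>

lemma compact_support_uniformly_continuous:
  fixes g :: "real^'n \<Rightarrow> 'b::real_normed_vector"
  assumes g: "continuous_on UNIV g" and S: "compact S" "\<And>x. x \<notin> S \<Longrightarrow> g x = 0"
  shows "uniformly_continuous_on UNIV g"
proof (unfold uniformly_continuous_on_def, intro allI impI)
  fix e :: real assume e: "e > 0"
  obtain R where R: "\<And>x. x \<in> S \<Longrightarrow> norm x \<le> R"
    using compact_imp_bounded[OF S(1)] by (auto simp: bounded_iff)
  have "uniformly_continuous_on (cball 0 (R + 1)) g"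
    by (intro compact_uniformly_continuous continuous_on_subset[OF g]) auto
  then obtain d where d: "d > 0"
    "\<And>x y. x \<in> cball 0 (R + 1) \<Longrightarrow> y \<in> cball 0 (R + 1) \<Longrightarrow> dist y x < d \<Longrightarrow> dist (g y) (g x) < e"
    using e unfolding uniformly_continuous_on_def by metis
  show "\<exists>d>0. \<forall>x\<in>UNIV. \<forall>y\<in>UNIV. dist y x < d \<longrightarrow> dist (g y) (g x) < e"
  proof (intro exI[of _ "min d 1"] conjI ballI impI)
    fix x y :: "real^'n" assume xy: "dist y x < min d 1"
    have n: "norm x \<le> norm y + dist y x" "norm y \<le> norm x + dist y x"
      using norm_triangle_sub[of x y] norm_triangle_sub[of y x] by (simp_all add: dist_norm norm_minus_commute)
    show "dist (g y) (g x) < e"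
    proof (cases "x \<in> S \<or> y \<in> S")
      case True
      then have "norm x \<le> R + 1" "norm y \<le> R + 1" using n R[of x] R[of y] xy by auto
      then show ?thesis using d(2)[of x y] xy by simp
    next
      case False then show ?thesis using S(2) e by simp
    qed
  qed (use d in auto)
qed

text \<open>
The gradient is uniformly continuous. The uniformity in \<open>z\<close> justifies differentiation under the integral
sign, here for mollifications and later for \<open>integral_partial_test\<close>.
\<close>

lemma test_uniform_linearization:
  assumes \<eta>: "\<eta> \<in> test_functions U" and e: "e > 0"
  shows "\<exists>d>0. \<forall>z h. norm h < d \<longrightarrow> \<bar>\<eta> (z + h) - \<eta> z - grad \<eta> z \<bullet> h\<bar> \<le> e * norm h"
proof -
  obtain S where S: "compact S" "\<And>x i. x \<notin> S \<Longrightarrow> partial_deriv i \<eta> x = 0"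
    using test_functionsE[OF \<eta>] by metis
  have "uniformly_continuous_on UNIV (grad \<eta>)"
    by (rule compact_support_uniformly_continuous[OF smooth_continuous_grad[OF test_smooth[OF \<eta>]] S(1)])
       (simp add: grad_def S(2) vec_eq_iff)
  then obtain d where d: "d > 0" "\<And>x y. dist y x < d \<Longrightarrow> dist (grad \<eta> y) (grad \<eta> x) < e"
    using e unfolding uniformly_continuous_on_def by (metis UNIV_I)
  have "\<bar>\<eta> (z + h) - \<eta> z - grad \<eta> z \<bullet> h\<bar> \<le> e * norm h" if h: "norm h < d" for z h
  proof -
    have "norm (\<eta> (z + h) - \<eta> z - grad \<eta> z \<bullet> ((z + h) - z)) \<le> norm ((z + h) - z) * e"
    proof (rule differentiable_bound_linearization[where S = "ball z d" and f' = "\<lambda>x h. grad \<eta> x \<bullet> h"])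
      fix t :: real assume t: "t \<in> {0..1}"
      have "norm (t *\<^sub>R h) \<le> 1 * norm h" using t by (simp add: mult_right_mono mult_left_le_one_le)
      then show "z + t *\<^sub>R (z + h - z) \<in> ball z d" using h by (simp add: dist_norm)
    next
      fix x assume "x \<in> ball z d"
      show "(\<eta> has_derivative (\<lambda>h. grad \<eta> x \<bullet> h)) (at x within ball z d)"
        by (rule has_derivative_at_withinI[OF smooth_has_derivative[OF test_smooth[OF \<eta>]]])
      show "onorm ((\<lambda>h. grad \<eta> x \<bullet> h) - (\<lambda>h. grad \<eta> z \<bullet> h)) \<le> e"
      proof (rule onorm_le)
        fix k
        have "norm ((grad \<eta> x - grad \<eta> z) \<bullet> k) \<le> norm (grad \<eta> x - grad \<eta> z) * norm k"
          using Cauchy_Schwarz_ineq2 by simp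
        also have "\<dots> \<le> e * norm k"
          using d(2)[of x z] \<open>x \<in> ball z d\<close> by (intro mult_right_mono) (auto simp: dist_norm norm_minus_commute)
        finally show "norm (((\<lambda>h. grad \<eta> x \<bullet> h) - (\<lambda>h. grad \<eta> z \<bullet> h)) k) \<le> e * norm k"
          by (simp add: inner_diff_left)
      qed
    qed (use d in auto)
    then show ?thesis by (simp add: mult.commute)
  qed
  with d(1) show ?thesis by blast
qed

context bounded_open
begin

text \<open>
The kernel is taken at \<open>y - x\<close>, so that the mollification is the average of \<open>f (x + h)\<close> with weight \<open>\<eta> h\<close> and
only translations occur; \<open>x\<close>-derivatives of the kernel are then minus its \<open>y\<close>-derivatives, which is the sign of
an integration by parts.
\<close>

definition moll :: "(real^'n \<Rightarrow> real) \<Rightarrow> (real^'n \<Rightarrow> real) \<Rightarrow> real^'n \<Rightarrow> real" where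
  "moll \<eta> f x = (LINT y|\<mu>. \<eta> (y - x) * f y)"

lemma integrable_bounded_mult:
  fixes f g :: "real^'n \<Rightarrow> real"
  assumes f: "integrable \<mu> f" and g: "g \<in> borel_measurable \<mu>" and B: "\<And>x. \<bar>g x\<bar> \<le> B"
  shows "integrable \<mu> (\<lambda>x. g x * f x)"
proof (rule Bochner_Integration.integrable_bound)
  show "integrable \<mu> (\<lambda>x. B * \<bar>f x\<bar>)" using f by (intro integrable_mult_right integrable_abs)
  show "(\<lambda>x. g x * f x) \<in> borel_measurable \<mu>"
    by (intro borel_measurable_times g borel_measurable_integrable[OF f])
  have "\<bar>g x\<bar> * \<bar>f x\<bar> \<le> \<bar>B\<bar> * \<bar>f x\<bar>" for x by (rule mult_right_mono) (use B[of x] in auto)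
  then show "AE x in \<mu>. norm (g x * f x) \<le> norm (B * \<bar>f x\<bar>)" by (intro AE_I2) (simp add: abs_mult)
qed

lemma test_translate_measurable:
  assumes "\<eta> \<in> test_functions U" shows "(\<lambda>y. \<eta> (y - x)) \<in> borel_measurable \<mu>"
  by (rule borel_measurable_lebesgue_on[OF smooth_measurable[OF smooth_translate[OF test_smooth[OF assms]]]])

lemma moll_integrable:
  assumes \<eta>: "\<eta> \<in> test_functions U" and f: "integrable \<mu> f"
  shows "integrable \<mu> (\<lambda>y. \<eta> (y - x) * f y)"
proof -
  obtain B where B: "\<And>x. \<bar>\<eta> x\<bar> \<le> B" using test_bounded[OF \<eta>] by metis
  show ?thesis by (rule integrable_bounded_mult[OF f test_translate_measurable[OF \<eta>] B])
qed

lemma moll_has_derivative: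
  assumes \<eta>: "\<eta> \<in> test_functions U" and f: "integrable \<mu> f"
  shows "(moll \<eta> f has_derivative (\<lambda>h. (\<chi> i. - moll (partial_deriv i \<eta>) f x) \<bullet> h)) (at x)"
  unfolding has_derivative_at_alt
proof (intro conjI allI impI)
  let ?G = "\<chi> i. - moll (partial_deriv i \<eta>) f x"
  show "bounded_linear (\<lambda>h. ?G \<bullet> h)" by (rule bounded_linear_inner_right)
  fix e :: real assume e: "e > 0"
  define I where "I = (LINT y|\<mu>. \<bar>f y\<bar>)"
  have I0: "I \<ge> 0" unfolding I_def by simp
  have "e / (I + 1) > 0" using e I0 by simp
  then obtain d where d: "d > 0"
    "\<And>z h. norm h < d \<Longrightarrow> \<bar>\<eta> (z + h) - \<eta> z - grad \<eta> z \<bullet> h\<bar> \<le> e / (I + 1) * norm h"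
    using test_uniform_linearization[OF \<eta>] by metis
  have pi: "integrable \<mu> (\<lambda>y. partial_deriv i \<eta> (y - x) * f y)" for i
    by (rule moll_integrable[OF test_partial[OF \<eta>] f])
  have Gh: "?G \<bullet> h = - (LINT y|\<mu>. (grad \<eta> (y - x) \<bullet> h) * f y)"
    and Gi: "integrable \<mu> (\<lambda>y. (grad \<eta> (y - x) \<bullet> h) * f y)" for h
  proof -
    have eq: "(grad \<eta> (y - x) \<bullet> h) * f y = (\<Sum>i\<in>UNIV. h $ i * (partial_deriv i \<eta> (y - x) * f y))" for y
      by (simp add: inner_vec_def grad_def sum_distrib_left sum_distrib_right mult_ac)
    show "integrable \<mu> (\<lambda>y. (grad \<eta> (y - x) \<bullet> h) * f y)"
      unfolding eq by (intro Bochner_Integration.integrable_sum integrable_mult_right pi)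
    have "(LINT y|\<mu>. (grad \<eta> (y - x) \<bullet> h) * f y) = (\<Sum>i\<in>UNIV. LINT y|\<mu>. h $ i * (partial_deriv i \<eta> (y - x) * f y))"
      unfolding eq by (intro Bochner_Integration.integral_sum integrable_mult_right pi)
    also have "\<dots> = (\<Sum>i\<in>UNIV. h $ i * moll (partial_deriv i \<eta>) f x)"
      by (simp add: moll_def)
    finally show "?G \<bullet> h = - (LINT y|\<mu>. (grad \<eta> (y - x) \<bullet> h) * f y)"
      by (simp add: inner_vec_def sum_negf mult.commute)
  qed
  show "\<exists>d>0. \<forall>y. norm (y - x) < d \<longrightarrow> norm (moll \<eta> f y - moll \<eta> f x - ?G \<bullet> (y - x)) \<le> e * norm (y - x)"
  proof (intro exI[of _ d] conjI allI impI d(1))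
    fix x' assume x': "norm (x' - x) < d"
    define h where "h = x' - x"
    have "moll \<eta> f x' - moll \<eta> f x - ?G \<bullet> h
       = (LINT y|\<mu>. \<eta> (y - x') * f y - \<eta> (y - x) * f y + (grad \<eta> (y - x) \<bullet> h) * f y)"
      unfolding Gh unfolding moll_def using moll_integrable[OF \<eta> f] Gi by simp
    also have "norm \<dots> \<le> (LINT y|\<mu>. (e / (I + 1) * norm h) * \<bar>f y\<bar>)"
    proof (rule Bochner_Integration.integral_norm_bound_integral)
      show "integrable \<mu> (\<lambda>y. \<eta> (y - x') * f y - \<eta> (y - x) * f y + (grad \<eta> (y - x) \<bullet> h) * f y)"
        using moll_integrable[OF \<eta> f] Gi by simp
      show "integrable \<mu> (\<lambda>y. (e / (I + 1) * norm h) * \<bar>f y\<bar>)" using f by simp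
      fix y
      have "\<bar>\<eta> ((y - x) + (- h)) - \<eta> (y - x) - grad \<eta> (y - x) \<bullet> (- h)\<bar> \<le> e / (I + 1) * norm (- h)"
        using x' by (intro d(2)) (simp add: h_def norm_minus_commute)
      then have "\<bar>\<eta> (y - x') - \<eta> (y - x) + grad \<eta> (y - x) \<bullet> h\<bar> * \<bar>f y\<bar> \<le> (e / (I + 1) * norm h) * \<bar>f y\<bar>"
        by (intro mult_right_mono) (simp_all add: h_def algebra_simps norm_minus_commute)
      then show "norm (\<eta> (y - x') * f y - \<eta> (y - x) * f y + (grad \<eta> (y - x) \<bullet> h) * f y) \<le> (e / (I + 1) * norm h) * \<bar>f y\<bar>"
        by (simp add: abs_mult[symmetric] algebra_simps)
    qed
    also have "\<dots> = e * norm h * (I / (I + 1))" by (simp add: I_def)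
    also have "\<dots> \<le> e * norm h * 1" using e I0 by (intro mult_left_mono) auto
    finally show "norm (moll \<eta> f x' - moll \<eta> f x - ?G \<bullet> (x' - x)) \<le> e * norm (x' - x)"
      by (simp add: h_def)
  qed
qed

lemma moll_partial:
  assumes \<eta>: "\<eta> \<in> test_functions U" and f: "integrable \<mu> f"
  shows "partial_deriv i (moll \<eta> f) x = - moll (partial_deriv i \<eta>) f x"
  using partial_derivI[OF moll_has_derivative[OF assms]] by (simp add: inner_axis)

lemma moll_smooth:
  assumes \<eta>: "\<eta> \<in> test_functions U" and f: "integrable \<mu> f"
  shows "smooth (moll \<eta> f)"
proof -
  have "C_k k (moll \<eta> f)" if "\<eta> \<in> test_functions U" for k \<eta>
    using that
  proof (induction k arbitrary: \<eta>)
    case 0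
    show ?case unfolding C_k.simps
      by (intro continuous_at_imp_continuous_on ballI) (rule has_derivative_continuous[OF moll_has_derivative[OF 0 f]])
  next
    case (Suc k)
    have "partial_deriv i (moll \<eta> f) = (\<lambda>x. (-1) * moll (partial_deriv i \<eta>) f x)" for i
      using moll_partial[OF Suc.prems f] by (auto simp: fun_eq_iff)
    moreover have "C_k k (\<lambda>x. (-1) * moll (partial_deriv i \<eta>) f x)" for i
      by (intro C_k_mult C_k_const Suc.IH test_partial Suc.prems)
    moreover have "moll \<eta> f differentiable_on UNIV"
      unfolding differentiable_on_UNIV differentiable_def
      by (intro allI exI) (rule moll_has_derivative[OF Suc.prems f])
    ultimately show ?case by (simp add: differentiable_on_UNIV)
  qed
  with \<eta> show ?thesis by (simp add: smooth_def)
qed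

lemma moll_nonzero:
  assumes \<eta>: "mollifier \<epsilon> \<eta>" and S: "\<And>y. y \<notin> S \<Longrightarrow> f y = 0" and nz: "moll \<eta> f x \<noteq> 0"
  shows "\<exists>y\<in>S. dist x y < \<epsilon>"
proof (rule ccontr)
  assume neg: "\<not> (\<exists>y\<in>S. dist x y < \<epsilon>)"
  have "\<eta> (y - x) * f y = 0" for y
  proof (cases "y \<in> S")
    case True
    then have "y - x \<notin> ball 0 \<epsilon>" using neg by (auto simp: dist_norm norm_minus_commute)
    then show ?thesis using \<eta> test_functionsE[of \<eta> "ball 0 \<epsilon>"] unfolding mollifier_def
      by (metis mult_zero_left subsetD)
  qed (simp add: S)
  then have "(\<lambda>y. \<eta> (y - x) * f y) = (\<lambda>_. 0)" by blast
  then show False using nz unfolding moll_def by simp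
qed

text \<open>
The mollification lives in the \<open>\<epsilon>\<close>-neighbourhood of \<open>S\<close>, which for small \<open>\<epsilon>\<close> is still inside \<open>\<Omega>\<close>.
\<close>

lemma moll_test:
  assumes S: "compact S" "S \<subseteq> \<Omega>"
  obtains \<epsilon>0 where "\<epsilon>0 > 0"
    "\<And>\<epsilon> (\<eta> :: real^'n \<Rightarrow> real) f. \<epsilon> \<le> \<epsilon>0 \<Longrightarrow> mollifier \<epsilon> \<eta> \<Longrightarrow> integrable \<mu> f \<Longrightarrow> (\<And>y. y \<notin> S \<Longrightarrow> f y = 0) \<Longrightarrow> moll \<eta> f \<in> test_functions \<Omega>"
proof -
  obtain e where e: "e > 0" "(\<Union>x\<in>S. cball x e) \<subseteq> \<Omega>"
    using compact_subset_open_imp_cball_epsilon_subset[OF S(1) open_\<Omega> S(2)] by metis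
  show thesis
  proof (rule that[OF e(1)])
    fix \<epsilon> and \<eta> f :: "real^'n \<Rightarrow> real"
    assume \<epsilon>: "\<epsilon> \<le> e" and \<eta>: "mollifier \<epsilon> \<eta>" and f: "integrable \<mu> f" and f0: "\<And>y. y \<notin> S \<Longrightarrow> f y = 0"
    show "moll \<eta> f \<in> test_functions \<Omega>"
    proof (rule test_functionsI)
      show "smooth (moll \<eta> f)" using moll_smooth[OF _ f] \<eta> unfolding mollifier_def by blast
      show "compact {x + y |x y. x \<in> S \<and> y \<in> cball 0 e}" by (rule compact_sums[OF S(1) compact_cball])
      show "{x + y |x y. x \<in> S \<and> y \<in> cball 0 e} \<subseteq> \<Omega>"
      proof clarify
        fix x y assume "x \<in> S" "y \<in> cball (0::real^'n) e"
        then have "x + y \<in> cball x e" by (simp add: dist_norm)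
        then show "x + y \<in> \<Omega>" using e(2) \<open>x \<in> S\<close> by blast
      qed
      fix x assume x: "x \<notin> {x + y |x y. x \<in> S \<and> y \<in> cball 0 e}"
      show "moll \<eta> f x = 0"
      proof (rule ccontr)
        assume "moll \<eta> f x \<noteq> 0"
        then have "\<exists>y\<in>S. dist x y < \<epsilon>" by (rule moll_nonzero[OF \<eta> _ , rotated]) (rule f0)
        then obtain y where y: "y \<in> S" "dist x y < \<epsilon>" by blast
        have "x = y + (x - y)" "x - y \<in> cball 0 e" using y \<epsilon> by (auto simp: dist_norm norm_minus_commute)
        with y(1) have "x \<in> {x + y |x y. x \<in> S \<and> y \<in> cball 0 e}" by blast
        then show False using x by contradiction
      qed
    qed
  qed
qed

text \<open>
Tonelli's theorem applies to functions that are measurable for the product of Borel \<open>\<sigma>\<close>-algebras,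
whereas members of \<open>L2\<close> are Lebesgue measurable; the two differ on a null set.
\<close>

lemma borel_representative:
  fixes f :: "real^'n \<Rightarrow> real"
  assumes f: "f \<in> borel_measurable \<mu>"
  obtains f0 where "f0 \<in> borel_measurable borel" "AE x in lebesgue. indicator \<Omega> x * f x = f0 x"
proof -
  have "(\<lambda>x. indicator \<Omega> x *\<^sub>R f x) \<in> borel_measurable lebesgue"
    using f by (subst (asm) borel_measurable_restrict_space_iff[OF \<Omega>_sets(2)]) (simp add: mult.commute)
  from completion_ex_borel_measurable_real[OF this] show thesis
    using that by (auto simp: AE_completion)
qed

lemma nn_integral_\<Omega>_eq_lborel:
  assumes "AE x in lebesgue. indicator \<Omega> x * f x = f0 x"
  shows "(\<integral>\<^sup>+x. ennreal ((f x)\<^sup>2) \<partial>\<mu>) = (\<integral>\<^sup>+x. ennreal ((f0 x)\<^sup>2) \<partial>lborel)"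
proof -
  have "(\<integral>\<^sup>+x. ennreal ((f x)\<^sup>2) \<partial>\<mu>) = (\<integral>\<^sup>+x. ennreal ((f x)\<^sup>2) * indicator \<Omega> x \<partial>lebesgue)"
    by (rule nn_integral_restrict_space[OF \<Omega>_sets(2)])
  also have "\<dots> = (\<integral>\<^sup>+x. ennreal ((f0 x)\<^sup>2) \<partial>lebesgue)"
  proof (rule nn_integral_cong_AE, use assms in eventually_elim)
    case (elim x) then show ?case by (cases "x \<in> \<Omega>") (auto simp: indicator_def)
  qed
  finally show ?thesis by (simp add: nn_integral_completion)
qed

lemma moll_eq_lborel:
  assumes fm: "f \<in> borel_measurable \<mu>" and f: "AE x in lebesgue. indicator \<Omega> x * f x = f0 x" and f0: "f0 \<in> borel_measurable borel"
    and \<eta>: "\<eta> \<in> borel_measurable borel"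
  shows "moll \<eta> f x = (\<integral>h. \<eta> h * f0 (x + h) \<partial>lborel)"
proof -
  note [measurable] = f0 \<eta>
  have "(\<lambda>y. \<eta> (y - x) * f0 y) \<in> borel_measurable (completion lborel)"
    by (rule measurable_completion) measurable
  have "moll \<eta> f x = (\<integral>y. indicator \<Omega> y *\<^sub>R (\<eta> (y - x) * f y) \<partial>lebesgue)"
    unfolding moll_def by (rule integral_restrict_space[OF \<Omega>_sets(2)])
  also have "\<dots> = (\<integral>y. \<eta> (y - x) * f0 y \<partial>lebesgue)"
  proof (rule integral_cong_AE)
    have "(\<lambda>y. \<eta> (y - x) * f y) \<in> borel_measurable \<mu>"
      by (intro borel_measurable_times fm borel_measurable_lebesgue_on) measurable
    then show "(\<lambda>y. indicator \<Omega> y *\<^sub>R (\<eta> (y - x) * f y)) \<in> borel_measurable lebesgue"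
      by (subst (asm) borel_measurable_restrict_space_iff[OF \<Omega>_sets(2)]) (simp add: mult.commute)
    show "(\<lambda>y. \<eta> (y - x) * f0 y) \<in> borel_measurable lebesgue" by fact
    show "AE y in lebesgue. indicator \<Omega> y *\<^sub>R (\<eta> (y - x) * f y) = \<eta> (y - x) * f0 y"
      using f by eventually_elim (simp add: mult.left_commute)
  qed
  also have "\<dots> = (\<integral>y. \<eta> (y - x) * f0 y \<partial>lborel)" by (rule integral_completion) measurable
  also have "\<dots> = (\<integral>h. \<eta> ((h + x) - x) * f0 (h + x) \<partial>lborel)"
    by (rule integral_translate[of "\<lambda>y. \<eta> (y - x) * f0 y", symmetric]) measurable
  finally show ?thesis by (simp add: add.commute)
qed

lemma nn_integral_\<Omega>_le_lborel: "(\<integral>\<^sup>+x. g x \<partial>\<mu>) \<le> (\<integral>\<^sup>+x. g x \<partial>lborel)"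
proof -
  have "(\<integral>\<^sup>+x. g x \<partial>\<mu>) = (\<integral>\<^sup>+x. g x * indicator \<Omega> x \<partial>lebesgue)"
    by (rule nn_integral_restrict_space[OF \<Omega>_sets(2)])
  also have "\<dots> \<le> (\<integral>\<^sup>+x. g x \<partial>lebesgue)" by (intro nn_integral_mono) (auto simp: indicator_def)
  finally show ?thesis by (simp add: nn_integral_completion)
qed

lemma moll_measurable:
  assumes "mollifier \<epsilon> \<eta>" "integrable \<mu> f" shows "moll \<eta> f \<in> borel_measurable \<mu>"
  using assms unfolding mollifier_def
  by (intro borel_measurable_lebesgue_on smooth_measurable) (blast intro: moll_smooth)

lemma moll_L2:
  assumes \<eta>: "mollifier \<epsilon> \<eta>" and f: "f \<in> L2 \<Omega>"
  shows "moll \<eta> f \<in> L2 \<Omega>" and "norm_L2 \<Omega> (moll \<eta> f) \<le> norm_L2 \<Omega> f"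
proof -
  obtain f0 where f0: "f0 \<in> borel_measurable borel" "AE x in lebesgue. indicator \<Omega> x * f x = f0 x"
    using borel_representative[OF L2_measurable[OF f]] by metis
  have "(\<integral>\<^sup>+x. ennreal ((norm (moll \<eta> f x))\<^sup>2) \<partial>\<mu>) \<le> (\<integral>\<^sup>+x. ennreal ((moll \<eta> f x)\<^sup>2) \<partial>lborel)"
    using nn_integral_\<Omega>_le_lborel[of "\<lambda>x. ennreal ((moll \<eta> f x)\<^sup>2)"] by simp
  also have "\<dots> \<le> (\<integral>\<^sup>+x. ennreal ((f0 x)\<^sup>2) \<partial>lborel)"
    unfolding moll_eq_lborel[OF L2_measurable[OF f] f0(2,1) mollifier_measurable[OF \<eta>]]
    by (rule nn_integral_mollified_le[OF \<eta> f0(1)])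
  also have "\<dots> = ennreal ((norm_L2 \<Omega> f)\<^sup>2)"
    using nn_integral_norm_sq_L2[OF f] nn_integral_\<Omega>_eq_lborel[OF f0(2)] by simp
  finally have *: "(\<integral>\<^sup>+x. ennreal ((norm (moll \<eta> f x))\<^sup>2) \<partial>\<mu>) \<le> ennreal ((norm_L2 \<Omega> f)\<^sup>2)" .
  have m: "moll \<eta> f \<in> borel_measurable \<mu>" by (rule moll_measurable[OF \<eta> L2_integrable[OF f]])
  show "moll \<eta> f \<in> L2 \<Omega>" "norm_L2 \<Omega> (moll \<eta> f) \<le> norm_L2 \<Omega> f"
    using L2_if_nn_integral_le[OF m norm_L2_nonneg *] by auto
qed

lemma test_extended_by_zero:
  assumes "\<phi> \<in> test_functions \<Omega>"
  shows "AE x in lebesgue. indicator \<Omega> x * \<phi> x = \<phi> x"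
    and "(\<integral>\<^sup>+x. ennreal ((\<phi> x)\<^sup>2) \<partial>lborel) = ennreal ((norm_L2 \<Omega> \<phi>)\<^sup>2)"
proof -
  have "\<phi> x = 0" if "x \<notin> \<Omega>" for x using test_functionsE[OF assms] that by (metis subsetD)
  then have "indicator \<Omega> x * \<phi> x = \<phi> x" for x by (cases "x \<in> \<Omega>") auto
  then show *: "AE x in lebesgue. indicator \<Omega> x * \<phi> x = \<phi> x" by (intro AE_I2)
  show "(\<integral>\<^sup>+x. ennreal ((\<phi> x)\<^sup>2) \<partial>lborel) = ennreal ((norm_L2 \<Omega> \<phi>)\<^sup>2)"
    using nn_integral_\<Omega>_eq_lborel[OF *] nn_integral_norm_sq_L2[OF test_L2[OF assms]] by simp
qed

lemma test_grad_L2: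
  assumes \<phi>: "\<phi> \<in> test_functions \<Omega>"
  shows "grad \<phi> \<in> L2 \<Omega>"
proof -
  obtain S where S: "compact S" "\<And>x i. x \<notin> S \<Longrightarrow> partial_deriv i \<phi> x = 0"
    using test_functionsE[OF \<phi>] by metis
  have "bounded (grad \<phi> ` S)"
    by (intro compact_imp_bounded compact_continuous_image smooth_continuous_grad test_smooth[OF \<phi>] S(1))
  then obtain B where B: "B > 0" "\<And>x. x \<in> S \<Longrightarrow> norm (grad \<phi> x) \<le> B" by (auto simp: bounded_pos)
  have "norm (grad \<phi> x) \<le> B" for x
  proof (cases "x \<in> S")
    case False
    then have "grad \<phi> x = 0" by (simp add: grad_def S(2) vec_eq_iff)
    then show ?thesis using B(1) by simp
  qed (rule B(2))
  then show ?thesis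
    by (intro L2_bounded_measurable[where C = B] borel_measurable_lebesgue_on grad_measurable test_smooth[OF \<phi>] AE_I2)
qed

lemma nn_integral_grad_test:
  assumes \<phi>: "\<phi> \<in> test_functions \<Omega>"
  shows "(\<integral>\<^sup>+x. ennreal ((norm (grad \<phi> x))\<^sup>2) \<partial>lborel) = ennreal ((norm_L2 \<Omega> (grad \<phi>))\<^sup>2)"
proof -
  have "partial_deriv i \<phi> x = 0" if "x \<notin> \<Omega>" for x i using test_functionsE[OF \<phi>] that by (metis subsetD)
  then have "grad \<phi> x = 0" if "x \<notin> \<Omega>" for x using that by (simp add: grad_def vec_eq_iff)
  then have "indicator \<Omega> x * norm (grad \<phi> x) = norm (grad \<phi> x)" for x by (cases "x \<in> \<Omega>") auto
  then have "AE x in lebesgue. indicator \<Omega> x * norm (grad \<phi> x) = norm (grad \<phi> x)"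
    by (intro AE_I2)
  from nn_integral_\<Omega>_eq_lborel[OF this] show ?thesis
    using nn_integral_norm_sq_L2[OF test_grad_L2[OF \<phi>]] by simp
qed

lemma moll_test_close:
  assumes \<eta>: "mollifier \<epsilon> \<eta>" and \<phi>: "\<phi> \<in> test_functions \<Omega>" and \<epsilon>: "\<epsilon> > 0"
  shows "norm_L2 \<Omega> (\<lambda>x. moll \<eta> \<phi> x - \<phi> x) \<le> \<epsilon> * norm_L2 \<Omega> (grad \<phi>)"
proof (rule L2_if_nn_integral_le(2))
  have "(\<integral>\<^sup>+x. ennreal ((norm (moll \<eta> \<phi> x - \<phi> x))\<^sup>2) \<partial>\<mu>) \<le> (\<integral>\<^sup>+x. ennreal ((moll \<eta> \<phi> x - \<phi> x)\<^sup>2) \<partial>lborel)"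
    using nn_integral_\<Omega>_le_lborel[of "\<lambda>x. ennreal ((moll \<eta> \<phi> x - \<phi> x)\<^sup>2)"] by simp
  also have "\<dots> \<le> ennreal (\<epsilon>\<^sup>2) * ennreal ((norm_L2 \<Omega> (grad \<phi>))\<^sup>2)"
    unfolding nn_integral_grad_test[OF \<phi>, symmetric]
      moll_eq_lborel[OF test_measurable[OF \<phi>] test_extended_by_zero(1)[OF \<phi>] smooth_measurable[OF test_smooth[OF \<phi>]] mollifier_measurable[OF \<eta>]]
    by (rule nn_integral_mollified_diff_le[OF \<eta> \<phi>])
  also have "\<dots> = ennreal ((\<epsilon> * norm_L2 \<Omega> (grad \<phi>))\<^sup>2)"
    by (simp add: ennreal_mult'[symmetric] power_mult_distrib)
  finally show "(\<integral>\<^sup>+x. ennreal ((norm (moll \<eta> \<phi> x - \<phi> x))\<^sup>2) \<partial>\<mu>) \<le> ennreal ((\<epsilon> * norm_L2 \<Omega> (grad \<phi>))\<^sup>2)" .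
  show "(\<lambda>x. moll \<eta> \<phi> x - \<phi> x) \<in> borel_measurable \<mu>"
    by (intro borel_measurable_diff test_measurable[OF \<phi>] moll_measurable[OF \<eta> L2_integrable[OF test_L2[OF \<phi>]]])
qed (use \<epsilon> norm_L2_nonneg[of \<Omega> "grad \<phi>"] in simp)

lemma moll_diff:
  assumes \<eta>: "mollifier \<epsilon> \<eta>" and f: "integrable \<mu> f" and g: "integrable \<mu> g"
  shows "moll \<eta> (\<lambda>x. f x - g x) x = moll \<eta> f x - moll \<eta> g x"
proof -
  have t: "\<eta> \<in> test_functions (ball 0 \<epsilon>)" using \<eta> by (simp add: mollifier_def)
  show ?thesis
    unfolding moll_def right_diff_distrib
    by (rule Bochner_Integration.integral_diff[OF moll_integrable[OF t f] moll_integrable[OF t g]])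
qed

text \<open>
On the dense set of test functions there is even a rate, \<open>moll_test_close\<close>, and mollifications are
contractions.
\<close>

lemma moll_converges:
  assumes f: "f \<in> L2 \<Omega>" and e: "e > 0"
  shows "\<exists>\<epsilon>0>0. \<forall>\<epsilon> (\<eta> :: real^'n \<Rightarrow> real). 0 < \<epsilon> \<longrightarrow> \<epsilon> \<le> \<epsilon>0 \<longrightarrow> mollifier \<epsilon> \<eta> \<longrightarrow> norm_L2 \<Omega> (\<lambda>x. moll \<eta> f x - f x) < e"
proof -
  have "e/3 > 0" using e by simp
  then obtain \<phi> where \<phi>: "\<phi> \<in> test_functions \<Omega>" "norm_L2 \<Omega> (\<lambda>x. f x - \<phi> x) < e/3"
    using test_dense_L2[OF f] by blast
  define N where "N = norm_L2 \<Omega> (grad \<phi>)"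
  have N: "N \<ge> 0" unfolding N_def by (rule norm_L2_nonneg)
  have \<phi>L: "\<phi> \<in> L2 \<Omega>" by (rule test_L2[OF \<phi>(1)])
  show ?thesis
  proof (intro exI[of _ "e / (3 * (N + 1))"] conjI allI impI)
    show "e / (3 * (N + 1)) > 0" using e N by simp
    fix \<epsilon> and \<eta> :: "real^'n \<Rightarrow> real" assume \<epsilon>: "0 < \<epsilon>" "\<epsilon> \<le> e / (3 * (N + 1))" and \<eta>: "mollifier \<epsilon> \<eta>"
    let ?d = "\<lambda>x. f x - \<phi> x"
    have d: "?d \<in> L2 \<Omega>" by (rule L2_diff[OF f \<phi>L])
    have eq: "(\<lambda>x. moll \<eta> f x - f x) = (\<lambda>x. moll \<eta> ?d x + ((moll \<eta> \<phi> x - \<phi> x) + (-1) *\<^sub>R ?d x))"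
      using moll_diff[OF \<eta> L2_integrable[OF f] L2_integrable[OF \<phi>L]] by (auto simp: fun_eq_iff)
    have p: "(\<lambda>x. moll \<eta> \<phi> x - \<phi> x) \<in> L2 \<Omega>" by (intro L2_diff moll_L2(1)[OF \<eta>] \<phi>L)
    have "norm_L2 \<Omega> (\<lambda>x. moll \<eta> f x - f x) \<le> norm_L2 \<Omega> (moll \<eta> ?d) + norm_L2 \<Omega> (\<lambda>x. (moll \<eta> \<phi> x - \<phi> x) + (-1) *\<^sub>R ?d x)"
      unfolding eq by (intro norm_L2_triangle moll_L2(1)[OF \<eta>] d L2_add p L2_scale)
    also have "\<dots> \<le> norm_L2 \<Omega> ?d + (norm_L2 \<Omega> (\<lambda>x. moll \<eta> \<phi> x - \<phi> x) + norm_L2 \<Omega> (\<lambda>x. (-1) *\<^sub>R ?d x))"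
      by (intro add_mono moll_L2(2)[OF \<eta>] d norm_L2_triangle p L2_scale)
    also have "norm_L2 \<Omega> (\<lambda>x. (-1) *\<^sub>R ?d x) = norm_L2 \<Omega> ?d" by (simp add: norm_L2_def power2_commute)
    also have "norm_L2 \<Omega> (\<lambda>x. moll \<eta> \<phi> x - \<phi> x) \<le> \<epsilon> * N"
      unfolding N_def by (rule moll_test_close[OF \<eta> \<phi>(1) \<epsilon>(1)])
    also have "\<epsilon> * N \<le> e / (3 * (N + 1)) * (N + 1)" using \<epsilon> N by (intro mult_mono) auto
    also have "\<dots> = e / 3" using N by (simp add: field_simps)
    finally show "norm_L2 \<Omega> (\<lambda>x. moll \<eta> f x - f x) < e" using \<phi>(2) by simp
  qed
qed

text \<open>
After a shift \<open>h\<close> longer than the diameter of \<open>\<Omega>\<close> the supports of the function and of its translate are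
disjoint. Then the increment is at least as large as the function itself in mean square, while
\<open>translation_estimate\<close> bounds it by the gradient.
\<close>

lemma Poincare_test:
  obtains C where "C > 0" "\<And>\<phi>. \<phi> \<in> test_functions \<Omega> \<Longrightarrow> norm_L2 \<Omega> \<phi> \<le> C * norm_L2 \<Omega> (grad \<phi>)"
proof -
  obtain R where R: "R > 0" "\<And>x. x \<in> \<Omega> \<Longrightarrow> norm x \<le> R" using bounded_\<Omega> by (auto simp: bounded_pos)
  \<comment> \<open>Any direction will do, and \<open>2 * R\<close> bounds the diameter of \<open>\<Omega>\<close>.\<close>
  define h :: "real^'n" where "h = (3 * R) *\<^sub>R axis undefined 1"
  have nh: "norm h = 3 * R" using R(1) by (simp add: h_def)
  have "norm_L2 \<Omega> \<phi> \<le> (3 * R) * norm_L2 \<Omega> (grad \<phi>)" if \<phi>: "\<phi> \<in> test_functions \<Omega>" for \<phi>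
  proof (rule L2_if_nn_integral_le(2)[OF test_measurable[OF \<phi>]])
    have z: "\<phi> x = 0" if "x \<notin> \<Omega>" for x using test_functionsE[OF \<phi>] that by (metis subsetD)
    have "(\<integral>\<^sup>+x. ennreal ((norm (\<phi> x))\<^sup>2) \<partial>\<mu>) \<le> (\<integral>\<^sup>+x. ennreal ((norm (\<phi> x))\<^sup>2) \<partial>lborel)"
      by (rule nn_integral_\<Omega>_le_lborel)
    also have "\<dots> \<le> (\<integral>\<^sup>+x. ennreal ((\<phi> (x + h) - \<phi> x)\<^sup>2) \<partial>lborel)"
    proof (intro nn_integral_mono ennreal_leI)
      fix x
      show "(norm (\<phi> x))\<^sup>2 \<le> (\<phi> (x + h) - \<phi> x)\<^sup>2"
      proof (cases "\<phi> x = 0")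
        case False
        then have "x \<in> \<Omega>" using z by blast
        then have "x + h \<notin> \<Omega>" using R(2)[of x] R(2)[of "x + h"] nh norm_triangle_ineq4[of "x + h" x] R(1) by auto
        then show ?thesis using z by simp
      qed simp
    qed
    also have "\<dots> \<le> ennreal ((norm h)\<^sup>2) * ennreal ((norm_L2 \<Omega> (grad \<phi>))\<^sup>2)"
      unfolding nn_integral_grad_test[OF \<phi>, symmetric] by (rule translation_estimate[OF test_smooth[OF \<phi>]])
    also have "\<dots> = ennreal (((3 * R) * norm_L2 \<Omega> (grad \<phi>))\<^sup>2)"
      by (simp add: ennreal_mult'[symmetric] power_mult_distrib nh)
    finally show "(\<integral>\<^sup>+x. ennreal ((norm (\<phi> x))\<^sup>2) \<partial>\<mu>) \<le> ennreal (((3 * R) * norm_L2 \<Omega> (grad \<phi>))\<^sup>2)" .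
  qed (use R norm_L2_nonneg[of \<Omega> "grad \<phi>"] in simp)
  with R(1) show thesis by (intro that[of "3 * R"]) auto
qed

end

section \<open>Weak gradients and the Sobolev space H1\<close>

context bounded_open
begin

abbreviation W :: "(real^'n \<Rightarrow> real) \<Rightarrow> real^'n \<Rightarrow> real^'n" where
  "W u \<equiv> weak_grad \<Omega> u"

lemma L2_component:
  fixes g :: "real^'n \<Rightarrow> real^'n"
  assumes g: "g \<in> L2 \<Omega>" shows "(\<lambda>x. g x $ i) \<in> L2 \<Omega>"
proof (rule L2_dominated(1)[OF g, where C = 1])
  have "(\<lambda>x. g x \<bullet> axis i 1) \<in> borel_measurable \<mu>"
    using L2_measurable[OF g] by measurable
  then show "(\<lambda>x. g x $ i) \<in> borel_measurable \<mu>" by (simp add: inner_axis)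
qed (auto intro!: AE_I2 simp: component_le_norm_cart)

lemma L2_vec:
  fixes f :: "'n \<Rightarrow> real^'n \<Rightarrow> real"
  assumes f: "\<And>i. f i \<in> L2 \<Omega>"
  shows "(\<lambda>x. \<chi> i. f i x) \<in> L2 \<Omega>" and "norm_L2 \<Omega> (\<lambda>x. \<chi> i. f i x) \<le> (\<Sum>i\<in>UNIV. norm_L2 \<Omega> (f i))"
proof -
  have eq: "(\<lambda>x. \<chi> i. f i x) = (\<lambda>x. \<Sum>i\<in>UNIV. f i x *\<^sub>R axis i 1)"
  proof (rule ext)
    show "(\<chi> i. f i x) = (\<Sum>i\<in>UNIV. f i x *\<^sub>R axis i 1)" for x
      using basis_expansion[of "\<chi> i. f i x"] by (simp add: scalar_mult_eq_scaleR)
  qed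
  have t: "(\<lambda>x. f i x *\<^sub>R axis i (1::real)) \<in> L2 \<Omega>" "norm_L2 \<Omega> (\<lambda>x. f i x *\<^sub>R axis i (1::real)) \<le> norm_L2 \<Omega> (f i)" for i :: 'n
    using L2_dominated[OF f, of "\<lambda>x. f i x *\<^sub>R axis i (1::real)" 1 i] L2_measurable[OF f, of i] by auto
  have "(\<lambda>x. \<Sum>i\<in>I. f i x *\<^sub>R axis i (1::real)) \<in> L2 \<Omega> \<and>
     norm_L2 \<Omega> (\<lambda>x. \<Sum>i\<in>I. f i x *\<^sub>R axis i (1::real)) \<le> (\<Sum>i\<in>I. norm_L2 \<Omega> (f i))" if "finite I" for I :: "'n set"
    using that
  proof (induction I)
    case empty then show ?case using L2_zero[of \<Omega>] by (simp add: norm_L2_def)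
  next
    case (insert i I)
    then have "norm_L2 \<Omega> (\<lambda>x. f i x *\<^sub>R axis i (1::real) + (\<Sum>i\<in>I. f i x *\<^sub>R axis i (1::real)))
       \<le> norm_L2 \<Omega> (\<lambda>x. f i x *\<^sub>R axis i (1::real)) + norm_L2 \<Omega> (\<lambda>x. \<Sum>i\<in>I. f i x *\<^sub>R axis i (1::real))"
      by (intro norm_L2_triangle t) auto
    moreover have "(\<lambda>x. f i x *\<^sub>R axis i (1::real) + (\<Sum>i\<in>I. f i x *\<^sub>R axis i (1::real))) \<in> L2 \<Omega>"
      using insert by (intro L2_add t) auto
    ultimately show ?case using insert t(2)[of i] by simp
  qed
  from this[of UNIV] show "(\<lambda>x. \<chi> i. f i x) \<in> L2 \<Omega>"
    "norm_L2 \<Omega> (\<lambda>x. \<chi> i. f i x) \<le> (\<Sum>i\<in>UNIV. norm_L2 \<Omega> (f i))"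
    unfolding eq by auto
qed

lemma has_weak_gradD:
  assumes "has_weak_grad \<Omega> u g"
  shows "u \<in> L2 \<Omega>" "g \<in> L2 \<Omega>"
    "\<phi> \<in> test_functions \<Omega> \<Longrightarrow> (LINT x|\<mu>. u x * partial_deriv i \<phi> x) = - (LINT x|\<mu>. g x $ i * \<phi> x)"
  using assms by (auto simp: has_weak_grad_def)

lemma has_weak_grad_unique:
  assumes g: "has_weak_grad \<Omega> u g" and h: "has_weak_grad \<Omega> u h"
  shows "AE x in \<mu>. g x = h x"
proof -
  have "AE x in \<mu>. g x $ i - h x $ i = 0" for i
  proof (rule fundamental_lemma)
    show "(\<lambda>x. g x $ i - h x $ i) \<in> L2 \<Omega>"
      by (intro L2_diff L2_component has_weak_gradD[OF g] has_weak_gradD[OF h])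
    fix \<phi> assume \<phi>: "\<phi> \<in> test_functions \<Omega>"
    have i: "integrable \<mu> (\<lambda>x. g x $ i * \<phi> x)" "integrable \<mu> (\<lambda>x. h x $ i * \<phi> x)"
      using integrable_inner_L2[OF L2_component test_L2[OF \<phi>]] has_weak_gradD(2)[OF g] has_weak_gradD(2)[OF h]
      by auto
    show "(LINT x|\<mu>. (g x $ i - h x $ i) * \<phi> x) = 0"
      using i has_weak_gradD(3)[OF g \<phi>, of i] has_weak_gradD(3)[OF h \<phi>, of i]
      by (simp add: left_diff_distrib)
  qed
  then have "AE x in \<mu>. \<forall>i\<in>UNIV. g x $ i - h x $ i = 0"
    by (intro AE_finite_allI) auto
  then show ?thesis by eventually_elim (simp add: vec_eq_iff)
qed

lemma H1_weak_grad: "u \<in> H1 \<Omega> \<Longrightarrow> has_weak_grad \<Omega> u (W u)"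
  unfolding H1_def weak_grad_def mem_Collect_eq by (erule exE) (rule someI[of "has_weak_grad \<Omega> u"])

lemma H1_L2: "u \<in> H1 \<Omega> \<Longrightarrow> u \<in> L2 \<Omega>"
  and weak_grad_L2: "u \<in> H1 \<Omega> \<Longrightarrow> W u \<in> L2 \<Omega>"
  using has_weak_gradD[OF H1_weak_grad] by auto

lemma has_weak_grad_H1: "has_weak_grad \<Omega> u g \<Longrightarrow> u \<in> H1 \<Omega>"
  by (auto simp: H1_def)

lemma has_weak_grad_AE:
  assumes "has_weak_grad \<Omega> u g" shows "AE x in \<mu>. W u x = g x"
  by (rule has_weak_grad_unique[OF H1_weak_grad[OF has_weak_grad_H1[OF assms]] assms])

lemma ipL2_cong_AE:
  fixes f f' g g' :: "real^'n \<Rightarrow> 'b::euclidean_space"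
  assumes "f \<in> L2 \<Omega>" "f' \<in> L2 \<Omega>" "g \<in> L2 \<Omega>" "g' \<in> L2 \<Omega>"
    and "AE x in \<mu>. f x = f' x" "AE x in \<mu>. g x = g' x"
  shows "ipL2 \<Omega> f g = ipL2 \<Omega> f' g'"
  unfolding ipL2_def
proof (rule integral_cong_AE)
  show "AE x in \<mu>. f x \<bullet> g x = f' x \<bullet> g' x" using assms(5,6) by eventually_elim simp
qed (intro borel_measurable_integrable integrable_inner_L2 assms)+

lemma has_weak_grad_add:
  assumes u: "has_weak_grad \<Omega> u g" and v: "has_weak_grad \<Omega> v h"
  shows "has_weak_grad \<Omega> (\<lambda>x. u x + v x) (\<lambda>x. g x + h x)"
  unfolding has_weak_grad_def
proof (intro conjI ballI allI)
  note u' = has_weak_gradD[OF u] and v' = has_weak_gradD[OF v]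
  show "(\<lambda>x. u x + v x) \<in> L2 \<Omega>" "(\<lambda>x. g x + h x) \<in> L2 \<Omega>" by (intro L2_add u' v')+
  fix \<phi> i assume \<phi>: "\<phi> \<in> test_functions \<Omega>"
  have "integrable \<mu> (\<lambda>x. u x * partial_deriv i \<phi> x)" "integrable \<mu> (\<lambda>x. v x * partial_deriv i \<phi> x)"
    "integrable \<mu> (\<lambda>x. g x $ i * \<phi> x)" "integrable \<mu> (\<lambda>x. h x $ i * \<phi> x)"
    using integrable_inner_L2[OF u'(1) test_L2[OF test_partial[OF \<phi>]]] integrable_inner_L2[OF v'(1) test_L2[OF test_partial[OF \<phi>]]]
      integrable_inner_L2[OF L2_component[OF u'(2)] test_L2[OF \<phi>]] integrable_inner_L2[OF L2_component[OF v'(2)] test_L2[OF \<phi>]]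
    by auto
  then show "(LINT x|\<mu>. (u x + v x) * partial_deriv i \<phi> x) = - (LINT x|\<mu>. (g x + h x) $ i * \<phi> x)"
    using u'(3)[OF \<phi>] v'(3)[OF \<phi>] by (simp add: distrib_right)
qed

lemma has_weak_grad_scale:
  assumes u: "has_weak_grad \<Omega> u g"
  shows "has_weak_grad \<Omega> (\<lambda>x. c * u x) (\<lambda>x. c *\<^sub>R g x)"
  unfolding has_weak_grad_def
proof (intro conjI ballI allI)
  note u' = has_weak_gradD[OF u]
  show "(\<lambda>x. c * u x) \<in> L2 \<Omega>" using L2_scale[OF u'(1), of c] by simp
  show "(\<lambda>x. c *\<^sub>R g x) \<in> L2 \<Omega>" by (rule L2_scale[OF u'(2)])
  fix \<phi> i assume \<phi>: "\<phi> \<in> test_functions \<Omega>"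
  show "(LINT x|\<mu>. c * u x * partial_deriv i \<phi> x) = - (LINT x|\<mu>. (c *\<^sub>R g x) $ i * \<phi> x)"
    using u'(3)[OF \<phi>, of i] by (simp add: mult.assoc)
qed

text \<open>
The integral of \<open>\<phi> (x + h) - \<phi> x\<close> over the whole space is \<open>0\<close> by translation invariance. For
\<open>h = t *\<^sub>R axis i 1\<close> it differs from \<open>t\<close> times the integral of the partial derivative by \<open>o(t)\<close>.
\<close>

lemma integral_partial_test:
  assumes \<phi>: "\<phi> \<in> test_functions \<Omega>"
  shows "(LINT x|\<mu>. partial_deriv i \<phi> x) = 0"
proof -
  let ?D = "partial_deriv i \<phi>"
  have D: "?D \<in> test_functions \<Omega>" by (rule test_partial[OF \<phi>])
  have Di: "integrable lborel ?D" and \<phi>i: "integrable lborel \<phi>" by (rule test_integrable_lborel[OF D] test_integrable_lborel[OF \<phi>])+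
  have z: "?D x = 0" "\<phi> x = 0" if "x \<notin> \<Omega>" for x
    using test_functionsE[OF \<phi>] that by (metis subsetD)+
  have "(LINT x|\<mu>. ?D x) = (LINT x|lebesgue. indicator \<Omega> x *\<^sub>R ?D x)"
    by (rule integral_restrict_space[OF \<Omega>_sets(2)])
  also have "(\<lambda>x. indicator \<Omega> x *\<^sub>R ?D x) = ?D" using z by (auto simp: fun_eq_iff indicator_def)
  also have "(LINT x|lebesgue. ?D x) = (LINT x|lborel. ?D x)"
    by (rule integral_completion) (simp add: smooth_measurable[OF test_smooth[OF D]])
  finally have eq: "(LINT x|\<mu>. ?D x) = (LINT x|lborel. ?D x)" .
  obtain R where R: "R > 0" "\<And>x. x \<in> \<Omega> \<Longrightarrow> norm x \<le> R" using bounded_\<Omega> by (auto simp: bounded_pos)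
  let ?B = "ball (0::real^'n) (R + 1)"
  define m where "m = measure lborel ?B"
  have "\<bar>LINT x|lborel. ?D x\<bar> \<le> e * m" if e: "e > 0" for e
  proof -
    obtain d where d: "d > 0" "\<And>z h. norm h < d \<Longrightarrow> \<bar>\<phi> (z + h) - \<phi> z - grad \<phi> z \<bullet> h\<bar> \<le> e * norm h"
      using test_uniform_linearization[OF \<phi> e] by blast
    define t where "t = min (d/2) (1/2)"
    define h :: "real^'n" where "h = t *\<^sub>R axis i 1"
    have t: "t > 0" "t < d" "t < 1" using d(1) by (auto simp: t_def)
    have nh: "norm h = t" using t by (simp add: h_def)
    have gh: "grad \<phi> x \<bullet> h = t * ?D x" for x by (simp add: h_def grad_def inner_axis)
    have \<phi>h: "integrable lborel (\<lambda>x. \<phi> (x + h))"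
    proof -
      have "\<phi> \<in> borel_measurable borel" by (rule smooth_measurable[OF test_smooth[OF \<phi>]])
      then have "integrable (distr lborel borel ((+) h)) \<phi> \<longleftrightarrow> integrable lborel (\<lambda>x. \<phi> (h + x))"
        by (intro integrable_distr_eq) auto
      then show ?thesis using \<phi>i by (simp add: lborel_distr_plus add.commute)
    qed
    have i3: "integrable lborel (\<lambda>x. \<phi> (x + h) - \<phi> x - t * ?D x)" using \<phi>h \<phi>i Di by simp
    have "- (t * (LINT x|lborel. ?D x)) = (LINT x|lborel. \<phi> (x + h) - \<phi> x - t * ?D x)"
      using \<phi>h \<phi>i Di integral_translate[OF smooth_measurable[OF test_smooth[OF \<phi>]], of h] by simp
    also have "\<bar>\<dots>\<bar> \<le> (LINT x|lborel. (e * t) * indicator ?B x)"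
      unfolding real_norm_def[symmetric]
    proof (rule Bochner_Integration.integral_norm_bound_integral[OF i3])
      show "integrable lborel (\<lambda>x. (e * t) * indicator ?B x)"
        by (intro integrable_mult_right integrable_real_indicator) (use emeasure_bounded_finite[OF bounded_ball] in auto)
      fix x
      show "norm (\<phi> (x + h) - \<phi> x - t * ?D x) \<le> (e * t) * indicator ?B x"
      proof (cases "x \<in> ?B")
        case True then show ?thesis using d(2)[of h x] nh t gh by simp
      next
        case False
        then have nx: "norm x \<ge> R + 1" by (simp add: dist_norm)
        then have "x \<notin> \<Omega>" using R(2)[of x] by auto
        moreover have "x + h \<notin> \<Omega>" using nx nh t R(2)[of "x + h"] norm_triangle_ineq4[of "x + h" h] by auto
        ultimately show ?thesis using z False by simp
      qed
    qed
    also have "\<dots> = t * (e * m)" by (simp add: m_def)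
    finally have "t * \<bar>LINT x|lborel. ?D x\<bar> \<le> t * (e * m)" using t by (simp add: abs_mult)
    then show ?thesis using t by simp
  qed
  note bound = this
  have m: "m \<ge> 0" by (simp add: m_def)
  have "\<bar>LINT x|lborel. ?D x\<bar> \<le> 0 + e" if e: "e > 0" for e :: real
  proof -
    have "\<bar>LINT x|lborel. ?D x\<bar> \<le> e / (m + 1) * m" by (rule bound) (use e m in simp)
    also have "\<dots> \<le> e" using e m by (simp add: field_simps)
    finally show ?thesis by simp
  qed
  then show ?thesis using eq field_le_epsilon[of "\<bar>LINT x|lborel. ?D x\<bar>" 0] by simp
qed

text \<open>
Integration by parts, since the product of two test functions is a test function.
\<close>

lemma test_has_weak_grad:
  assumes \<phi>: "\<phi> \<in> test_functions \<Omega>"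
  shows "has_weak_grad \<Omega> \<phi> (grad \<phi>)"
  unfolding has_weak_grad_def
proof (intro conjI ballI allI test_L2[OF \<phi>] test_grad_L2[OF \<phi>])
  fix \<psi> i assume \<psi>: "\<psi> \<in> test_functions \<Omega>"
  have d: "\<phi> differentiable (at x)" "\<psi> differentiable (at x)" for x
    using smooth_differentiable test_smooth \<phi> \<psi> by blast+
  have i: "integrable \<mu> (\<lambda>x. \<phi> x * partial_deriv i \<psi> x)" "integrable \<mu> (\<lambda>x. partial_deriv i \<phi> x * \<psi> x)"
    using integrable_inner_L2[OF test_L2[OF \<phi>] test_L2[OF test_partial[OF \<psi>]]]
      integrable_inner_L2[OF test_L2[OF test_partial[OF \<phi>]] test_L2[OF \<psi>]] by auto
  have "0 = (LINT x|\<mu>. partial_deriv i (\<lambda>x. \<phi> x * \<psi> x) x)"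
    by (rule integral_partial_test[OF test_mult_smooth[OF \<phi> test_smooth[OF \<psi>]], symmetric])
  also have "\<dots> = (LINT x|\<mu>. partial_deriv i \<phi> x * \<psi> x + \<phi> x * partial_deriv i \<psi> x)"
    by (simp add: partial_deriv_mult d)
  also have "\<dots> = (LINT x|\<mu>. partial_deriv i \<phi> x * \<psi> x) + (LINT x|\<mu>. \<phi> x * partial_deriv i \<psi> x)"
    using i by simp
  finally show "(LINT x|\<mu>. \<phi> x * partial_deriv i \<psi> x) = - (LINT x|\<mu>. grad \<phi> x $ i * \<psi> x)"
    by (simp add: grad_nth)
qed

lemma test_H1: "\<phi> \<in> test_functions \<Omega> \<Longrightarrow> \<phi> \<in> H1 \<Omega>"
  by (rule has_weak_grad_H1[OF test_has_weak_grad])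

lemma norm_H1_eq:
  assumes "has_weak_grad \<Omega> u g"
  shows "norm_H1 \<Omega> u = sqrt ((norm_L2 \<Omega> u)\<^sup>2 + (norm_L2 \<Omega> g)\<^sup>2)"
proof -
  have "norm_L2 \<Omega> (W u) = norm_L2 \<Omega> g"
    by (rule L2_AE_cong(2)[OF has_weak_gradD(2)[OF assms] L2_measurable[OF weak_grad_L2[OF has_weak_grad_H1[OF assms]]]
       has_weak_grad_AE[OF assms]])
  then show ?thesis by (simp add: norm_H1_def)
qed

lemma norm_L2_le_norm_H1: "norm_L2 \<Omega> u \<le> norm_H1 \<Omega> u" "norm_L2 \<Omega> (W u) \<le> norm_H1 \<Omega> u"
  unfolding norm_H1_def by (auto intro!: real_le_rsqrt)

lemma norm_H1_le_sum: "has_weak_grad \<Omega> u g \<Longrightarrow> norm_H1 \<Omega> u \<le> norm_L2 \<Omega> u + norm_L2 \<Omega> g"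
  unfolding norm_H1_eq by (rule sqrt_sum_squares_le_sum[OF norm_L2_nonneg norm_L2_nonneg])

lemma weak_grad_add:
  assumes "u \<in> H1 \<Omega>" "v \<in> H1 \<Omega>" shows "AE x in \<mu>. W (u + v) x = W u x + W v x"
  using has_weak_grad_AE[OF has_weak_grad_add[OF H1_weak_grad H1_weak_grad, OF assms]]
  by (simp add: plus_fun_def)

lemma weak_grad_scale:
  assumes "u \<in> H1 \<Omega>" shows "AE x in \<mu>. W (c *\<^sub>R u) x = c *\<^sub>R W u x"
  using has_weak_grad_AE[OF has_weak_grad_scale[OF H1_weak_grad, OF assms]]
  by (simp add: scaleR_fun_def)

lemma H1_add: "u \<in> H1 \<Omega> \<Longrightarrow> v \<in> H1 \<Omega> \<Longrightarrow> u + v \<in> H1 \<Omega>"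
  using has_weak_grad_H1[OF has_weak_grad_add[OF H1_weak_grad H1_weak_grad]] by (simp add: plus_fun_def)

lemma H1_scale: "u \<in> H1 \<Omega> \<Longrightarrow> c *\<^sub>R u \<in> H1 \<Omega>"
  using has_weak_grad_H1[OF has_weak_grad_scale[OF H1_weak_grad]] by (simp add: scaleR_fun_def)

lemma subspace_H1: "subspace (H1 \<Omega>)"
  unfolding subspace_def using H1_add H1_scale test_H1[OF test_zero] by (auto simp: zero_fun_def)

definition ipH1 :: "(real^'n \<Rightarrow> real) \<Rightarrow> (real^'n \<Rightarrow> real) \<Rightarrow> real" where
  "ipH1 u v = ipL2 \<Omega> u v + ipL2 \<Omega> (W u) (W v)"

lemma ipL2_weak_grad_add:
  assumes "u \<in> H1 \<Omega>" "v \<in> H1 \<Omega>" "g \<in> L2 \<Omega>"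
  shows "ipL2 \<Omega> (W (u + v)) g = ipL2 \<Omega> (W u) g + ipL2 \<Omega> (W v) g"
proof -
  have "ipL2 \<Omega> (W (u + v)) g = ipL2 \<Omega> (W u + W v) g"
    using weak_grad_add[OF assms(1,2)] assms
    by (intro ipL2_cong_AE weak_grad_L2 H1_add L2.V_add) auto
  then show ?thesis using assms by (simp add: L2.ip_add_left weak_grad_L2)
qed

lemma ipL2_weak_grad_scale:
  assumes "u \<in> H1 \<Omega>" "g \<in> L2 \<Omega>"
  shows "ipL2 \<Omega> (W (c *\<^sub>R u)) g = c * ipL2 \<Omega> (W u) g"
proof -
  have "ipL2 \<Omega> (W (c *\<^sub>R u)) g = ipL2 \<Omega> (c *\<^sub>R W u) g"
    using weak_grad_scale[OF assms(1), of c] assms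
    by (intro ipL2_cong_AE weak_grad_L2 H1_scale L2.V_scale) (auto simp: scaleR_fun_def)
  then show ?thesis using assms by (simp add: L2.ip_scale_left weak_grad_L2)
qed

lemma ipH1_semi_inner: "semi_inner_space (H1 \<Omega>) ipH1"
proof
  fix x y z :: "real^'n \<Rightarrow> real" and c
  assume x: "x \<in> H1 \<Omega>"
  show "0 \<le> ipH1 x x"
    unfolding ipH1_def by (intro add_nonneg_nonneg L2.ip_self_nonneg H1_L2 weak_grad_L2 x)
  assume y: "y \<in> H1 \<Omega>"
  show "ipH1 x y = ipH1 y x"
    using x y by (simp add: ipH1_def L2.ip_commute[of x _ y] L2.ip_commute[of "W x" _ "W y"] H1_L2 weak_grad_L2)
  show "ipH1 (c *\<^sub>R x) y = c * ipH1 x y"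
    using x y by (simp add: ipH1_def L2.ip_scale_left ipL2_weak_grad_scale H1_L2 weak_grad_L2 distrib_left)
  assume z: "z \<in> H1 \<Omega>"
  show "ipH1 (x + y) z = ipH1 x z + ipH1 y z"
    using x y z by (simp add: ipH1_def L2.ip_add_left ipL2_weak_grad_add H1_L2 weak_grad_L2)
qed (rule subspace_H1)

lemma nrm_ipH1: "semi_inner_space.nrm ipH1 = norm_H1 \<Omega>"
proof (rule ext)
  fix u
  have "ipL2 \<Omega> u u = (norm_L2 \<Omega> u)\<^sup>2" "ipL2 \<Omega> (W u) (W u) = (norm_L2 \<Omega> (W u))\<^sup>2"
    by (simp_all add: ipL2_def norm_L2_def power2_norm_eq_inner power2_eq_square[of "u _"] integral_nonneg_AE)
  then show "semi_inner_space.nrm ipH1 u = norm_H1 \<Omega> u"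
    by (simp add: semi_inner_space.nrm_def[OF ipH1_semi_inner] norm_H1_def ipH1_def)
qed

lemma weak_grad_diff:
  assumes "u \<in> H1 \<Omega>" "v \<in> H1 \<Omega>" shows "AE x in \<mu>. W (u - v) x = W u x - W v x"
proof -
  have "u - v = u + (-1) *\<^sub>R v" by simp
  then have "AE x in \<mu>. W (u - v) x = W u x + W ((-1) *\<^sub>R v) x"
    using weak_grad_add[OF assms(1) H1_scale[OF assms(2)], of "-1"] by simp
  with weak_grad_scale[OF assms(2), of "-1"] show ?thesis by eventually_elim simp
qed

lemma norm_L2_weak_grad_diff:
  assumes "u \<in> H1 \<Omega>" "v \<in> H1 \<Omega>"
  shows "norm_L2 \<Omega> (W u - W v) = norm_L2 \<Omega> (W (u - v))"
  by (rule L2_AE_cong(2))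
     (use assms weak_grad_diff[OF assms] in \<open>auto intro!: weak_grad_L2 L2.V_diff subspace_diff[OF subspace_H1] L2_measurable elim!: eventually_mono\<close>)

text \<open>
Functions and gradients converge in mean square separately, and the identity defining the weak gradient
passes to the limit.
\<close>

lemma H1_complete:
  assumes X: "\<And>n. X n \<in> H1 \<Omega>"
    and Cau: "\<And>e. e > 0 \<Longrightarrow> \<exists>N. \<forall>m\<ge>N. \<forall>n\<ge>N. norm_H1 \<Omega> (X m - X n) < e"
  shows "\<exists>u\<in>H1 \<Omega>. (\<lambda>n. norm_H1 \<Omega> (X n - u)) \<longlonglongrightarrow> 0"
proof -
  have "\<exists>u\<in>L2 \<Omega>. (\<lambda>n. norm_L2 \<Omega> (X n - u)) \<longlonglongrightarrow> 0"
  proof (rule L2.complete_V)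
    show "X n \<in> L2 \<Omega>" for n by (rule H1_L2[OF X])
    show "\<exists>N. \<forall>m\<ge>N. \<forall>n\<ge>N. norm_L2 \<Omega> (X m - X n) < e" if "e > 0" for e
      using Cau[OF that] norm_L2_le_norm_H1(1) by (meson le_less_trans)
  qed
  then obtain u where u: "u \<in> L2 \<Omega>" "(\<lambda>n. norm_L2 \<Omega> (X n - u)) \<longlonglongrightarrow> 0" by blast
  have "\<exists>g\<in>L2 \<Omega>. (\<lambda>n. norm_L2 \<Omega> (W (X n) - g)) \<longlonglongrightarrow> 0"
  proof (rule L2.complete_V)
    show "W (X n) \<in> L2 \<Omega>" for n by (rule weak_grad_L2[OF X])
    show "\<exists>N. \<forall>m\<ge>N. \<forall>n\<ge>N. norm_L2 \<Omega> (W (X m) - W (X n)) < e" if "e > 0" for e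
      unfolding norm_L2_weak_grad_diff[OF X X]
      using Cau[OF that] norm_L2_le_norm_H1(2) by (meson le_less_trans)
  qed
  then obtain g where g: "g \<in> L2 \<Omega>" "(\<lambda>n. norm_L2 \<Omega> (W (X n) - g)) \<longlonglongrightarrow> 0" by blast
  have lim: "(\<lambda>n. ipL2 \<Omega> (Y n) h) \<longlonglongrightarrow> ipL2 \<Omega> y h"
    if Y: "\<And>n. Y n \<in> L2 \<Omega>" and y: "y \<in> L2 \<Omega>" and h: "h \<in> L2 \<Omega>" and l: "(\<lambda>n. norm_L2 \<Omega> (Y n - y)) \<longlonglongrightarrow> 0"
    for Y and y h :: "real^'n \<Rightarrow> 'b::euclidean_space"
  proof -
    have "(\<lambda>n. ipL2 \<Omega> (Y n) h - ipL2 \<Omega> y h) \<longlonglongrightarrow> 0"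
    proof (rule Lim_null_comparison)
      show "\<forall>\<^sub>F n in sequentially. norm (ipL2 \<Omega> (Y n) h - ipL2 \<Omega> y h) \<le> norm_L2 \<Omega> (Y n - y) * norm_L2 \<Omega> h"
        using L2.ip_Cauchy_Schwarz[OF L2.V_diff[OF Y y] h] by (intro always_eventually) (simp add: L2.ip_diff_left Y y h)
      show "(\<lambda>n. norm_L2 \<Omega> (Y n - y) * norm_L2 \<Omega> h) \<longlonglongrightarrow> 0" using tendsto_mult_right[OF l] by simp
    qed
    then show ?thesis by (simp add: LIM_zero_iff)
  qed
  have ug: "has_weak_grad \<Omega> u g"
    unfolding has_weak_grad_def
  proof (intro conjI ballI allI u(1) g(1))
    fix \<phi> i assume \<phi>: "\<phi> \<in> test_functions \<Omega>"
    define \<Phi> :: "real^'n \<Rightarrow> real^'n" where "\<Phi> x = \<phi> x *\<^sub>R axis i 1" for x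
    have \<Phi>: "\<Phi> \<in> L2 \<Omega>" unfolding \<Phi>_def[abs_def]
      by (rule L2_dominated(1)[OF test_L2[OF \<phi>], where C = 1]) (use test_measurable[OF \<phi>] in auto)
    have ip\<Phi>: "ipL2 \<Omega> h \<Phi> = (LINT x|\<mu>. h x $ i * \<phi> x)" for h :: "real^'n \<Rightarrow> real^'n"
      unfolding ipL2_def \<Phi>_def by (simp add: inner_axis mult.commute)
    have "ipL2 \<Omega> (X n) (partial_deriv i \<phi>) = - ipL2 \<Omega> (W (X n)) \<Phi>" for n
      unfolding ip\<Phi> using has_weak_gradD(3)[OF H1_weak_grad[OF X] \<phi>, of n i] by (simp add: ipL2_def)
    then have "(\<lambda>n. - ipL2 \<Omega> (W (X n)) \<Phi>) \<longlonglongrightarrow> ipL2 \<Omega> u (partial_deriv i \<phi>)"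
      using lim[OF H1_L2[OF X] u(1) test_L2[OF test_partial[OF \<phi>]] u(2), of i] by simp
    moreover have "(\<lambda>n. - ipL2 \<Omega> (W (X n)) \<Phi>) \<longlonglongrightarrow> - ipL2 \<Omega> g \<Phi>"
      by (intro tendsto_minus lim weak_grad_L2 X g \<Phi>)
    ultimately have "ipL2 \<Omega> u (partial_deriv i \<phi>) = - ipL2 \<Omega> g \<Phi>" by (rule LIMSEQ_unique)
    then show "(LINT x|\<mu>. u x * partial_deriv i \<phi> x) = - (LINT x|\<mu>. g x $ i * \<phi> x)"
      unfolding ip\<Phi> by (simp add: ipL2_def)
  qed
  have uH: "u \<in> H1 \<Omega>" by (rule has_weak_grad_H1[OF ug])
  have gW: "norm_L2 \<Omega> (W (X n) - g) = norm_L2 \<Omega> (W (X n - u))" for n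
  proof (rule L2_AE_cong(2))
    show "W (X n - u) \<in> L2 \<Omega>" by (intro weak_grad_L2 subspace_diff[OF subspace_H1] X uH)
    show "W (X n) - g \<in> borel_measurable \<mu>" by (intro L2_measurable L2.V_diff weak_grad_L2 X g)
    show "AE x in \<mu>. (W (X n) - g) x = W (X n - u) x"
      using weak_grad_diff[OF X uH, of n] has_weak_grad_AE[OF ug] by eventually_elim simp
  qed
  have "(\<lambda>n. sqrt ((norm_L2 \<Omega> (X n - u))\<^sup>2 + (norm_L2 \<Omega> (W (X n) - g))\<^sup>2)) \<longlonglongrightarrow> sqrt (0\<^sup>2 + 0\<^sup>2)"
    by (intro tendsto_intros u(2) g(2))
  then have "(\<lambda>n. norm_H1 \<Omega> (X n - u)) \<longlonglongrightarrow> 0"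
    by (simp add: norm_H1_def gW)
  with uH show ?thesis by blast
qed

end

sublocale bounded_open \<subseteq> H1: semi_hilbert_space "H1 \<Omega>" ipH1
  rewrites "semi_inner_space.nrm ipH1 = norm_H1 \<Omega>"
proof -
  show "semi_hilbert_space (H1 \<Omega>) ipH1"
    unfolding semi_hilbert_space_def semi_hilbert_space_axioms_def nrm_ipH1
    by (intro conjI allI impI ipH1_semi_inner) (simp add: H1_complete)
qed (rule nrm_ipH1)

context bounded_open
begin

section \<open>Zero boundary values\<close>

lemma H10_eq_cl: "H10 \<Omega> = H1.cl (test_functions \<Omega>)"
  by (simp add: H10_def H1.cl_def fun_diff_def)

lemma test_subset_H1: "test_functions \<Omega> \<subseteq> H1 \<Omega>" using test_H1 by blast

lemma subspace_H10: "subspace (H10 \<Omega>)"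
  unfolding H10_eq_cl by (rule H1.subspace_cl[OF test_subset_H1 subspace_test])

lemma test_H10: "\<phi> \<in> test_functions \<Omega> \<Longrightarrow> \<phi> \<in> H10 \<Omega>"
  unfolding H10_eq_cl using H1.cl_subset[OF test_subset_H1] by blast

lemma H10_H1: "u \<in> H10 \<Omega> \<Longrightarrow> u \<in> H1 \<Omega>" by (simp add: H10_def)

lemma H10_approx:
  assumes "u \<in> H10 \<Omega>" "e > 0"
  obtains \<phi> where "\<phi> \<in> test_functions \<Omega>" "norm_H1 \<Omega> (u - \<phi>) < e"
  using assms by (auto simp: H10_def fun_diff_def)

lemma Poincare:
  obtains C where "C > 0" "\<And>u. u \<in> H10 \<Omega> \<Longrightarrow> norm_H1 \<Omega> u \<le> C * norm_L2 \<Omega> (W u)"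
proof -
  obtain C where C: "C > 0" "\<And>\<phi>. \<phi> \<in> test_functions \<Omega> \<Longrightarrow> norm_L2 \<Omega> \<phi> \<le> C * norm_L2 \<Omega> (grad \<phi>)"
    by (rule Poincare_test) blast
  have t: "norm_H1 \<Omega> \<phi> \<le> (C + 1) * norm_L2 \<Omega> (W \<phi>)" if \<phi>: "\<phi> \<in> test_functions \<Omega>" for \<phi>
  proof -
    have "norm_L2 \<Omega> (W \<phi>) = norm_L2 \<Omega> (grad \<phi>)"
      by (rule L2_AE_cong(2)[OF test_grad_L2[OF \<phi>] L2_measurable[OF weak_grad_L2[OF test_H1[OF \<phi>]]]
         has_weak_grad_AE[OF test_has_weak_grad[OF \<phi>]]])
    then show ?thesis
      using norm_H1_le_sum[OF test_has_weak_grad[OF \<phi>]] C(2)[OF \<phi>] by (simp add: algebra_simps)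
  qed
  have "norm_H1 \<Omega> u \<le> (C + 1) * norm_L2 \<Omega> (W u)" if u: "u \<in> H10 \<Omega>" for u
  proof (rule field_le_epsilon)
    fix e :: real assume e: "e > 0"
    then have "e / (C + 2) > 0" using C by simp
    then obtain \<phi> where \<phi>: "\<phi> \<in> test_functions \<Omega>" "norm_H1 \<Omega> (u - \<phi>) < e / (C + 2)"
      by (rule H10_approx[OF u])
    have uH: "u \<in> H1 \<Omega>" and \<phi>H: "\<phi> \<in> H1 \<Omega>" by (rule H10_H1[OF u] test_H1[OF \<phi>(1)])+
    have "norm_L2 \<Omega> (W \<phi>) \<le> norm_L2 \<Omega> (W \<phi> - W u) + norm_L2 \<Omega> (W u)"
      by (rule L2.nrm_triangle_sub) (intro weak_grad_L2 uH \<phi>H)+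
    also have "norm_L2 \<Omega> (W \<phi> - W u) \<le> norm_H1 \<Omega> (\<phi> - u)"
      unfolding norm_L2_weak_grad_diff[OF \<phi>H uH] by (rule norm_L2_le_norm_H1)
    also have "norm_H1 \<Omega> (\<phi> - u) = norm_H1 \<Omega> (u - \<phi>)" by (rule H1.nrm_minus_commute[OF \<phi>H uH])
    finally have "(C + 1) * norm_L2 \<Omega> (W \<phi>) \<le> (C + 1) * (norm_H1 \<Omega> (u - \<phi>) + norm_L2 \<Omega> (W u))"
      using C by (intro mult_left_mono) auto
    moreover have "norm_H1 \<Omega> u \<le> norm_H1 \<Omega> (u - \<phi>) + norm_H1 \<Omega> \<phi>" by (rule H1.nrm_triangle_sub[OF uH \<phi>H])
    moreover have "(C + 2) * norm_H1 \<Omega> (u - \<phi>) \<le> e" using \<phi>(2) C by (simp add: field_simps)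
    ultimately show "norm_H1 \<Omega> u \<le> (C + 1) * norm_L2 \<Omega> (W u) + e"
      using t[OF \<phi>(1)] by (simp add: algebra_simps)
  qed
  then show thesis using C(1) by (intro that[of "C + 1"]) auto
qed

end

section \<open>Localization, compactness and cutoffs\<close>

lemma test_bounded_grad:
  assumes "\<phi> \<in> test_functions U"
  obtains B where "B > 0" "\<And>x. norm (grad \<phi> x) \<le> B"
proof -
  have "\<forall>i. \<exists>B. \<forall>x. \<bar>partial_deriv i \<phi> x\<bar> \<le> B"
    using test_bounded[OF test_partial[OF assms]] by metis
  then obtain b where b: "\<And>i x. \<bar>partial_deriv i \<phi> x\<bar> \<le> b i" by metis
  have "norm (grad \<phi> x) \<le> (\<Sum>i\<in>UNIV. b i) + 1" for x
    using norm_le_l1_cart[of "grad \<phi> x"] sum_mono[of UNIV "\<lambda>i. \<bar>grad \<phi> x $ i\<bar>" b] b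
    by (simp add: grad_nth)
  moreover have "(\<Sum>i\<in>UNIV. b i) + 1 > 0"
    by (intro add_nonneg_pos sum_nonneg order_trans[OF abs_ge_zero b]) simp
  ultimately show thesis by (rule that[rotated])
qed

lemma grad_bound_if_Lipschitz:
  fixes f :: "real^'n \<Rightarrow> real"
  assumes d: "(f has_derivative (\<lambda>h. g \<bullet> h)) (at x)" and L: "\<And>y. \<bar>f y - f x\<bar> \<le> L * norm (y - x)"
  shows "norm g \<le> L"
proof (cases "g = 0")
  case True
  have "0 \<le> L * norm (axis undefined 1 :: real^'n)" using L[of "x + axis undefined 1"] by simp
  then show ?thesis using True by simp
next
  case False
  show ?thesis
  proof (rule field_le_epsilon)
    fix e :: real assume "e > 0"
    then obtain r where r: "r > 0" "\<And>y. norm (y - x) < r \<Longrightarrow> norm (f y - f x - g \<bullet> (y - x)) \<le> e * norm (y - x)"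
      using d unfolding has_derivative_at_alt by blast
    define t where "t = r / (2 * norm g)"
    have t: "t > 0" "t * norm g < r" using False r(1) by (auto simp: t_def)
    let ?y = "x + t *\<^sub>R g"
    have n: "norm (?y - x) = t * norm g" using t by simp
    have "g \<bullet> (?y - x) \<le> L * norm (?y - x) + e * norm (?y - x)"
    proof -
      have "norm (?y - x) < r" unfolding n by (rule t(2))
      from r(2)[OF this] L[of ?y] show ?thesis unfolding real_norm_def by linarith
    qed
    moreover have "g \<bullet> (?y - x) = (t * norm g) * norm g" by (simp add: power2_norm_eq_inner[symmetric] power2_eq_square)
    ultimately have "(t * norm g) * norm g \<le> L * (t * norm g) + e * (t * norm g)" unfolding n by linarith
    also have "\<dots> = (t * norm g) * (L + e)" by (simp add: algebra_simps)
    finally have "(t * norm g) * norm g \<le> (t * norm g) * (L + e)" .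
    then show "norm g \<le> L + e" using t(1) False by (simp add: mult_le_cancel_left_pos)
  qed
qed

context bounded_open
begin

lemma test_scaleR_L2:
  fixes g :: "real^'n \<Rightarrow> 'b::euclidean_space"
  assumes \<theta>: "\<theta> \<in> test_functions \<Omega>" and g: "g \<in> L2 \<Omega>"
  shows "(\<lambda>x. \<theta> x *\<^sub>R g x) \<in> L2 \<Omega>"
proof -
  obtain B where B: "B > 0" "\<And>x. \<bar>\<theta> x\<bar> \<le> B" using test_bounded[OF \<theta>] by metis
  show ?thesis
  proof (rule L2_dominated(1)[OF g, where C = B])
    show "(\<lambda>x. \<theta> x *\<^sub>R g x) \<in> borel_measurable \<mu>"
      by (intro borel_measurable_scaleR test_measurable \<theta> L2_measurable g)
    show "AE x in \<mu>. norm (\<theta> x *\<^sub>R g x) \<le> B * norm (g x)"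
      using B by (intro AE_I2) (simp add: mult_right_mono)
  qed (use B in auto)
qed

lemma scaleR_grad_test_L2:
  assumes \<theta>: "\<theta> \<in> test_functions \<Omega>" and u: "u \<in> L2 \<Omega>"
  shows "(\<lambda>x. u x *\<^sub>R grad \<theta> x) \<in> L2 \<Omega>"
proof -
  obtain B where B: "B > 0" "\<And>x. norm (grad \<theta> x) \<le> B" using test_bounded_grad[OF \<theta>] by metis
  show ?thesis
  proof (rule L2_dominated(1)[OF u, where C = B])
    show "(\<lambda>x. u x *\<^sub>R grad \<theta> x) \<in> borel_measurable \<mu>"
      by (intro borel_measurable_scaleR L2_measurable u test_grad_L2 \<theta>)
    show "AE x in \<mu>. norm (u x *\<^sub>R grad \<theta> x) \<le> B * norm (u x)"
      using B by (intro AE_I2) (simp add: mult.commute[of B] mult_left_mono)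
  qed (use B in auto)
qed

text \<open>
As \<open>\<theta>\<close> has compact support in \<open>\<Omega>\<close>, the product \<open>\<theta> \<psi>\<close> is a test function for every smooth \<open>\<psi>\<close>. In \<open>cutoff_H10\<close>
the role of \<open>\<psi>\<close> is played by a shifted mollifier, whose support may leave \<open>\<Omega>\<close>.
\<close>

lemma cutoff_weak_grad_smooth:
  assumes u: "u \<in> H1 \<Omega>" and \<theta>: "\<theta> \<in> test_functions \<Omega>" and \<psi>: "smooth \<psi>"
  shows "(LINT x|\<mu>. (\<theta> x * u x) * partial_deriv i \<psi> x)
    = - (LINT x|\<mu>. (\<theta> x * W u x $ i + u x * partial_deriv i \<theta> x) * \<psi> x)"
proof -
  note uL = H1_L2[OF u] and gL = L2_component[OF weak_grad_L2[OF u], of i]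
  have t: "(\<lambda>x. \<theta> x * \<psi> x) \<in> test_functions \<Omega>" by (rule test_mult_smooth[OF \<theta> \<psi>])
  have t1: "(\<lambda>x. \<theta> x * partial_deriv i \<psi> x) \<in> test_functions \<Omega>"
    by (rule test_mult_smooth[OF \<theta> smooth_partial[OF \<psi>]])
  have t2: "(\<lambda>x. partial_deriv i \<theta> x * \<psi> x) \<in> test_functions \<Omega>"
    by (rule test_mult_smooth[OF test_partial[OF \<theta>] \<psi>])
  have i1: "integrable \<mu> (\<lambda>x. u x * (\<theta> x * partial_deriv i \<psi> x))"
    using integrable_inner_L2[OF uL test_L2[OF t1]] by simp
  have i2: "integrable \<mu> (\<lambda>x. u x * (partial_deriv i \<theta> x * \<psi> x))"
    using integrable_inner_L2[OF uL test_L2[OF t2]] by simp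
  have i3: "integrable \<mu> (\<lambda>x. W u x $ i * (\<theta> x * \<psi> x))"
    using integrable_inner_L2[OF gL test_L2[OF t]] by simp
  have d: "\<theta> differentiable (at x)" "\<psi> differentiable (at x)" for x
    using smooth_differentiable test_smooth \<theta> \<psi> by blast+
  have "(LINT x|\<mu>. u x * (partial_deriv i \<theta> x * \<psi> x)) + (LINT x|\<mu>. u x * (\<theta> x * partial_deriv i \<psi> x))
     = (LINT x|\<mu>. u x * partial_deriv i (\<lambda>x. \<theta> x * \<psi> x) x)"
    using i1 i2 by (simp add: partial_deriv_mult d distrib_left)
  also have "\<dots> = - (LINT x|\<mu>. W u x $ i * (\<theta> x * \<psi> x))"
    by (rule has_weak_gradD(3)[OF H1_weak_grad[OF u] t])
  finally have "(LINT x|\<mu>. u x * (\<theta> x * partial_deriv i \<psi> x))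
     = - ((LINT x|\<mu>. W u x $ i * (\<theta> x * \<psi> x)) + (LINT x|\<mu>. u x * (partial_deriv i \<theta> x * \<psi> x)))" by simp
  also have "\<dots> = - (LINT x|\<mu>. W u x $ i * (\<theta> x * \<psi> x) + u x * (partial_deriv i \<theta> x * \<psi> x))"
    using i2 i3 by simp
  finally show ?thesis by (simp add: algebra_simps)
qed

lemma cutoff_has_weak_grad:
  assumes u: "u \<in> H1 \<Omega>" and \<theta>: "\<theta> \<in> test_functions \<Omega>"
  shows "has_weak_grad \<Omega> (\<lambda>x. \<theta> x * u x) (\<lambda>x. \<theta> x *\<^sub>R W u x + u x *\<^sub>R grad \<theta> x)"
  unfolding has_weak_grad_def
proof (intro conjI ballI allI)
  show "(\<lambda>x. \<theta> x * u x) \<in> L2 \<Omega>" using test_scaleR_L2[OF \<theta> H1_L2[OF u]] by simp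
  show "(\<lambda>x. \<theta> x *\<^sub>R W u x + u x *\<^sub>R grad \<theta> x) \<in> L2 \<Omega>"
    by (intro L2_add test_scaleR_L2 \<theta> weak_grad_L2 u scaleR_grad_test_L2 H1_L2)
  fix \<psi> i assume "\<psi> \<in> test_functions \<Omega>"
  from cutoff_weak_grad_smooth[OF u \<theta> test_smooth[OF this], of i]
  show "(LINT x|\<mu>. \<theta> x * u x * partial_deriv i \<psi> x) = - (LINT x|\<mu>. (\<theta> x *\<^sub>R W u x + u x *\<^sub>R grad \<theta> x) $ i * \<psi> x)"
    by (simp add: grad_nth)
qed

text \<open>
By \<open>cutoff_weak_grad_smooth\<close> the gradient of the mollified product is the mollified gradient, so both
converge in mean square, and for small \<open>\<epsilon>\<close> the mollified product is a test function. This local form of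
the Meyers--Serrin theorem is what makes the argument independent of the regularity of the boundary.
\<close>

theorem cutoff_H10:
  assumes u: "u \<in> H1 \<Omega>" and \<theta>: "\<theta> \<in> test_functions \<Omega>"
  shows "(\<lambda>x. \<theta> x * u x) \<in> H10 \<Omega>"
proof -
  let ?f = "\<lambda>x. \<theta> x * u x"
  define g where "g i x = \<theta> x * W u x $ i + u x * partial_deriv i \<theta> x" for i x
  let ?G = "\<lambda>x. \<theta> x *\<^sub>R W u x + u x *\<^sub>R grad \<theta> x"
  have wg: "has_weak_grad \<Omega> ?f ?G" by (rule cutoff_has_weak_grad[OF u \<theta>])
  have Gg: "?G x $ i = g i x" for x i by (simp add: g_def grad_nth)
  have fL: "?f \<in> L2 \<Omega>" and GL: "?G \<in> L2 \<Omega>" using has_weak_gradD[OF wg] by auto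
  have gL: "g i \<in> L2 \<Omega>" for i using L2_component[OF GL, of i] unfolding Gg by simp
  obtain S where S: "compact S" "S \<subseteq> \<Omega>" "\<And>x. x \<notin> S \<Longrightarrow> \<theta> x = 0" using test_functionsE[OF \<theta>] by metis
  obtain \<epsilon>0 where \<epsilon>0: "\<epsilon>0 > 0"
    "\<And>\<epsilon> (\<eta> :: real^'n \<Rightarrow> real) f. \<epsilon> \<le> \<epsilon>0 \<Longrightarrow> mollifier \<epsilon> \<eta> \<Longrightarrow> integrable \<mu> f \<Longrightarrow> (\<And>y. y \<notin> S \<Longrightarrow> f y = 0) \<Longrightarrow> moll \<eta> f \<in> test_functions \<Omega>"
    using moll_test[OF S(1,2)] by metis
  show ?thesis
    unfolding H10_def
  proof (intro CollectI conjI allI impI has_weak_grad_H1[OF wg])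
    fix e :: real assume e: "e > 0"
    define c where "c = real CARD('n)"
    have c: "c > 0" by (simp add: c_def)
    have "e/2 > 0" "e / (2 * c) > 0" using e c by auto
    define near where "near h e \<epsilon> \<longleftrightarrow> (\<forall>\<epsilon>' (\<eta> :: real^'n \<Rightarrow> real). 0 < \<epsilon>' \<longrightarrow> \<epsilon>' \<le> \<epsilon> \<longrightarrow>
      mollifier \<epsilon>' \<eta> \<longrightarrow> norm_L2 \<Omega> (\<lambda>x. moll \<eta> h x - h x) < e)" for h and e \<epsilon> :: real
    have near: "\<exists>\<epsilon>>0. near h e \<epsilon>" if "h \<in> L2 \<Omega>" "e > 0" for h e
      unfolding near_def by (rule moll_converges[OF that])
    obtain \<epsilon>1 where \<epsilon>1: "\<epsilon>1 > 0" "near ?f (e/2) \<epsilon>1"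
      using near[OF fL \<open>e/2 > 0\<close>] by blast
    obtain \<epsilon>2 where \<epsilon>2: "\<And>i. \<epsilon>2 i > 0" "\<And>i. near (g i) (e / (2 * c)) (\<epsilon>2 i)"
      using near[OF gL \<open>e / (2 * c) > 0\<close>] by metis
    define \<epsilon> where "\<epsilon> = Min (insert \<epsilon>0 (insert \<epsilon>1 (range \<epsilon>2)))"
    have \<epsilon>: "\<epsilon> > 0" unfolding \<epsilon>_def using \<epsilon>0(1) \<epsilon>1(1) \<epsilon>2(1) by auto
    have \<epsilon>_le: "\<epsilon> \<le> \<epsilon>0" "\<epsilon> \<le> \<epsilon>1" "\<epsilon> \<le> \<epsilon>2 i" for i
      unfolding \<epsilon>_def by (rule Min_le; simp)+
    obtain \<eta> :: "real^'n \<Rightarrow> real" where \<eta>: "mollifier \<epsilon> \<eta>" using mollifier_exists[OF \<epsilon>] by blast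
    have \<eta>t: "\<eta> \<in> test_functions (ball 0 \<epsilon>)" using \<eta> by (simp add: mollifier_def)
    let ?m = "moll \<eta> ?f"
    have mt: "?m \<in> test_functions \<Omega>" by (rule \<epsilon>0(2)[OF \<epsilon>_le(1) \<eta> L2_integrable[OF fL]]) (simp add: S(3))
    have pm: "partial_deriv i ?m x = moll \<eta> (g i) x" for i x
    proof -
      have "partial_deriv i ?m x = - (LINT y|\<mu>. (\<theta> y * u y) * partial_deriv i \<eta> (y - x))"
        unfolding moll_partial[OF \<eta>t L2_integrable[OF fL]] by (simp add: moll_def mult.commute)
      also have "\<dots> = - (LINT y|\<mu>. (\<theta> y * u y) * partial_deriv i (\<lambda>y. \<eta> (y - x)) y)"
        by (simp add: partial_deriv_translate[OF smooth_differentiable[OF test_smooth[OF \<eta>t]]])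
      also have "\<dots> = (LINT y|\<mu>. (\<theta> y * W u y $ i + u y * partial_deriv i \<theta> y) * \<eta> (y - x))"
        using cutoff_weak_grad_smooth[OF u \<theta> smooth_translate[OF test_smooth[OF \<eta>t]], of i x] by simp
      finally show ?thesis by (simp add: moll_def g_def mult.commute)
    qed
    have gm: "has_weak_grad \<Omega> (\<lambda>x. ?f x + (-1) * ?m x) (\<lambda>x. ?G x + (-1) *\<^sub>R grad ?m x)"
      by (intro has_weak_grad_add wg has_weak_grad_scale test_has_weak_grad mt)
    have Gv: "(\<lambda>x. ?G x + (-1) *\<^sub>R grad ?m x) = (\<lambda>x. \<chi> i. g i x - moll \<eta> (g i) x)"
      by (simp add: fun_eq_iff vec_eq_iff grad_nth pm g_def)
    have sgn: "norm_L2 \<Omega> (\<lambda>x. a x - b x) = norm_L2 \<Omega> (\<lambda>x. b x - a x)" for a b :: "real^'n \<Rightarrow> real"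
      by (simp add: norm_L2_def power2_commute)
    have "norm_H1 \<Omega> (\<lambda>x. ?f x - ?m x) \<le> norm_L2 \<Omega> (\<lambda>x. ?f x - ?m x) + norm_L2 \<Omega> (\<lambda>x. \<chi> i. g i x - moll \<eta> (g i) x)"
      using norm_H1_le_sum[OF gm] unfolding Gv by simp
    also have "norm_L2 \<Omega> (\<lambda>x. \<chi> i. g i x - moll \<eta> (g i) x) \<le> (\<Sum>i\<in>UNIV. norm_L2 \<Omega> (\<lambda>x. g i x - moll \<eta> (g i) x))"
      by (rule L2_vec) (intro L2_diff gL moll_L2(1)[OF \<eta>])
    also have "\<dots> \<le> (\<Sum>i\<in>(UNIV::'n set). e / (2 * c))"
      by (rule sum_mono) (subst sgn, rule less_imp_le, rule \<epsilon>2(2)[unfolded near_def, rule_format, OF \<epsilon> \<epsilon>_le(3) \<eta>])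
    also have "\<dots> = e/2" using c by (simp add: c_def)
    also have "norm_L2 \<Omega> (\<lambda>x. ?f x - ?m x) < e/2" by (subst sgn) (rule \<epsilon>1(2)[unfolded near_def, rule_format, OF \<epsilon> \<epsilon>_le(2) \<eta>])
    finally have "norm_H1 \<Omega> (\<lambda>x. ?f x - ?m x) < e" by simp
    with mt show "\<exists>\<phi>\<in>test_functions \<Omega>. norm_H1 \<Omega> (\<lambda>x. \<theta> x * u x - \<phi> x) < e" by blast
  qed
qed

text \<open>
The rate for test functions extends by density.
\<close>

lemma H10_moll_close:
  assumes f: "f \<in> H10 \<Omega>" and \<eta>: "mollifier \<epsilon> \<eta>" and \<epsilon>: "\<epsilon> > 0"
  shows "norm_L2 \<Omega> (moll \<eta> f - f) \<le> \<epsilon> * norm_H1 \<Omega> f"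
proof (rule field_le_epsilon)
  fix e :: real assume e: "e > 0"
  then have "e / (2 + \<epsilon>) > 0" using \<epsilon> by simp
  then obtain \<phi> where \<phi>: "\<phi> \<in> test_functions \<Omega>" "norm_H1 \<Omega> (f - \<phi>) < e / (2 + \<epsilon>)"
    by (rule H10_approx[OF f])
  define d where "d = norm_H1 \<Omega> (f - \<phi>)"
  have fH: "f \<in> H1 \<Omega>" and \<phi>H: "\<phi> \<in> H1 \<Omega>" by (rule H10_H1[OF f] test_H1[OF \<phi>(1)])+
  note fL = H1_L2[OF fH] and \<phi>L = H1_L2[OF \<phi>H]
  have mfL: "moll \<eta> f \<in> L2 \<Omega>" and m\<phi>L: "moll \<eta> \<phi> \<in> L2 \<Omega>" by (rule moll_L2(1)[OF \<eta> fL] moll_L2(1)[OF \<eta> \<phi>L])+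
  have dL: "norm_L2 \<Omega> (f - \<phi>) \<le> d" unfolding d_def by (rule norm_L2_le_norm_H1)
  have "norm_L2 \<Omega> (moll \<eta> f - f) \<le> norm_L2 \<Omega> (moll \<eta> f - moll \<eta> \<phi>) + norm_L2 \<Omega> (moll \<eta> \<phi> - f)"
    by (rule L2.nrm_diff_triangle[OF mfL m\<phi>L fL])
  also have "norm_L2 \<Omega> (moll \<eta> \<phi> - f) \<le> norm_L2 \<Omega> (moll \<eta> \<phi> - \<phi>) + norm_L2 \<Omega> (\<phi> - f)"
    by (rule L2.nrm_diff_triangle[OF m\<phi>L \<phi>L fL])
  also have "norm_L2 \<Omega> (\<phi> - f) = norm_L2 \<Omega> (f - \<phi>)" by (rule L2.nrm_minus_commute[OF \<phi>L fL])
  also have "moll \<eta> f - moll \<eta> \<phi> = moll \<eta> (f - \<phi>)"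
    using moll_diff[OF \<eta> L2_integrable[OF fL] L2_integrable[OF \<phi>L]] by (simp add: fun_eq_iff fun_diff_def)
  also have "norm_L2 \<Omega> (moll \<eta> (f - \<phi>)) \<le> norm_L2 \<Omega> (f - \<phi>)" by (rule moll_L2(2)[OF \<eta> L2.V_diff[OF fL \<phi>L]])
  also have "norm_L2 \<Omega> (moll \<eta> \<phi> - \<phi>) \<le> \<epsilon> * norm_L2 \<Omega> (grad \<phi>)"
    using moll_test_close[OF \<eta> \<phi>(1) \<epsilon>] by (simp add: fun_diff_def)
  also have "norm_L2 \<Omega> (grad \<phi>) = norm_L2 \<Omega> (W \<phi>)"
    by (rule L2_AE_cong(2)[OF test_grad_L2[OF \<phi>(1)] L2_measurable[OF weak_grad_L2[OF \<phi>H]]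
         has_weak_grad_AE[OF test_has_weak_grad[OF \<phi>(1)]], symmetric])
  finally have "norm_L2 \<Omega> (moll \<eta> f - f) \<le> norm_L2 \<Omega> (f - \<phi>) + (\<epsilon> * norm_L2 \<Omega> (W \<phi>) + norm_L2 \<Omega> (f - \<phi>))"
    by (simp add: fun_diff_def)
  moreover have "norm_L2 \<Omega> (W \<phi>) \<le> d + norm_H1 \<Omega> f"
    using norm_L2_le_norm_H1(2)[of \<phi>] H1.nrm_triangle_sub[OF \<phi>H fH] H1.nrm_minus_commute[OF fH \<phi>H] by (simp add: d_def)
  then have "\<epsilon> * norm_L2 \<Omega> (W \<phi>) \<le> \<epsilon> * (d + norm_H1 \<Omega> f)" using \<epsilon> by (intro mult_left_mono) auto
  moreover have "(2 + \<epsilon>) * d \<le> e" using \<phi>(2) \<epsilon> by (simp add: d_def field_simps)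
  ultimately show "norm_L2 \<Omega> (moll \<eta> f - f) \<le> \<epsilon> * norm_H1 \<Omega> f + e"
    using dL by (simp add: algebra_simps)
qed

text \<open>
The value of the mollification at a point is an inner product with a fixed function. So weak convergence
yields pointwise convergence, and the values are uniformly bounded.
\<close>

lemma moll_weakly_null:
  assumes \<eta>: "mollifier \<epsilon> \<eta>" and f: "\<And>n. f n \<in> L2 \<Omega>" and R: "\<And>n. norm_L2 \<Omega> (f n) \<le> R"
    and weak: "\<And>h. h \<in> L2 \<Omega> \<Longrightarrow> (\<lambda>n::nat. ipL2 \<Omega> (f n) h) \<longlonglongrightarrow> 0"
  shows "(\<lambda>n. norm_L2 \<Omega> (moll \<eta> (f n))) \<longlonglongrightarrow> 0"
proof -
  have \<eta>t: "\<eta> \<in> test_functions (ball 0 \<epsilon>)" using \<eta> by (simp add: mollifier_def)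
  obtain B where B: "B > 0" "\<And>x. \<bar>\<eta> x\<bar> \<le> B" using test_bounded[OF \<eta>t] by metis
  have \<eta>L: "(\<lambda>y. \<eta> (y - x)) \<in> L2 \<Omega>" and \<eta>n: "norm_L2 \<Omega> (\<lambda>y. \<eta> (y - x)) \<le> B * norm_L2 \<Omega> (\<lambda>_. 1::real)" for x
    using L2_dominated[OF L2_one test_translate_measurable[OF \<eta>t], of B x] B by auto
  have eq: "moll \<eta> (f n) x = ipL2 \<Omega> (f n) (\<lambda>y. \<eta> (y - x))" for n x
    by (simp add: moll_def ipL2_def mult.commute[of "\<eta> _"])
  define M where "M = R * (B * norm_L2 \<Omega> (\<lambda>_. 1::real))"
  have M: "\<bar>moll \<eta> (f n) x\<bar> \<le> M" for n x
  proof -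
    have "\<bar>moll \<eta> (f n) x\<bar> \<le> norm_L2 \<Omega> (f n) * norm_L2 \<Omega> (\<lambda>y. \<eta> (y - x))"
      unfolding eq by (rule L2.ip_Cauchy_Schwarz[OF f \<eta>L])
    also have "\<dots> \<le> M" unfolding M_def
      by (intro mult_mono R \<eta>n norm_L2_nonneg order_trans[OF norm_L2_nonneg R])
    finally show ?thesis .
  qed
  have "(\<lambda>n. LINT x|\<mu>. (norm (moll \<eta> (f n) x))\<^sup>2) \<longlonglongrightarrow> (LINT x|\<mu>. 0)"
  proof (rule integral_dominated_convergence)
    show "integrable \<mu> (\<lambda>x. M\<^sup>2)" by simp
    show "AE x in \<mu>. (\<lambda>n. (norm (moll \<eta> (f n) x))\<^sup>2) \<longlonglongrightarrow> 0"
    proof (rule AE_I2)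
      fix x
      have "(\<lambda>n. moll \<eta> (f n) x) \<longlonglongrightarrow> 0" unfolding eq by (rule weak[OF \<eta>L])
      from tendsto_power[OF tendsto_norm[OF this], of 2] show "(\<lambda>n. (norm (moll \<eta> (f n) x))\<^sup>2) \<longlonglongrightarrow> 0" by simp
    qed
    have "\<bar>moll \<eta> (f n) x\<bar>\<^sup>2 \<le> M\<^sup>2" for n x by (rule power_mono[OF M abs_ge_zero])
    then show "AE x in \<mu>. norm ((norm (moll \<eta> (f n) x))\<^sup>2) \<le> M\<^sup>2" for n by (intro AE_I2) simp
    show "(\<lambda>x. (norm (moll \<eta> (f n) x))\<^sup>2) \<in> borel_measurable \<mu>" for n
      using moll_measurable[OF \<eta> L2_integrable[OF f]] by measurable
  qed simp
  from tendsto_real_sqrt[OF this] show ?thesis by (simp add: norm_L2_def)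
qed

text \<open>
Mollification at scale \<open>\<epsilon>\<close> moves all \<open>f n\<close> by at most \<open>\<epsilon> * R\<close>, and for fixed \<open>\<epsilon>\<close> the mollifications tend
to \<open>0\<close> in norm.
\<close>

theorem Rellich:
  assumes f: "\<And>n. f n \<in> H10 \<Omega>" and R: "\<And>n. norm_H1 \<Omega> (f n) \<le> R"
    and weak: "\<And>h. h \<in> L2 \<Omega> \<Longrightarrow> (\<lambda>n::nat. ipL2 \<Omega> (f n) h) \<longlonglongrightarrow> 0"
  shows "(\<lambda>n. norm_L2 \<Omega> (f n)) \<longlonglongrightarrow> 0"
proof (rule LIMSEQ_I)
  fix e :: real assume e: "e > 0"
  have fL: "f n \<in> L2 \<Omega>" for n by (rule H1_L2[OF H10_H1[OF f]])
  have RL: "norm_L2 \<Omega> (f n) \<le> R" for n by (rule order_trans[OF norm_L2_le_norm_H1(1) R])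
  have R0: "R \<ge> 0" by (rule order_trans[OF norm_L2_nonneg RL])
  define \<epsilon> where "\<epsilon> = e / (2 * (R + 1))"
  have \<epsilon>: "\<epsilon> > 0" using e R0 by (simp add: \<epsilon>_def)
  have "\<epsilon> * R \<le> \<epsilon> * (R + 1)" using \<epsilon> by simp
  also have "\<dots> = e/2"
  proof -
    have "R + 1 \<noteq> 0" using R0 by simp
    then show ?thesis unfolding \<epsilon>_def by (simp only: times_divide_eq_left mult.commute[of 2] divide_divide_eq_left[symmetric] nonzero_mult_div_cancel_right not_False_eq_True)
  qed
  finally have \<epsilon>R: "\<epsilon> * R \<le> e/2" .
  obtain \<eta> :: "real^'n \<Rightarrow> real" where \<eta>: "mollifier \<epsilon> \<eta>" using mollifier_exists[OF \<epsilon>] by blast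
  have "(\<lambda>n. norm_L2 \<Omega> (moll \<eta> (f n))) \<longlonglongrightarrow> 0" by (rule moll_weakly_null[OF \<eta> fL RL weak])
  from order_tendstoD(2)[OF this, of "e/2"] e
  obtain N where N: "\<And>n. n \<ge> N \<Longrightarrow> norm_L2 \<Omega> (moll \<eta> (f n)) < e/2"
    unfolding eventually_sequentially by auto
  show "\<exists>N. \<forall>n\<ge>N. norm (norm_L2 \<Omega> (f n) - 0) < e"
  proof (intro exI[of _ N] allI impI)
    fix n assume n: "n \<ge> N"
    have "norm_L2 \<Omega> (f n) \<le> norm_L2 \<Omega> (f n - moll \<eta> (f n)) + norm_L2 \<Omega> (moll \<eta> (f n))"
      by (rule L2.nrm_triangle_sub[OF fL moll_L2(1)[OF \<eta> fL]])
    also have "norm_L2 \<Omega> (f n - moll \<eta> (f n)) = norm_L2 \<Omega> (moll \<eta> (f n) - f n)"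
      by (rule L2.nrm_minus_commute[OF fL moll_L2(1)[OF \<eta> fL]])
    also have "\<dots> \<le> \<epsilon> * norm_H1 \<Omega> (f n)" by (rule H10_moll_close[OF f \<eta> \<epsilon>])
    also have "\<dots> \<le> \<epsilon> * R" using R \<epsilon> by (intro mult_left_mono) auto
    finally show "norm (norm_L2 \<Omega> (f n) - 0) < e" using N[OF n] \<epsilon>R norm_L2_nonneg[of \<Omega> "f n"] by simp
  qed
qed

lemma \<Omega>_neq_UNIV: "\<Omega> \<noteq> UNIV" using bounded_\<Omega> not_bounded_UNIV by metis

text \<open>
A segment from \<open>x\<close> to the complement crosses the frontier.
\<close>

lemma infdist_frontier_le_infdist_compl:
  assumes x: "x \<in> \<Omega>" shows "infdist x (frontier \<Omega>) \<le> infdist x (- \<Omega>)"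
proof -
  have ne: "- \<Omega> \<noteq> {}" using \<Omega>_neq_UNIV by auto
  have "infdist x (frontier \<Omega>) \<le> dist x y" if y: "y \<in> - \<Omega>" for y
  proof -
    have "closed_segment x y \<inter> frontier \<Omega> \<noteq> {}"
      by (rule connected_Int_frontier) (use x y in auto)
    then obtain z where z: "z \<in> closed_segment x y" "z \<in> frontier \<Omega>" by blast
    have "infdist x (frontier \<Omega>) \<le> dist x z" by (rule infdist_le[OF z(2)])
    also have "\<dots> \<le> dist x y" using dist_in_closed_segment[OF z(1)] by (simp add: dist_commute)
    finally show ?thesis .
  qed
  then show ?thesis unfolding infdist_notempty[OF ne] by (intro cINF_greatest ne)
qed

text \<open>
The cutoff is a mollified clamp of the distance to the complement. Averaging preserves the Lipschitz
constant \<open>4 / \<delta>\<close> of the clamp, and a Lipschitz constant bounds the gradient.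
\<close>

theorem cutoff_exists:
  assumes \<delta>: "\<delta> > 0"
  obtains \<theta> where "\<theta> \<in> test_functions \<Omega>" "\<And>x. 0 \<le> \<theta> x" "\<And>x. \<theta> x \<le> 1"
    "\<And>x. x \<in> \<Omega> \<Longrightarrow> x \<notin> boundary_layer \<Omega> \<delta> \<Longrightarrow> \<theta> x = 1 \<and> grad \<theta> x = 0"
    "\<And>x. norm (grad \<theta> x) \<le> 4 / \<delta>"
proof -
  define d where "d x = infdist x (- \<Omega>)" for x
  \<comment> \<open>The clamp rises from 0 to 1 between the distances \<open>\<delta> / 4\<close> and \<open>\<delta> / 2\<close> to the complement, which leaves
    room for mollification at scale \<open>\<delta> / 8\<close> on either side.\<close>
  define \<rho> where "\<rho> x = max 0 (min 1 (4 / \<delta> * d x - 1))" for x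
  have ne: "- \<Omega> \<noteq> {}" using \<Omega>_neq_UNIV by auto
  have cld: "closed (- \<Omega>)" using open_\<Omega> by (simp add: closed_Compl)
  have dlip: "\<bar>d x - d y\<bar> \<le> dist x y" for x y unfolding d_def by (rule infdist_triangle_abs)
  have d0: "d x \<ge> 0" for x unfolding d_def by (rule infdist_nonneg)
  have d\<Omega>: "x \<in> \<Omega>" if "d x > 0" for x
  proof (rule ccontr)
    assume "x \<notin> \<Omega>"
    then have "d x = 0" unfolding d_def by (intro infdist_zero) simp
    with that show False by simp
  qed
  have dcont: "continuous_on UNIV d" unfolding d_def by (intro continuous_intros)
  have \<rho>b: "0 \<le> \<rho> x" "\<rho> x \<le> 1" for x by (auto simp: \<rho>_def)
  have \<rho>lip: "\<bar>\<rho> x - \<rho> y\<bar> \<le> 4 / \<delta> * norm (x - y)" for x y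
  proof -
    have clamp: "\<bar>max 0 (min 1 (a - 1)) - max 0 (min 1 (b - 1))\<bar> \<le> \<bar>a - b\<bar>" for a b :: real by linarith
    have "\<bar>\<rho> x - \<rho> y\<bar> \<le> \<bar>4 / \<delta> * d x - 4 / \<delta> * d y\<bar>" unfolding \<rho>_def by (rule clamp)
    also have "\<dots> = \<bar>4 / \<delta>\<bar> * \<bar>d x - d y\<bar>" unfolding right_diff_distrib[symmetric] by (rule abs_mult)
    also have "\<bar>4 / \<delta>\<bar> = 4 / \<delta>" using \<delta> by simp
    also have "4 / \<delta> * \<bar>d x - d y\<bar> \<le> 4 / \<delta> * norm (x - y)" using dlip[of x y] \<delta> by (intro mult_left_mono) (auto simp: dist_norm)
    finally show ?thesis .
  qed
  have \<rho>1: "\<rho> x = 1" if "d x \<ge> \<delta> / 2" for x using that \<delta> by (simp add: \<rho>_def field_simps)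
  have \<rho>0: "d x \<ge> \<delta> / 4" if "\<rho> x \<noteq> 0" for x
  proof (rule ccontr)
    assume "\<not> d x \<ge> \<delta> / 4"
    then have "4 / \<delta> * d x - 1 < 0" using \<delta> by (simp add: field_simps)
    then have "\<rho> x = 0" by (simp add: \<rho>_def)
    with that show False by simp
  qed
  have \<rho>cont: "continuous_on UNIV \<rho>" unfolding \<rho>_def by (intro continuous_intros dcont)
  then have [measurable]: "\<rho> \<in> borel_measurable borel" by (rule borel_measurable_continuous_onI)
  define \<epsilon> where "\<epsilon> = \<delta> / 8"
  have \<epsilon>: "\<epsilon> > 0" using \<delta> by (simp add: \<epsilon>_def)
  obtain \<eta> :: "real^'n \<Rightarrow> real" where \<eta>: "mollifier \<epsilon> \<eta>" using mollifier_exists[OF \<epsilon>] by blast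
  have \<eta>t: "\<eta> \<in> test_functions (ball 0 \<epsilon>)" and \<eta>0: "\<And>x. 0 \<le> \<eta> x" and \<eta>1: "integral\<^sup>L lborel \<eta> = 1"
    using \<eta> by (auto simp: mollifier_def)
  note [measurable] = mollifier_measurable[OF \<eta>]
  have \<eta>z: "\<eta> h = 0" if "norm h \<ge> \<epsilon>" for h
    using test_functionsE[OF \<eta>t] that by (metis mem_ball_0 not_le subsetD)
  have \<eta>i: "integrable lborel \<eta>" by (rule test_integrable_lborel[OF \<eta>t])
  have \<rho>m: "\<rho> \<in> borel_measurable \<mu>" by (rule borel_measurable_lebesgue_on) measurable
  have \<rho>L: "\<rho> \<in> L2 \<Omega>" by (rule L2_bounded_measurable[OF \<rho>m, of 1]) (use \<rho>b in \<open>auto intro!: AE_I2\<close>)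
  define \<theta> where "\<theta> = moll \<eta> \<rho>"
  have \<theta>: "\<theta> x = (\<integral>h. \<eta> h * \<rho> (x + h) \<partial>lborel)" for x
    unfolding \<theta>_def
  proof (rule moll_eq_lborel[OF \<rho>m])
    show "AE x in lebesgue. indicator \<Omega> x * \<rho> x = \<rho> x"
    proof (rule AE_I2)
      fix x show "indicator \<Omega> x * \<rho> x = \<rho> x"
        using \<rho>0[of x] d\<Omega>[of x] \<delta> by (cases "\<rho> x = 0") (auto simp: indicator_def)
    qed
  qed measurable
  have \<eta>\<rho>: "integrable lborel (\<lambda>h. \<eta> h * \<rho> (x + h))" for x
  proof (rule Bochner_Integration.integrable_bound[OF \<eta>i])
    show "AE h in lborel. norm (\<eta> h * \<rho> (x + h)) \<le> norm (\<eta> h)"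
      using \<rho>b \<eta>0 by (intro AE_I2) (simp add: mult_left_le)
  qed measurable
  have \<theta>0: "0 \<le> \<theta> x" for x
    unfolding \<theta> using \<rho>b \<eta>0 by (intro integral_nonneg_AE AE_I2) simp
  have \<theta>1: "\<theta> x \<le> 1" for x
    unfolding \<theta> \<eta>1[symmetric] using \<rho>b \<eta>0 by (intro integral_mono \<eta>\<rho> \<eta>i) (simp add: mult_left_le)
  have \<theta>lip: "\<bar>\<theta> y - \<theta> x\<bar> \<le> 4 / \<delta> * norm (y - x)" for x y
  proof -
    have "\<theta> y - \<theta> x = (\<integral>h. \<eta> h * \<rho> (y + h) - \<eta> h * \<rho> (x + h) \<partial>lborel)"
      unfolding \<theta> using \<eta>\<rho> by simp
    also have "\<bar>\<dots>\<bar> \<le> (\<integral>h. \<eta> h * (4 / \<delta> * norm (y - x)) \<partial>lborel)"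
      unfolding real_norm_def[symmetric]
    proof (rule Bochner_Integration.integral_norm_bound_integral)
      show "integrable lborel (\<lambda>h. \<eta> h * \<rho> (y + h) - \<eta> h * \<rho> (x + h))" using \<eta>\<rho> by simp
      show "integrable lborel (\<lambda>h. \<eta> h * (4 / \<delta> * norm (y - x)))" using \<eta>i by simp
      fix h
      have "norm (\<eta> h * \<rho> (y + h) - \<eta> h * \<rho> (x + h)) = \<eta> h * \<bar>\<rho> (y + h) - \<rho> (x + h)\<bar>"
        using \<eta>0 by (simp add: right_diff_distrib[symmetric] abs_mult)
      also have "\<dots> \<le> \<eta> h * (4 / \<delta> * norm (y - x))"
        using \<rho>lip[of "y + h" "x + h"] \<eta>0 by (intro mult_left_mono) auto
      finally show "norm (\<eta> h * \<rho> (y + h) - \<eta> h * \<rho> (x + h)) \<le> \<eta> h * (4 / \<delta> * norm (y - x))" .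
    qed
    also have "\<dots> = 4 / \<delta> * norm (y - x)" using \<eta>1 by simp
    finally show ?thesis .
  qed
  have sm: "smooth \<theta>" unfolding \<theta>_def by (rule moll_smooth[OF \<eta>t L2_integrable[OF \<rho>L]])
  have eq1: "\<theta> x = 1" if x: "d x > 5 * \<delta> / 8" for x
  proof -
    have "\<eta> h * \<rho> (x + h) = \<eta> h" for h
    proof (cases "norm h < \<epsilon>")
      case True
      then have "d (x + h) \<ge> \<delta> / 2" using dlip[of x "x + h"] x by (auto simp: dist_norm \<epsilon>_def)
      then show ?thesis using \<rho>1 by simp
    qed (simp add: \<eta>z)
    then have "(\<lambda>h. \<eta> h * \<rho> (x + h)) = \<eta>" by blast
    then show ?thesis unfolding \<theta> using \<eta>1 by metis
  qed
  show thesis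
  proof (rule that[of \<theta>])
    show "\<theta> \<in> test_functions \<Omega>"
    proof (rule test_functionsI[OF sm, of "{x. d x \<ge> \<delta> / 8}"])
      have sub: "{x. d x \<ge> \<delta> / 8} \<subseteq> \<Omega>" using d\<Omega> \<delta> by force
      then show "{x. d x \<ge> \<delta> / 8} \<subseteq> \<Omega>" .
      have "closed {x. d x \<ge> \<delta> / 8}" by (intro closed_Collect_le continuous_on_const dcont)
      then show "compact {x. d x \<ge> \<delta> / 8}"
        using bounded_subset[OF bounded_\<Omega> sub] by (simp add: compact_eq_bounded_closed)
      fix x assume x: "x \<notin> {x. d x \<ge> \<delta> / 8}"
      have "\<eta> h * \<rho> (x + h) = 0" for h
      proof (cases "norm h < \<epsilon>")
        case True
        then have "d (x + h) < \<delta> / 4" using dlip[of x "x + h"] x by (auto simp: dist_norm \<epsilon>_def)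
        then show ?thesis using \<rho>0[of "x + h"] by auto
      qed (simp add: \<eta>z)
      then have "(\<lambda>h. \<eta> h * \<rho> (x + h)) = (\<lambda>_. 0)" by blast
      then show "\<theta> x = 0" unfolding \<theta> by simp
    qed
    show "norm (grad \<theta> x) \<le> 4 / \<delta>" for x
      by (rule grad_bound_if_Lipschitz[OF smooth_has_derivative[OF sm] \<theta>lip])
    fix x assume x: "x \<in> \<Omega>" "x \<notin> boundary_layer \<Omega> \<delta>"
    then have "d x \<ge> \<delta>" using infdist_frontier_le_infdist_compl[OF x(1)] by (simp add: boundary_layer_def d_def)
    then have dx: "d x > 5 * \<delta> / 8" using \<delta> by simp
    have "(\<theta> has_derivative (\<lambda>h. 0)) (at x)"
    proof (rule has_derivative_transform_within_open[of "\<lambda>x. 1" _ x UNIV "{x. d x > 5 * \<delta> / 8}"])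
      show "open {x. d x > 5 * \<delta> / 8}" by (intro open_Collect_less continuous_on_const dcont)
      show "1 = \<theta> y" if "y \<in> {x. d x > 5 * \<delta> / 8}" for y using eq1[of y] that by simp
    qed (use dx in auto)
    from partial_derivI[OF this] show "\<theta> x = 1 \<and> grad \<theta> x = 0"
      using eq1[OF dx] by (simp add: grad_def vec_eq_iff)
  qed (rule \<theta>0 \<theta>1)+
qed

lemma compact_avoids_boundary_layer:
  assumes S: "compact S" "S \<subseteq> \<Omega>"
  obtains \<delta>0 where "\<delta>0 > 0" "\<And>\<delta>. \<delta> \<le> \<delta>0 \<Longrightarrow> S \<inter> boundary_layer \<Omega> \<delta> = {}"
proof -
  have "S \<inter> frontier \<Omega> = {}" using S(2) open_\<Omega> by (auto simp: frontier_def interior_open)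
  then obtain r where r: "r > 0" "\<And>x y. x \<in> S \<Longrightarrow> y \<in> frontier \<Omega> \<Longrightarrow> r \<le> dist x y"
    using separate_compact_closed[OF S(1) frontier_closed] by metis
  have "x \<notin> boundary_layer \<Omega> \<delta>" if x: "x \<in> S" and \<delta>: "\<delta> \<le> r" for x \<delta>
  proof -
    have "frontier \<Omega> \<noteq> {}" using x S(2) \<Omega>_neq_UNIV by (auto simp: frontier_eq_empty)
    then have "r \<le> infdist x (frontier \<Omega>)"
      unfolding infdist_def using r(2)[OF x] by (auto intro!: cINF_greatest)
    then show ?thesis using \<delta> by (simp add: boundary_layer_def)
  qed
  then show thesis using r(1) by (intro that[of r]) blast+
qed

end

section \<open>Coefficient fields and Dirichlet problems\<close>

lemma norm_matrix_vector_le: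
  fixes A :: "real^'n^'m"
  shows "norm (A *v x) \<le> norm A * norm x"
proof (rule power2_le_imp_le)
  have "(norm (A *v x))\<^sup>2 = (\<Sum>i\<in>UNIV. (A $ i \<bullet> x)\<^sup>2)"
    by (simp add: norm_vec_def L2_set_def sum_nonneg matrix_vector_mul_component)
  also have "\<dots> \<le> (\<Sum>i\<in>UNIV. (norm (A $ i))\<^sup>2 * (norm x)\<^sup>2)"
    by (rule sum_mono)
      (simp only: power_mult_distrib[symmetric] abs_le_square_iff[symmetric] abs_mult abs_norm_cancel Cauchy_Schwarz_ineq2)
  also have "\<dots> = (norm A * norm x)\<^sup>2"
    by (simp add: norm_vec_def[of A] L2_set_def sum_nonneg sum_distrib_right[symmetric] power_mult_distrib)
  finally show "(norm (A *v x))\<^sup>2 \<le> (norm A * norm x)\<^sup>2" .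
qed simp

lemma symmetric_matrix_inner_commute:
  fixes A :: "real^'n^'n"
  assumes "transpose A = A" shows "(A *v \<xi>) \<bullet> \<zeta> = (A *v \<zeta>) \<bullet> \<xi>"
proof -
  have "(A *v \<xi>) \<bullet> \<zeta> = (transpose A *v \<xi>) \<bullet> \<zeta>" using assms by simp
  also have "\<dots> = \<xi> \<bullet> (A *v \<zeta>)" by (simp add: dot_lmul_matrix)
  finally show ?thesis by (simp add: inner_commute)
qed

text \<open>
The Cauchy--Schwarz inequality for the form defined by \<open>A\<close>. It turns the bounds on the quadratic forms in
\<open>M_K\<close> into a bound on the matrices that is uniform over all of \<open>M_K\<close>.
\<close>

lemma symmetric_matrix_bound:
  fixes A :: "real^'n^'n"
  assumes sym: "transpose A = A" and pos: "\<And>\<xi>. 0 \<le> (A *v \<xi>) \<bullet> \<xi>"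
    and le: "\<And>\<xi>. (A *v \<xi>) \<bullet> \<xi> \<le> K * (norm \<xi>)\<^sup>2" and K: "K \<ge> 0"
  shows "\<bar>(A *v \<xi>) \<bullet> \<zeta>\<bar> \<le> K * (norm \<xi> * norm \<zeta>)"
proof -
  interpret M: semi_inner_space UNIV "\<lambda>\<xi> \<zeta>. (A *v \<xi>) \<bullet> \<zeta>"
    by unfold_locales
      (auto simp: matrix_vector_right_distrib inner_add_left matrix_vector_mult_scaleR pos
        intro: symmetric_matrix_inner_commute[OF sym])
  have "M.nrm x \<le> sqrt K * norm x" for x
    unfolding M.nrm_def using real_sqrt_le_mono[OF le[of x]] by (simp add: real_sqrt_mult)
  then have "M.nrm \<xi> * M.nrm \<zeta> \<le> (sqrt K * norm \<xi>) * (sqrt K * norm \<zeta>)"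
    using K by (intro mult_mono) (auto intro: M.nrm_nonneg)
  also have "\<dots> = (sqrt K * sqrt K) * (norm \<xi> * norm \<zeta>)" by (simp only: mult_ac)
  also have "\<dots> = K * (norm \<xi> * norm \<zeta>)" using K by simp
  finally show ?thesis using M.ip_Cauchy_Schwarz[of \<xi> \<zeta>] by simp
qed

definition mat_app :: "(real^'n \<Rightarrow> real^'n^'n) \<Rightarrow> (real^'n \<Rightarrow> real^'n) \<Rightarrow> real^'n \<Rightarrow> real^'n" where
  "mat_app \<sigma> g x = \<sigma> x *v g x"

lemma mat_app_measurable:
  assumes "\<sigma> \<in> borel_measurable M" "g \<in> borel_measurable M"
  shows "mat_app \<sigma> g \<in> borel_measurable M"
proof -
  have "continuous_on UNIV (\<lambda>x. fst x *v snd x :: real^'n)"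
    unfolding matrix_vector_mult_def by (intro continuous_intros)
  from borel_measurable_continuous_Pair[OF assms this] show ?thesis by (simp add: mat_app_def[abs_def])
qed

locale elliptic = bounded_open \<Omega> for \<Omega> :: "(real^'n) set" +
  fixes K :: real
  assumes K1: "K \<ge> 1"
begin

lemma M_K_measurable: "\<sigma> \<in> M_K K \<Omega> \<Longrightarrow> \<sigma> \<in> borel_measurable \<mu>"
  by (simp add: M_K_def)

lemma M_K_commute:
  assumes "\<sigma> \<in> M_K K \<Omega>"
  shows "AE x in \<mu>. \<forall>\<xi> \<zeta>. (\<sigma> x *v \<xi>) \<bullet> \<zeta> = (\<sigma> x *v \<zeta>) \<bullet> \<xi>"
proof -
  have "AE x in \<mu>. transpose (\<sigma> x) = \<sigma> x" using assms by (simp add: M_K_def)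
  then show ?thesis by eventually_elim (intro allI symmetric_matrix_inner_commute)
qed

lemma M_K_lower:
  assumes "\<sigma> \<in> M_K K \<Omega>"
  shows "AE x in \<mu>. \<forall>\<xi>. (norm \<xi>)\<^sup>2 \<le> K * ((\<sigma> x *v \<xi>) \<bullet> \<xi>)"
proof -
  have "AE x in \<mu>. \<forall>\<xi>. 1 / K * (norm \<xi>)\<^sup>2 \<le> (\<sigma> x *v \<xi>) \<bullet> \<xi> \<and> (\<sigma> x *v \<xi>) \<bullet> \<xi> \<le> K * (norm \<xi>)\<^sup>2"
    using assms by (simp add: M_K_def)
  then show ?thesis by eventually_elim (use K1 in \<open>simp add: field_simps\<close>)
qed

lemma M_K_bound:
  assumes "\<sigma> \<in> M_K K \<Omega>"
  shows "AE x in \<mu>. \<forall>\<xi>. norm (\<sigma> x *v \<xi>) \<le> K * norm \<xi>"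
proof -
  have "AE x in \<mu>. transpose (\<sigma> x) = \<sigma> x"
    "AE x in \<mu>. \<forall>\<xi>. 1 / K * (norm \<xi>)\<^sup>2 \<le> (\<sigma> x *v \<xi>) \<bullet> \<xi> \<and> (\<sigma> x *v \<xi>) \<bullet> \<xi> \<le> K * (norm \<xi>)\<^sup>2"
    using assms by (simp_all add: M_K_def)
  then show ?thesis
  proof eventually_elim
    case (elim x)
    show ?case
    proof
      fix \<xi>
      have pos: "0 \<le> (\<sigma> x *v \<xi>) \<bullet> \<xi>" for \<xi>
        using elim(2)[rule_format, of \<xi>] K1 by (meson dual_order.trans mult_nonneg_nonneg zero_le_divide_1_iff zero_le_one zero_le_power2)
      have "(norm (\<sigma> x *v \<xi>))\<^sup>2 \<le> K * (norm \<xi> * norm (\<sigma> x *v \<xi>))"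
        using symmetric_matrix_bound[OF elim(1) pos, of K \<xi> "\<sigma> x *v \<xi>"] elim(2) K1
        by (simp add: power2_norm_eq_inner)
      then show "norm (\<sigma> x *v \<xi>) \<le> K * norm \<xi>"
        by (cases "norm (\<sigma> x *v \<xi>) = 0") (use K1 in \<open>auto simp: power2_eq_square mult.assoc[symmetric]\<close>)
    qed
  qed
qed

context
  fixes \<sigma> assumes \<sigma>: "\<sigma> \<in> M_K K \<Omega>"
begin

lemma mat_app_L2: "g \<in> L2 \<Omega> \<Longrightarrow> mat_app \<sigma> g \<in> L2 \<Omega>"
  and norm_mat_app_le: "g \<in> L2 \<Omega> \<Longrightarrow> norm_L2 \<Omega> (mat_app \<sigma> g) \<le> K * norm_L2 \<Omega> g"
proof -
  assume g: "g \<in> L2 \<Omega>"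
  have "AE x in \<mu>. norm (mat_app \<sigma> g x) \<le> K * norm (g x)"
    using M_K_bound[OF \<sigma>] by eventually_elim (simp add: mat_app_def)
  from L2_dominated[OF g mat_app_measurable[OF M_K_measurable[OF \<sigma>] L2_measurable[OF g]] _ this]
  show "mat_app \<sigma> g \<in> L2 \<Omega>" "norm_L2 \<Omega> (mat_app \<sigma> g) \<le> K * norm_L2 \<Omega> g" using K1 by auto
qed

lemma ip_mat_app_commute:
  assumes f: "f \<in> L2 \<Omega>" and g: "g \<in> L2 \<Omega>"
  shows "ipL2 \<Omega> (mat_app \<sigma> f) g = ipL2 \<Omega> (mat_app \<sigma> g) f"
  unfolding ipL2_def
proof (rule integral_cong_AE)
  show "AE x in \<mu>. mat_app \<sigma> f x \<bullet> g x = mat_app \<sigma> g x \<bullet> f x"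
    using M_K_commute[OF \<sigma>] by eventually_elim (simp add: mat_app_def)
qed (intro borel_measurable_integrable integrable_inner_L2 mat_app_L2 f g)+

lemma ip_mat_app_bound:
  assumes f: "f \<in> L2 \<Omega>" and g: "g \<in> L2 \<Omega>"
  shows "\<bar>ipL2 \<Omega> (mat_app \<sigma> f) g\<bar> \<le> K * norm_L2 \<Omega> f * norm_L2 \<Omega> g"
  by (rule order_trans[OF L2.ip_Cauchy_Schwarz[OF mat_app_L2[OF f] g]
     mult_right_mono[OF norm_mat_app_le[OF f] norm_L2_nonneg]])

lemma ip_mat_app_coercive:
  assumes g: "g \<in> L2 \<Omega>"
  shows "(norm_L2 \<Omega> g)\<^sup>2 \<le> K * ipL2 \<Omega> (mat_app \<sigma> g) g"
proof -
  have "(LINT x|\<mu>. (norm (g x))\<^sup>2) \<le> (LINT x|\<mu>. K * (mat_app \<sigma> g x \<bullet> g x))"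
  proof (rule integral_mono_AE)
    show "integrable \<mu> (\<lambda>x. (norm (g x))\<^sup>2)" by (rule L2_integrable_sq[OF g])
    show "integrable \<mu> (\<lambda>x. K * (mat_app \<sigma> g x \<bullet> g x))"
      by (intro integrable_mult_right integrable_inner_L2 mat_app_L2 g)
    show "AE x in \<mu>. (norm (g x))\<^sup>2 \<le> K * (mat_app \<sigma> g x \<bullet> g x)"
      using M_K_lower[OF \<sigma>] by eventually_elim (simp add: mat_app_def)
  qed
  then show ?thesis by (simp add: ipL2_def norm_L2_def integral_nonneg_AE)
qed

lemma energy_eq: "energy \<Omega> \<sigma> u v = ipL2 \<Omega> (mat_app \<sigma> (W u)) (W v)"
  by (simp add: energy_def ipL2_def mat_app_def)

lemma energy_commute: "u \<in> H1 \<Omega> \<Longrightarrow> v \<in> H1 \<Omega> \<Longrightarrow> energy \<Omega> \<sigma> u v = energy \<Omega> \<sigma> v u"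
  unfolding energy_eq by (intro ip_mat_app_commute weak_grad_L2)

lemma energy_add_left:
  assumes u: "u \<in> H1 \<Omega>" and v: "v \<in> H1 \<Omega>" and w: "w \<in> H1 \<Omega>"
  shows "energy \<Omega> \<sigma> (u + v) w = energy \<Omega> \<sigma> u w + energy \<Omega> \<sigma> v w"
proof -
  note a = mat_app_L2[OF weak_grad_L2[OF w]]
  have e: "energy \<Omega> \<sigma> x w = ipL2 \<Omega> (W x) (mat_app \<sigma> (W w))" if "x \<in> H1 \<Omega>" for x
    by (rule trans[OF energy_commute[OF that w] trans[OF energy_eq L2.ip_commute[OF a weak_grad_L2[OF that]]]])
  show ?thesis unfolding e[OF H1_add[OF u v]] e[OF u] e[OF v] by (rule ipL2_weak_grad_add[OF u v a])
qed

lemma energy_scale_left: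
  assumes u: "u \<in> H1 \<Omega>" and w: "w \<in> H1 \<Omega>"
  shows "energy \<Omega> \<sigma> (c *\<^sub>R u) w = c * energy \<Omega> \<sigma> u w"
proof -
  note a = mat_app_L2[OF weak_grad_L2[OF w]]
  have e: "energy \<Omega> \<sigma> x w = ipL2 \<Omega> (W x) (mat_app \<sigma> (W w))" if "x \<in> H1 \<Omega>" for x
    by (rule trans[OF energy_commute[OF that w] trans[OF energy_eq L2.ip_commute[OF a weak_grad_L2[OF that]]]])
  show ?thesis unfolding e[OF H1_scale[OF u]] e[OF u] by (rule ipL2_weak_grad_scale[OF u a])
qed

lemma energy_bound:
  "u \<in> H1 \<Omega> \<Longrightarrow> v \<in> H1 \<Omega> \<Longrightarrow> \<bar>energy \<Omega> \<sigma> u v\<bar> \<le> K * norm_L2 \<Omega> (W u) * norm_L2 \<Omega> (W v)"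
  unfolding energy_eq by (intro ip_mat_app_bound weak_grad_L2)

lemma energy_coercive:
  "u \<in> H1 \<Omega> \<Longrightarrow> (norm_L2 \<Omega> (W u))\<^sup>2 \<le> K * energy \<Omega> \<sigma> u u"
  unfolding energy_eq by (intro ip_mat_app_coercive weak_grad_L2)

lemma energy_semi_inner: "semi_inner_space (H1 \<Omega>) (energy \<Omega> \<sigma>)"
proof
  fix x assume x: "x \<in> H1 \<Omega>"
  have "0 \<le> K * energy \<Omega> \<sigma> x x" by (rule order_trans[OF zero_le_power2 energy_coercive[OF x]])
  then show "0 \<le> energy \<Omega> \<sigma> x x" using K1 by (simp add: zero_le_mult_iff)
qed (auto simp: energy_add_left energy_scale_left intro: energy_commute subspace_H1)

lemma energy_diff_left:
  "u \<in> H1 \<Omega> \<Longrightarrow> v \<in> H1 \<Omega> \<Longrightarrow> w \<in> H1 \<Omega> \<Longrightarrow> energy \<Omega> \<sigma> (u - v) w = energy \<Omega> \<sigma> u w - energy \<Omega> \<sigma> v w"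
  by (rule semi_inner_space.ip_diff_left[OF energy_semi_inner])

lemma energy_diff_right:
  "u \<in> H1 \<Omega> \<Longrightarrow> v \<in> H1 \<Omega> \<Longrightarrow> w \<in> H1 \<Omega> \<Longrightarrow> energy \<Omega> \<sigma> u (v - w) = energy \<Omega> \<sigma> u v - energy \<Omega> \<sigma> u w"
  by (rule semi_inner_space.ip_diff_right[OF energy_semi_inner])

text \<open>
On \<open>H10\<close> the energy norm is equivalent to the norm of \<open>H1\<close>, by the bounds on \<open>\<sigma>\<close> and Poincare's
inequality.
\<close>

lemma energy_semi_hilbert_H10: "semi_hilbert_space (H10 \<Omega>) (energy \<Omega> \<sigma>)"
proof -
  interpret E1: semi_inner_space "H1 \<Omega>" "energy \<Omega> \<sigma>" by (rule energy_semi_inner)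
  interpret E: semi_inner_space "H10 \<Omega>" "energy \<Omega> \<sigma>"
    by unfold_locales
      (auto simp: E1.ip_add_left E1.ip_scale_left E1.ip_self_nonneg H10_H1 subspace_H10 intro: E1.ip_commute)
  obtain C where C: "C > 0" "\<And>u. u \<in> H10 \<Omega> \<Longrightarrow> norm_H1 \<Omega> u \<le> C * norm_L2 \<Omega> (W u)" using Poincare by metis
  have lower: "norm_H1 \<Omega> u \<le> C * (sqrt K * E.nrm u)" if u: "u \<in> H10 \<Omega>" for u
  proof -
    have "norm_L2 \<Omega> (W u) \<le> sqrt (K * energy \<Omega> \<sigma> u u)"
      by (rule real_le_rsqrt[OF energy_coercive[OF H10_H1[OF u]]])
    then have "norm_L2 \<Omega> (W u) \<le> sqrt K * E.nrm u" by (simp add: E.nrm_def real_sqrt_mult)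
    then show ?thesis using C(2)[OF u] C(1) by (meson dual_order.trans mult_left_mono less_imp_le)
  qed
  have upper: "E.nrm u \<le> sqrt K * norm_H1 \<Omega> u" if u: "u \<in> H1 \<Omega>" for u
  proof -
    have "energy \<Omega> \<sigma> u u \<le> K * (norm_L2 \<Omega> (W u))\<^sup>2"
      using energy_bound[OF u u] by (simp add: power2_eq_square mult.assoc)
    also have "\<dots> \<le> K * (norm_H1 \<Omega> u)\<^sup>2"
      using K1 by (intro mult_left_mono power_mono norm_L2_le_norm_H1 norm_L2_nonneg) auto
    finally have "E.nrm u \<le> sqrt (K * (norm_H1 \<Omega> u)\<^sup>2)" unfolding E.nrm_def by (rule real_sqrt_le_mono)
    then show ?thesis using H1.nrm_nonneg[OF u] by (simp add: real_sqrt_mult)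
  qed
  show ?thesis
  proof
    fix X :: "nat \<Rightarrow> real^'n \<Rightarrow> real"
    assume X: "\<And>n. X n \<in> H10 \<Omega>" and Cau: "\<And>e. e > 0 \<Longrightarrow> \<exists>N. \<forall>m\<ge>N. \<forall>n\<ge>N. E.nrm (X m - X n) < e"
    have XH: "X n \<in> H1 \<Omega>" for n by (rule H10_H1[OF X])
    have "\<exists>u\<in>H1 \<Omega>. (\<lambda>n. norm_H1 \<Omega> (X n - u)) \<longlonglongrightarrow> 0"
    proof (rule H1_complete[OF XH])
      fix e :: real assume e: "e > 0"
      define c where "c = C * sqrt K"
      have c: "c > 0" using C K1 by (simp add: c_def)
      then have "e / c > 0" using e by simp
      from Cau[OF this] obtain N where N: "\<And>m n. m \<ge> N \<Longrightarrow> n \<ge> N \<Longrightarrow> E.nrm (X m - X n) < e / c" by blast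
      have "norm_H1 \<Omega> (X m - X n) < e" if "m \<ge> N" "n \<ge> N" for m n
      proof -
        have "norm_H1 \<Omega> (X m - X n) \<le> c * E.nrm (X m - X n)"
          using lower[OF E.V_diff[OF X X]] by (simp add: c_def mult.assoc)
        also have "\<dots> < e" using N[OF that] c by (simp add: field_simps)
        finally show ?thesis .
      qed
      then show "\<exists>N. \<forall>m\<ge>N. \<forall>n\<ge>N. norm_H1 \<Omega> (X m - X n) < e" by blast
    qed
    then obtain u where u: "u \<in> H1 \<Omega>" "(\<lambda>n. norm_H1 \<Omega> (X n - u)) \<longlonglongrightarrow> 0" by blast
    have uH: "u \<in> H10 \<Omega>"
      using H1.cl_closed[OF test_subset_H1, of X u] X u unfolding H10_eq_cl by blast
    have "(\<lambda>n. E.nrm (X n - u)) \<longlonglongrightarrow> 0"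
    proof (rule Lim_null_comparison)
      show "\<forall>\<^sub>F n in sequentially. norm (E.nrm (X n - u)) \<le> sqrt K * norm_H1 \<Omega> (X n - u)"
        using upper[OF H1.V_diff[OF XH u(1)]] E.nrm_nonneg[OF E.V_diff[OF X uH]] by (intro always_eventually) simp
      show "(\<lambda>n. sqrt K * norm_H1 \<Omega> (X n - u)) \<longlonglongrightarrow> 0" using tendsto_mult_left[OF u(2), of "sqrt K"] by simp
    qed
    with uH show "\<exists>u\<in>H10 \<Omega>. (\<lambda>n. E.nrm (X n - u)) \<longlonglongrightarrow> 0" by blast
  qed
qed

theorem Dirichlet_solvable:
  assumes F: "F \<in> Hm1 \<Omega>"
  shows "\<exists>w\<in>H10 \<Omega>. weak_solution \<Omega> \<sigma> F w"
proof -
  interpret E: semi_hilbert_space "H10 \<Omega>" "energy \<Omega> \<sigma>" by (rule energy_semi_hilbert_H10)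
  obtain C where C: "C > 0" "\<And>u. u \<in> H10 \<Omega> \<Longrightarrow> norm_H1 \<Omega> u \<le> C * norm_L2 \<Omega> (W u)" using Poincare by metis
  obtain B where B: "\<And>u. u \<in> H10 \<Omega> \<Longrightarrow> \<bar>F u\<bar> \<le> B * norm_H1 \<Omega> u" using F unfolding Hm1_def by blast
  have "\<exists>u\<in>H10 \<Omega>. \<forall>v\<in>H10 \<Omega>. F v = energy \<Omega> \<sigma> u v"
  proof (rule E.Riesz_representation[where C = "\<bar>B\<bar> * (C * sqrt K)"])
    show "F (x + y) = F x + F y" if "x \<in> H10 \<Omega>" "y \<in> H10 \<Omega>" for x y
      using F that by (simp add: Hm1_def plus_fun_def)
    show "F (c *\<^sub>R x) = c * F x" if "x \<in> H10 \<Omega>" for c x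
      using F that by (simp add: Hm1_def scaleR_fun_def)
    fix x assume x: "x \<in> H10 \<Omega>"
    have "norm_L2 \<Omega> (W x) \<le> sqrt (K * energy \<Omega> \<sigma> x x)"
      by (rule real_le_rsqrt[OF energy_coercive[OF H10_H1[OF x]]])
    then have "C * norm_L2 \<Omega> (W x) \<le> C * (sqrt K * E.nrm x)"
      using C(1) by (intro mult_left_mono) (simp_all add: E.nrm_def real_sqrt_mult)
    with C(2)[OF x] have n: "norm_H1 \<Omega> x \<le> C * (sqrt K * E.nrm x)" by linarith
    have "\<bar>F x\<bar> \<le> \<bar>B\<bar> * norm_H1 \<Omega> x"
      by (rule order_trans[OF B[OF x] mult_right_mono[OF abs_ge_self H1.nrm_nonneg[OF H10_H1[OF x]]]])
    also have "\<dots> \<le> \<bar>B\<bar> * (C * (sqrt K * E.nrm x))" by (rule mult_left_mono[OF n]) simp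
    finally show "\<bar>F x\<bar> \<le> \<bar>B\<bar> * (C * sqrt K) * E.nrm x" by (simp add: mult.assoc)
  qed
  then show ?thesis by (auto simp: weak_solution_def H10_H1)
qed

text \<open>
Coercivity bounds the square of the gradient by the energy, and Poincare's inequality absorbs one factor.
The constant depends on \<open>K\<close> and \<open>\<Omega>\<close> but not on \<open>\<sigma>\<close>.
\<close>

lemma Dirichlet_bound:
  assumes C: "C > 0" "\<And>u. u \<in> H10 \<Omega> \<Longrightarrow> norm_H1 \<Omega> u \<le> C * norm_L2 \<Omega> (W u)"
    and w: "w \<in> H10 \<Omega>" and B: "energy \<Omega> \<sigma> w w \<le> B * norm_H1 \<Omega> w" "B \<ge> 0"
  shows "norm_H1 \<Omega> w \<le> C * (K * B * C)"
proof -
  let ?g = "norm_L2 \<Omega> (W w)"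
  have "?g\<^sup>2 \<le> K * energy \<Omega> \<sigma> w w" by (rule energy_coercive[OF H10_H1[OF w]])
  also have "\<dots> \<le> K * (B * (C * ?g))"
    using order_trans[OF B(1) mult_left_mono[OF C(2)[OF w] B(2)]] K1 by (intro mult_left_mono) auto
  finally have "?g * ?g \<le> (K * B * C) * ?g" by (simp add: power2_eq_square mult_ac)
  moreover have "0 \<le> K * B * C" using K1 B(2) C(1) by simp
  ultimately have "?g \<le> K * B * C"
    using norm_L2_nonneg[of \<Omega> "W w"] by (cases "?g = 0") (auto simp: mult_le_cancel_right)
  then show ?thesis using C(2)[OF w] C(1) by (meson dual_order.trans mult_left_mono less_imp_le)
qed

end

lemma energy_in_Hm1:
  assumes \<sigma>: "\<sigma> \<in> M_K K \<Omega>" and u: "u \<in> H1 \<Omega>"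
  shows "energy \<Omega> \<sigma> u \<in> Hm1 \<Omega>"
proof -
  interpret E: semi_inner_space "H1 \<Omega>" "energy \<Omega> \<sigma>" by (rule energy_semi_inner[OF \<sigma>])
  have "energy \<Omega> \<sigma> u (\<lambda>x. v x + w x) = energy \<Omega> \<sigma> u v + energy \<Omega> \<sigma> u w" if "v \<in> H10 \<Omega>" "w \<in> H10 \<Omega>" for v w
    using E.ip_add_right[OF u H10_H1[OF that(1)] H10_H1[OF that(2)]] by (simp add: plus_fun_def)
  moreover have "energy \<Omega> \<sigma> u (\<lambda>x. c * v x) = c * energy \<Omega> \<sigma> u v" if "v \<in> H10 \<Omega>" for c v
    using E.ip_scale_right[OF u H10_H1[OF that], of c] by (simp add: scaleR_fun_def)
  moreover have "\<bar>energy \<Omega> \<sigma> u v\<bar> \<le> (K * norm_L2 \<Omega> (W u)) * norm_H1 \<Omega> v" if "v \<in> H10 \<Omega>" for v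
    by (rule order_trans[OF energy_bound[OF \<sigma> u H10_H1[OF that]] mult_left_mono[OF norm_L2_le_norm_H1(2)]])
       (use K1 norm_L2_nonneg[of \<Omega> "W u"] in simp)
  ultimately show ?thesis unfolding Hm1_def by blast
qed

section \<open>Cutoff fluxes\<close>

text \<open>
The integral of \<open>u (\<sigma> grad v) \<bullet> grad \<theta>\<close>: the term by which cutting off a test function with \<open>\<theta>\<close> changes the
equation for \<open>v\<close>. It depends on \<open>\<sigma>\<close> only where \<open>\<theta>\<close> is not constant.
\<close>

definition cutoff_flux :: "(real^'n \<Rightarrow> real^'n^'n) \<Rightarrow> (real^'n \<Rightarrow> real) \<Rightarrow> (real^'n \<Rightarrow> real) \<Rightarrow> (real^'n \<Rightarrow> real) \<Rightarrow> real" where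
  "cutoff_flux \<sigma> \<theta> u v = ipL2 \<Omega> (mat_app \<sigma> (W v)) (\<lambda>x. u x *\<^sub>R grad \<theta> x)"

lemma energy_cutoff:
  assumes \<sigma>: "\<sigma> \<in> M_K K \<Omega>" and u: "u \<in> H1 \<Omega>" and v: "v \<in> H1 \<Omega>" and \<theta>: "\<theta> \<in> test_functions \<Omega>"
  shows "energy \<Omega> \<sigma> v (\<lambda>x. \<theta> x * u x) = ipL2 \<Omega> (mat_app \<sigma> (W v)) (\<lambda>x. \<theta> x *\<^sub>R W u x) + cutoff_flux \<sigma> \<theta> u v"
proof -
  note wg = cutoff_has_weak_grad[OF u \<theta>]
  note a = mat_app_L2[OF \<sigma> weak_grad_L2[OF v]]
  have 1: "(\<lambda>x. \<theta> x *\<^sub>R W u x) \<in> L2 \<Omega>" by (rule test_scaleR_L2[OF \<theta> weak_grad_L2[OF u]])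
  have 2: "(\<lambda>x. u x *\<^sub>R grad \<theta> x) \<in> L2 \<Omega>" by (rule scaleR_grad_test_L2[OF \<theta> H1_L2[OF u]])
  have "energy \<Omega> \<sigma> v (\<lambda>x. \<theta> x * u x) = ipL2 \<Omega> (mat_app \<sigma> (W v)) (\<lambda>x. \<theta> x *\<^sub>R W u x + u x *\<^sub>R grad \<theta> x)"
    unfolding energy_eq[OF \<sigma>]
    by (intro ipL2_cong_AE a weak_grad_L2 has_weak_grad_H1[OF wg] has_weak_gradD(2)[OF wg] has_weak_grad_AE[OF wg]) simp
  also have "\<dots> = ipL2 \<Omega> (mat_app \<sigma> (W v)) ((\<lambda>x. \<theta> x *\<^sub>R W u x) + (\<lambda>x. u x *\<^sub>R grad \<theta> x))"
    by (simp add: plus_fun_def)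
  also have "\<dots> = ipL2 \<Omega> (mat_app \<sigma> (W v)) (\<lambda>x. \<theta> x *\<^sub>R W u x) + cutoff_flux \<sigma> \<theta> u v"
    unfolding cutoff_flux_def by (rule L2.ip_add_right[OF a 1 2])
  finally show ?thesis .
qed

lemma ip_mat_app_scaleR_commute:
  assumes \<sigma>: "\<sigma> \<in> M_K K \<Omega>" and f: "f \<in> L2 \<Omega>" and g: "g \<in> L2 \<Omega>"
    and cf: "(\<lambda>x. c x *\<^sub>R f x) \<in> L2 \<Omega>" and cg: "(\<lambda>x. c x *\<^sub>R g x) \<in> L2 \<Omega>"
  shows "ipL2 \<Omega> (mat_app \<sigma> f) (\<lambda>x. c x *\<^sub>R g x) = ipL2 \<Omega> (mat_app \<sigma> g) (\<lambda>x. c x *\<^sub>R f x)"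
  unfolding ipL2_def
proof (rule integral_cong_AE)
  show "AE x in \<mu>. mat_app \<sigma> f x \<bullet> (c x *\<^sub>R g x) = mat_app \<sigma> g x \<bullet> (c x *\<^sub>R f x)"
    using M_K_commute[OF \<sigma>] by eventually_elim (simp add: mat_app_def)
qed (intro borel_measurable_integrable integrable_inner_L2 mat_app_L2[OF \<sigma>] f g cf cg)+

text \<open>
Test the equation of each solution with \<open>\<theta>\<close> times the other one. The two terms that contain both
gradients agree by symmetry of \<open>\<sigma>\<close>.
\<close>

theorem Green_cutoff:
  assumes \<sigma>: "\<sigma> \<in> M_K K \<Omega>" and v: "weak_solution \<Omega> \<sigma> F v" and u: "weak_solution \<Omega> \<sigma> G u"
    and \<theta>: "\<theta> \<in> test_functions \<Omega>"
  shows "cutoff_flux \<sigma> \<theta> u v - cutoff_flux \<sigma> \<theta> v u = F (\<lambda>x. \<theta> x * u x) - G (\<lambda>x. \<theta> x * v x)"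
proof -
  have uH: "u \<in> H1 \<Omega>" and vH: "v \<in> H1 \<Omega>" using u v by (auto simp: weak_solution_def)
  have "F (\<lambda>x. \<theta> x * u x) = energy \<Omega> \<sigma> v (\<lambda>x. \<theta> x * u x)"
    "G (\<lambda>x. \<theta> x * v x) = energy \<Omega> \<sigma> u (\<lambda>x. \<theta> x * v x)"
    using u v cutoff_H10[OF uH \<theta>] cutoff_H10[OF vH \<theta>] by (auto simp: weak_solution_def)
  moreover have "ipL2 \<Omega> (mat_app \<sigma> (W v)) (\<lambda>x. \<theta> x *\<^sub>R W u x) = ipL2 \<Omega> (mat_app \<sigma> (W u)) (\<lambda>x. \<theta> x *\<^sub>R W v x)"
    by (intro ip_mat_app_scaleR_commute \<sigma> weak_grad_L2 uH vH test_scaleR_L2 \<theta>)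
  ultimately show ?thesis
    using energy_cutoff[OF \<sigma> uH vH \<theta>] energy_cutoff[OF \<sigma> vH uH \<theta>] by simp
qed

lemma layer_difference:
  assumes \<sigma>: "\<sigma> \<in> M_K K \<Omega>" and \<tau>: "\<tau> \<in> M_K K \<Omega>"
    and \<kappa>: "AE x in \<mu>. x \<in> A \<longrightarrow> norm (\<sigma> x - \<tau> x) \<le> \<kappa>" "\<kappa> \<ge> 0"
    and p: "p \<in> L2 \<Omega>" and q: "q \<in> L2 \<Omega>" and q0: "\<And>x. x \<in> \<Omega> \<Longrightarrow> x \<notin> A \<Longrightarrow> q x = 0"
  shows "\<bar>ipL2 \<Omega> (mat_app \<sigma> p) q - ipL2 \<Omega> (mat_app \<tau> p) q\<bar> \<le> \<kappa> * (norm_L2 \<Omega> p * norm_L2 \<Omega> q)"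
proof -
  note i = integrable_inner_L2[OF mat_app_L2[OF \<sigma> p] q] integrable_inner_L2[OF mat_app_L2[OF \<tau> p] q]
  have "AE x in \<mu>. x \<in> \<Omega>" by (intro AE_I2) simp
  with \<kappa>(1) have b: "AE x in \<mu>. norm (mat_app \<sigma> p x \<bullet> q x - mat_app \<tau> p x \<bullet> q x) \<le> \<kappa> * (norm (p x) * norm (q x))"
  proof eventually_elim
    case (elim x)
    show ?case
    proof (cases "x \<in> A")
      case True
      have "norm (mat_app \<sigma> p x \<bullet> q x - mat_app \<tau> p x \<bullet> q x) = \<bar>((\<sigma> x - \<tau> x) *v p x) \<bullet> q x\<bar>"
        by (simp add: mat_app_def inner_diff_left[symmetric] matrix_vector_mult_diff_rdistrib)
      also have "\<dots> \<le> norm ((\<sigma> x - \<tau> x) *v p x) * norm (q x)" by (rule Cauchy_Schwarz_ineq2)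
      also have "\<dots> \<le> (norm (\<sigma> x - \<tau> x) * norm (p x)) * norm (q x)"
        by (intro mult_right_mono norm_matrix_vector_le) simp
      also have "\<dots> \<le> (\<kappa> * norm (p x)) * norm (q x)" using elim True by (intro mult_right_mono) auto
      finally show ?thesis by (simp add: mult.assoc)
    next
      case False then show ?thesis using q0[of x] elim by simp
    qed
  qed
  have n: "(\<lambda>x. norm (p x)) \<in> L2 \<Omega>" "(\<lambda>x. norm (q x)) \<in> L2 \<Omega>"
    using p q by (auto simp: L2_def)
  have eq: "ipL2 \<Omega> (mat_app \<sigma> p) q - ipL2 \<Omega> (mat_app \<tau> p) q = (LINT x|\<mu>. mat_app \<sigma> p x \<bullet> q x - mat_app \<tau> p x \<bullet> q x)"
    unfolding ipL2_def using i by simp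
  have "\<bar>ipL2 \<Omega> (mat_app \<sigma> p) q - ipL2 \<Omega> (mat_app \<tau> p) q\<bar> \<le> (LINT x|\<mu>. norm (mat_app \<sigma> p x \<bullet> q x - mat_app \<tau> p x \<bullet> q x))"
    unfolding eq using integral_norm_bound[of \<mu> "\<lambda>x. mat_app \<sigma> p x \<bullet> q x - mat_app \<tau> p x \<bullet> q x"] by simp
  also have "\<dots> \<le> \<kappa> * ipL2 \<Omega> (\<lambda>x. norm (p x)) (\<lambda>x. norm (q x))"
  proof -
    have 1: "integrable \<mu> (\<lambda>x. norm (mat_app \<sigma> p x \<bullet> q x - mat_app \<tau> p x \<bullet> q x))"
      by (rule integrable_norm[OF Bochner_Integration.integrable_diff[OF i]])
    have 2: "integrable \<mu> (\<lambda>x. \<kappa> * (norm (p x) * norm (q x)))"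
      by (rule integrable_mult_right[OF integrable_norm_mult_L2[OF p q]])
    show ?thesis using integral_mono_AE[OF 1 2 b] by (simp add: ipL2_def)
  qed
  also have "\<dots> \<le> \<kappa> * (norm_L2 \<Omega> p * norm_L2 \<Omega> q)"
  proof (rule mult_left_mono[OF _ \<kappa>(2)])
    have "norm_L2 \<Omega> (\<lambda>x. norm (p x)) = norm_L2 \<Omega> p" "norm_L2 \<Omega> (\<lambda>x. norm (q x)) = norm_L2 \<Omega> q"
      by (simp_all add: norm_L2_def)
    then show "ipL2 \<Omega> (\<lambda>x. norm (p x)) (\<lambda>x. norm (q x)) \<le> norm_L2 \<Omega> p * norm_L2 \<Omega> q"
      using L2.ip_Cauchy_Schwarz[OF n] by simp
  qed
  finally show ?thesis .
qed

lemma norm_scaleR_grad_le: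
  assumes \<theta>: "\<theta> \<in> test_functions \<Omega>" and u: "u \<in> L2 \<Omega>" and B: "\<And>x. norm (grad \<theta> x) \<le> B"
  shows "norm_L2 \<Omega> (\<lambda>x. u x *\<^sub>R grad \<theta> x) \<le> B * norm_L2 \<Omega> u"
proof (rule L2_dominated(2)[OF u L2_measurable[OF scaleR_grad_test_L2[OF \<theta> u]]])
  show "B \<ge> 0" by (rule order_trans[OF norm_ge_zero B])
  show "AE x in \<mu>. norm (u x *\<^sub>R grad \<theta> x) \<le> B * norm (u x)"
    using B by (intro AE_I2) (simp add: mult.commute[of B] mult_left_mono)
qed

lemma cutoff_flux_layer_difference:
  assumes \<sigma>: "\<sigma> \<in> M_K K \<Omega>" and \<tau>: "\<tau> \<in> M_K K \<Omega>" and \<theta>: "\<theta> \<in> test_functions \<Omega>"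
    and \<kappa>: "AE x in \<mu>. x \<in> A \<longrightarrow> norm (\<sigma> x - \<tau> x) \<le> \<kappa>" "\<kappa> \<ge> 0"
    and \<theta>0: "\<And>x. x \<in> \<Omega> \<Longrightarrow> x \<notin> A \<Longrightarrow> grad \<theta> x = 0" and B: "\<And>x. norm (grad \<theta> x) \<le> B"
    and u: "u \<in> H1 \<Omega>" "norm_H1 \<Omega> u \<le> R" and v: "v \<in> H1 \<Omega>" "norm_H1 \<Omega> v \<le> R'"
  shows "\<bar>cutoff_flux \<sigma> \<theta> u v - cutoff_flux \<tau> \<theta> u v\<bar> \<le> \<kappa> * B * (R * R')"
proof -
  have B0: "B \<ge> 0" by (rule order_trans[OF norm_ge_zero B])
  have R0: "R \<ge> 0" "R' \<ge> 0" using u v H1.nrm_nonneg by (meson order_trans)+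
  have "\<bar>cutoff_flux \<sigma> \<theta> u v - cutoff_flux \<tau> \<theta> u v\<bar> \<le> \<kappa> * (norm_L2 \<Omega> (W v) * norm_L2 \<Omega> (\<lambda>x. u x *\<^sub>R grad \<theta> x))"
    unfolding cutoff_flux_def
    by (rule layer_difference[OF \<sigma> \<tau> \<kappa> weak_grad_L2[OF v(1)] scaleR_grad_test_L2[OF \<theta> H1_L2[OF u(1)]]])
       (simp add: \<theta>0)
  also have "\<dots> \<le> \<kappa> * (R' * (B * R))"
  proof (intro mult_left_mono mult_mono \<kappa>(2) R0 norm_L2_nonneg)
    show "norm_L2 \<Omega> (W v) \<le> R'" by (rule order_trans[OF norm_L2_le_norm_H1(2) v(2)])
    show "norm_L2 \<Omega> (\<lambda>x. u x *\<^sub>R grad \<theta> x) \<le> B * R"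
      by (rule order_trans[OF norm_scaleR_grad_le[OF \<theta> H1_L2[OF u(1)] B] mult_left_mono[OF order_trans[OF norm_L2_le_norm_H1(1) u(2)] B0]])
  qed
  finally show ?thesis by (simp add: mult_ac)
qed

section \<open>Weak convergence\<close>

text \<open>
Weak convergence in \<open>H1\<close>, with functions and gradients paired separately, as integrals over \<open>\<Omega>\<close> pair them.
\<close>

definition wconv :: "(nat \<Rightarrow> real^'n \<Rightarrow> real) \<Rightarrow> (real^'n \<Rightarrow> real) \<Rightarrow> bool" where
  "wconv X u \<longleftrightarrow> (\<forall>h\<in>L2 \<Omega>. (\<lambda>n. ipL2 \<Omega> (X n) h) \<longlonglongrightarrow> ipL2 \<Omega> u h) \<and>
     (\<forall>h\<in>L2 \<Omega>. (\<lambda>n. ipL2 \<Omega> (W (X n)) h) \<longlonglongrightarrow> ipL2 \<Omega> (W u) h)"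

lemma wconvD:
  assumes "wconv X u"
  shows "h \<in> L2 \<Omega> \<Longrightarrow> (\<lambda>n. ipL2 \<Omega> (X n) h) \<longlonglongrightarrow> ipL2 \<Omega> u h"
    and "g \<in> L2 \<Omega> \<Longrightarrow> (\<lambda>n. ipL2 \<Omega> (W (X n)) g) \<longlonglongrightarrow> ipL2 \<Omega> (W u) g"
  using assms by (auto simp: wconv_def)

lemma wconv_subseq: "wconv X u \<Longrightarrow> strict_mono r \<Longrightarrow> wconv (X \<circ> r) u"
  unfolding wconv_def using LIMSEQ_subseq_LIMSEQ by (force simp: o_def)

lemma wconv_const: "wconv (\<lambda>_. u) u"
  by (simp add: wconv_def)

lemma wconvI:
  assumes "\<And>h g. h \<in> L2 \<Omega> \<Longrightarrow> g \<in> L2 \<Omega> \<Longrightarrow>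
    (\<lambda>n. ipL2 \<Omega> (X n) h + ipL2 \<Omega> (W (X n)) g) \<longlonglongrightarrow> ipL2 \<Omega> u h + ipL2 \<Omega> (W u) g"
  shows "wconv X u"
proof -
  have z: "ipL2 \<Omega> f (\<lambda>x. 0) = 0" for f :: "real^'n \<Rightarrow> 'b::euclidean_space" by (simp add: ipL2_def)
  show ?thesis
    unfolding wconv_def using assms[OF _ L2_zero] assms[OF L2_zero] by (simp add: z)
qed

text \<open>
These functionals connect \<open>wconv\<close> with weak convergence in the Hilbert space \<open>H1\<close> and, through
\<open>pairing_in_Hm1\<close>, with the weak convergence that defines G-convergence.
\<close>

lemma pairing_bounded_linear:
  assumes h: "h \<in> L2 \<Omega>" and g: "g \<in> L2 \<Omega>"
  defines "L \<equiv> \<lambda>v. ipL2 \<Omega> v h + ipL2 \<Omega> (W v) g"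
  shows "x \<in> H1 \<Omega> \<Longrightarrow> y \<in> H1 \<Omega> \<Longrightarrow> L (x + y) = L x + L y"
    and "x \<in> H1 \<Omega> \<Longrightarrow> L (c *\<^sub>R x) = c * L x"
    and "x \<in> H1 \<Omega> \<Longrightarrow> \<bar>L x\<bar> \<le> (norm_L2 \<Omega> h + norm_L2 \<Omega> g) * norm_H1 \<Omega> x"
proof -
  show "L (x + y) = L x + L y" if x: "x \<in> H1 \<Omega>" and y: "y \<in> H1 \<Omega>"
    using ipL2_weak_grad_add[OF x y g] L2.ip_add_left[OF H1_L2[OF x] H1_L2[OF y] h] by (simp add: L_def)
  show "L (c *\<^sub>R x) = c * L x" if x: "x \<in> H1 \<Omega>"
    using ipL2_weak_grad_scale[OF x g, of c] L2.ip_scale_left[OF H1_L2[OF x] h, of c] by (simp add: L_def distrib_left)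
  assume x: "x \<in> H1 \<Omega>"
  have "\<bar>ipL2 \<Omega> x h\<bar> \<le> norm_H1 \<Omega> x * norm_L2 \<Omega> h"
    by (rule order_trans[OF L2.ip_Cauchy_Schwarz[OF H1_L2[OF x] h] mult_right_mono[OF norm_L2_le_norm_H1(1) norm_L2_nonneg]])
  moreover have "\<bar>ipL2 \<Omega> (W x) g\<bar> \<le> norm_H1 \<Omega> x * norm_L2 \<Omega> g"
    by (rule order_trans[OF L2.ip_Cauchy_Schwarz[OF weak_grad_L2[OF x] g] mult_right_mono[OF norm_L2_le_norm_H1(2) norm_L2_nonneg]])
  ultimately show "\<bar>L x\<bar> \<le> (norm_L2 \<Omega> h + norm_L2 \<Omega> g) * norm_H1 \<Omega> x"
    by (simp add: L_def algebra_simps)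
qed

lemma pairing_in_Hm1:
  assumes h: "h \<in> L2 \<Omega>" and g: "g \<in> L2 \<Omega>"
  shows "(\<lambda>v. ipL2 \<Omega> v h + ipL2 \<Omega> (W v) g) \<in> Hm1 \<Omega>" (is "?L \<in> _")
proof -
  note L = pairing_bounded_linear[OF h g]
  have "?L (\<lambda>x. u x + v x) = ?L u + ?L v" if "u \<in> H10 \<Omega>" "v \<in> H10 \<Omega>" for u v
    using L(1)[OF H10_H1[OF that(1)] H10_H1[OF that(2)]] by (simp add: plus_fun_def)
  moreover have "?L (\<lambda>x. c * u x) = c * ?L u" if "u \<in> H10 \<Omega>" for c u
    using L(2)[OF H10_H1[OF that], of c] by (simp add: scaleR_fun_def)
  ultimately show ?thesis unfolding Hm1_def using L(3)[OF H10_H1] by blast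
qed

lemma H1_bounded_wconv_subseq:
  assumes X: "\<And>n. X n \<in> H1 \<Omega>" and R: "\<And>n. norm_H1 \<Omega> (X n) \<le> R"
  obtains r u where "strict_mono (r :: nat \<Rightarrow> nat)" "u \<in> H1 \<Omega>" "wconv (X \<circ> r) u"
proof -
  obtain r u where r: "strict_mono (r :: nat \<Rightarrow> nat)" and u: "u \<in> H1 \<Omega>"
    and lim: "\<forall>y\<in>H1 \<Omega>. (\<lambda>k. ipH1 (X (r k)) y) \<longlonglongrightarrow> ipH1 u y"
    using H1.weakly_convergent_subsequence[of X R, OF X R] by blast
  have lim2: "(\<lambda>n. ipL2 \<Omega> (X (r n)) h + ipL2 \<Omega> (W (X (r n))) g) \<longlonglongrightarrow> ipL2 \<Omega> u h + ipL2 \<Omega> (W u) g"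
    if h: "h \<in> L2 \<Omega>" and g: "g \<in> L2 \<Omega>" for h g
  proof -
    note L = pairing_bounded_linear[OF h g]
    obtain w where w: "w \<in> H1 \<Omega>" "\<And>v. v \<in> H1 \<Omega> \<Longrightarrow> ipL2 \<Omega> v h + ipL2 \<Omega> (W v) g = ipH1 w v"
      using H1.Riesz_representation[OF L] by blast
    have "(\<lambda>n. ipH1 w (X (r n))) \<longlonglongrightarrow> ipH1 w u"
      using lim w(1) H1.ip_commute[OF w(1) X] H1.ip_commute[OF w(1) u] by simp
    then show ?thesis using w(2)[OF X] w(2)[OF u] by simp
  qed
  have "wconv (X \<circ> r) u"
    by (rule wconvI) (simp add: lim2)
  with r u show thesis by (rule that)
qed

lemma cutoff_norm_bound:
  assumes \<theta>: "\<theta> \<in> test_functions \<Omega>"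
  obtains B where "\<And>u. u \<in> H1 \<Omega> \<Longrightarrow> norm_H1 \<Omega> (\<lambda>x. \<theta> x * u x) \<le> B * norm_H1 \<Omega> u"
proof -
  obtain b where b: "b > 0" "\<And>x. \<bar>\<theta> x\<bar> \<le> b" using test_bounded[OF \<theta>] by metis
  obtain b' where b': "b' > 0" "\<And>x. norm (grad \<theta> x) \<le> b'" using test_bounded_grad[OF \<theta>] by metis
  have "norm_H1 \<Omega> (\<lambda>x. \<theta> x * u x) \<le> (2 * b + b') * norm_H1 \<Omega> u" if u: "u \<in> H1 \<Omega>" for u
  proof -
    have 1: "norm_L2 \<Omega> (\<lambda>x. \<theta> x *\<^sub>R g x) \<le> b * norm_L2 \<Omega> g" if g: "g \<in> L2 \<Omega>" for g :: "real^'n \<Rightarrow> 'c::euclidean_space"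
    proof (rule L2_dominated(2)[OF g L2_measurable[OF test_scaleR_L2[OF \<theta> g]]])
      show "AE x in \<mu>. norm (\<theta> x *\<^sub>R g x) \<le> b * norm (g x)"
        using b by (intro AE_I2) (simp add: mult_right_mono)
    qed (use b in simp)
    have "norm_H1 \<Omega> (\<lambda>x. \<theta> x * u x) \<le> norm_L2 \<Omega> (\<lambda>x. \<theta> x * u x) + norm_L2 \<Omega> (\<lambda>x. \<theta> x *\<^sub>R W u x + u x *\<^sub>R grad \<theta> x)"
      by (rule norm_H1_le_sum[OF cutoff_has_weak_grad[OF u \<theta>]])
    also have "norm_L2 \<Omega> (\<lambda>x. \<theta> x *\<^sub>R W u x + u x *\<^sub>R grad \<theta> x) \<le> norm_L2 \<Omega> (\<lambda>x. \<theta> x *\<^sub>R W u x) + norm_L2 \<Omega> (\<lambda>x. u x *\<^sub>R grad \<theta> x)"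
      by (intro norm_L2_triangle test_scaleR_L2 \<theta> weak_grad_L2 u scaleR_grad_test_L2 H1_L2)
    also have "norm_L2 \<Omega> (\<lambda>x. \<theta> x * u x) \<le> b * norm_H1 \<Omega> u"
      using order_trans[OF 1[OF H1_L2[OF u]] mult_left_mono[OF norm_L2_le_norm_H1(1) less_imp_le[OF b(1)]]]
      unfolding real_scaleR_def .
    also have "norm_L2 \<Omega> (\<lambda>x. \<theta> x *\<^sub>R W u x) \<le> b * norm_H1 \<Omega> u"
      by (rule order_trans[OF 1[OF weak_grad_L2[OF u]] mult_left_mono[OF norm_L2_le_norm_H1(2) less_imp_le[OF b(1)]]])
    also have "norm_L2 \<Omega> (\<lambda>x. u x *\<^sub>R grad \<theta> x) \<le> b' * norm_H1 \<Omega> u"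
      by (rule order_trans[OF norm_scaleR_grad_le[OF \<theta> H1_L2[OF u] b'(2)]
        mult_left_mono[OF norm_L2_le_norm_H1(1) less_imp_le[OF b'(1)]]])
    finally show ?thesis by (simp add: algebra_simps)
  qed
  then show thesis by (rule that)
qed

text \<open>
Every component is a difference of members of \<open>H1\<close> times a derivative of \<open>\<theta>\<close>, hence in \<open>H10\<close>, so that
Rellich's theorem applies although nothing is known at the boundary.
\<close>

lemma wconv_cutoff_strong:
  assumes X: "\<And>n. X n \<in> H1 \<Omega>" and R: "\<And>n. norm_H1 \<Omega> (X n) \<le> R"
    and u: "u \<in> H1 \<Omega>" and lim: "wconv X u" and \<theta>: "\<theta> \<in> test_functions \<Omega>"
  shows "(\<lambda>n. norm_L2 \<Omega> (\<lambda>x. (X n - u) x *\<^sub>R grad \<theta> x)) \<longlonglongrightarrow> 0"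
proof -
  have dH: "X n - u \<in> H1 \<Omega>" for n by (rule H1.V_diff[OF X u])
  have dR: "norm_H1 \<Omega> (X n - u) \<le> R + norm_H1 \<Omega> u" for n
    using H1.nrm_triangle[OF X H1.V_uminus[OF u], of n] R[of n] H1.nrm_scale[OF u, of "-1"] by simp
  define f where "f i n x = partial_deriv i \<theta> x * (X n - u) x" for i n x
  have fn: "(\<lambda>n. norm_L2 \<Omega> (f i n)) \<longlonglongrightarrow> 0" for i
  proof -
    have t: "partial_deriv i \<theta> \<in> test_functions \<Omega>" by (rule test_partial[OF \<theta>])
    obtain B where B: "\<And>u. u \<in> H1 \<Omega> \<Longrightarrow> norm_H1 \<Omega> (\<lambda>x. partial_deriv i \<theta> x * u x) \<le> B * norm_H1 \<Omega> u"
      using cutoff_norm_bound[OF t] by blast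
    show ?thesis
    proof (rule Rellich[where R = "\<bar>B\<bar> * (R + norm_H1 \<Omega> u)"])
      show "f i n \<in> H10 \<Omega>" for n unfolding f_def by (rule cutoff_H10[OF dH t])
      show "norm_H1 \<Omega> (f i n) \<le> \<bar>B\<bar> * (R + norm_H1 \<Omega> u)" for n
      proof -
        have "norm_H1 \<Omega> (f i n) \<le> B * norm_H1 \<Omega> (X n - u)" unfolding f_def by (rule B[OF dH])
        also have "\<dots> \<le> \<bar>B\<bar> * norm_H1 \<Omega> (X n - u)" by (rule mult_right_mono[OF abs_ge_self H1.nrm_nonneg[OF dH]])
        also have "\<dots> \<le> \<bar>B\<bar> * (R + norm_H1 \<Omega> u)" by (rule mult_left_mono[OF dR abs_ge_zero])
        finally show ?thesis .
      qed
      fix h :: "real^'n \<Rightarrow> real" assume h: "h \<in> L2 \<Omega>"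
      let ?h = "\<lambda>x. partial_deriv i \<theta> x * h x"
      have hL: "?h \<in> L2 \<Omega>" using test_scaleR_L2[OF t h] by simp
      have "ipL2 \<Omega> (f i n) h = ipL2 \<Omega> (X n - u) ?h" for n
        by (simp add: ipL2_def f_def mult_ac)
      also have "\<dots> n = ipL2 \<Omega> (X n) ?h - ipL2 \<Omega> u ?h" for n
        by (rule L2.ip_diff_left[OF H1_L2[OF X] H1_L2[OF u] hL])
      finally show "(\<lambda>n. ipL2 \<Omega> (f i n) h) \<longlonglongrightarrow> 0"
        using wconvD(1)[OF lim hL] by (simp add: LIM_zero_iff)
    qed
  qed
  have fL: "f i n \<in> L2 \<Omega>" for i n unfolding f_def using test_scaleR_L2[OF test_partial[OF \<theta>] H1_L2[OF dH]] by simp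
  show ?thesis
  proof (rule Lim_null_comparison)
    have eq: "(\<lambda>x. (X n - u) x *\<^sub>R grad \<theta> x) = (\<lambda>x. \<chi> i. f i n x)" for n
      by (simp add: fun_eq_iff vec_eq_iff grad_nth f_def mult.commute)
    show "\<forall>\<^sub>F n in sequentially. norm (norm_L2 \<Omega> (\<lambda>x. (X n - u) x *\<^sub>R grad \<theta> x)) \<le> (\<Sum>i\<in>UNIV. norm_L2 \<Omega> (f i n))"
    proof (rule always_eventually, rule allI)
      fix n
      have "norm_L2 \<Omega> (\<lambda>x. \<chi> i. f i n x) \<le> (\<Sum>i\<in>UNIV. norm_L2 \<Omega> (f i n))" by (rule L2_vec(2)[OF fL])
      then show "norm (norm_L2 \<Omega> (\<lambda>x. (X n - u) x *\<^sub>R grad \<theta> x)) \<le> (\<Sum>i\<in>UNIV. norm_L2 \<Omega> (f i n))"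
        unfolding eq using norm_L2_nonneg[of \<Omega> "\<lambda>x. \<chi> i. f i n x"] by simp
    qed
    show "(\<lambda>n. \<Sum>i\<in>UNIV. norm_L2 \<Omega> (f i n)) \<longlonglongrightarrow> 0" using tendsto_sum[of UNIV "\<lambda>i n. norm_L2 \<Omega> (f i n)" "\<lambda>_. 0", OF fn] by simp
  qed
qed

text \<open>
A product of a strongly and a weakly convergent factor: \<open>X n\<close> times \<open>grad \<theta>\<close>, and the flux of \<open>Y n\<close>.
\<close>

theorem cutoff_flux_continuous:
  assumes \<sigma>: "\<sigma> \<in> M_K K \<Omega>" and \<theta>: "\<theta> \<in> test_functions \<Omega>"
    and X: "\<And>n. X n \<in> H1 \<Omega>" "\<And>n. norm_H1 \<Omega> (X n) \<le> R" "u \<in> H1 \<Omega>" "wconv X u"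
    and Y: "\<And>n. Y n \<in> H1 \<Omega>" "\<And>n. norm_H1 \<Omega> (Y n) \<le> R'" "v \<in> H1 \<Omega>" "wconv Y v"
  shows "(\<lambda>n. cutoff_flux \<sigma> \<theta> (X n) (Y n)) \<longlonglongrightarrow> cutoff_flux \<sigma> \<theta> u v"
proof -
  let ?d = "\<lambda>n x. (X n - u) x *\<^sub>R grad \<theta> x" and ?u = "\<lambda>x. u x *\<^sub>R grad \<theta> x"
  have dL: "?d n \<in> L2 \<Omega>" for n by (rule scaleR_grad_test_L2[OF \<theta> H1_L2[OF H1.V_diff[OF X(1,3)]]])
  have uL: "?u \<in> L2 \<Omega>" by (rule scaleR_grad_test_L2[OF \<theta> H1_L2[OF X(3)]])
  have aL: "mat_app \<sigma> (W (Y n)) \<in> L2 \<Omega>" for n by (rule mat_app_L2[OF \<sigma> weak_grad_L2[OF Y(1)]])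
  have split: "cutoff_flux \<sigma> \<theta> (X n) (Y n) = ipL2 \<Omega> (mat_app \<sigma> (W (Y n))) (?d n) + ipL2 \<Omega> (mat_app \<sigma> (W (Y n))) ?u" for n
  proof -
    have "(\<lambda>x. X n x *\<^sub>R grad \<theta> x) = ?d n + ?u"
      by (simp add: fun_eq_iff scaleR_diff_left)
    then show ?thesis unfolding cutoff_flux_def by (simp only: L2.ip_add_right[OF aL dL uL])
  qed
  have 1: "(\<lambda>n. ipL2 \<Omega> (mat_app \<sigma> (W (Y n))) (?d n)) \<longlonglongrightarrow> 0"
  proof (rule Lim_null_comparison)
    show "\<forall>\<^sub>F n in sequentially. norm (ipL2 \<Omega> (mat_app \<sigma> (W (Y n))) (?d n)) \<le> K * R' * norm_L2 \<Omega> (?d n)"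
    proof (rule always_eventually, rule allI)
      fix n
      have "\<bar>ipL2 \<Omega> (mat_app \<sigma> (W (Y n))) (?d n)\<bar> \<le> K * norm_L2 \<Omega> (W (Y n)) * norm_L2 \<Omega> (?d n)"
        by (rule ip_mat_app_bound[OF \<sigma> weak_grad_L2[OF Y(1)] dL])
      also have "\<dots> \<le> K * R' * norm_L2 \<Omega> (?d n)"
        using K1 order_trans[OF norm_L2_le_norm_H1(2) Y(2)[of n]] by (intro mult_right_mono mult_left_mono norm_L2_nonneg) auto
      finally show "norm (ipL2 \<Omega> (mat_app \<sigma> (W (Y n))) (?d n)) \<le> K * R' * norm_L2 \<Omega> (?d n)" by simp
    qed
    show "(\<lambda>n. K * R' * norm_L2 \<Omega> (?d n)) \<longlonglongrightarrow> 0"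
      using tendsto_mult_left[OF wconv_cutoff_strong[OF X \<theta>], of "K * R'"] by simp
  qed
  have c: "ipL2 \<Omega> (mat_app \<sigma> (W y)) ?u = ipL2 \<Omega> (W y) (mat_app \<sigma> ?u)" if "y \<in> H1 \<Omega>" for y
    unfolding ip_mat_app_commute[OF \<sigma> weak_grad_L2[OF that] uL]
    by (rule L2.ip_commute[OF mat_app_L2[OF \<sigma> uL] weak_grad_L2[OF that]])
  have 2: "(\<lambda>n. ipL2 \<Omega> (mat_app \<sigma> (W (Y n))) ?u) \<longlonglongrightarrow> ipL2 \<Omega> (mat_app \<sigma> (W v)) ?u"
    unfolding c[OF Y(1)] c[OF Y(3)] by (rule wconvD(2)[OF Y(4) mat_app_L2[OF \<sigma> uL]])
  show ?thesis unfolding split using tendsto_add[OF 1 2] by (simp add: cutoff_flux_def)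
qed

end

section \<open>Limits of solutions under G-convergence\<close>

text \<open>
The hypotheses of the theorem in the form in which the argument uses them; both are inherited by
subsequences.
\<close>

locale G_convergent_sequence = elliptic \<Omega> K for \<Omega> :: "(real^'n) set" and K +
  fixes S :: "nat \<Rightarrow> real^'n \<Rightarrow> real^'n^'n" and \<sigma> :: "real^'n \<Rightarrow> real^'n^'n"
  assumes S_M_K: "\<And>n. S n \<in> M_K K \<Omega>" and \<sigma>_M_K: "\<sigma> \<in> M_K K \<Omega>"
    and layer: "\<And>e. e > 0 \<Longrightarrow> \<exists>\<delta>0>0. \<forall>\<delta>. 0 < \<delta> \<longrightarrow> \<delta> < \<delta>0 \<longrightarrow>
      (\<forall>\<^sub>F n in sequentially. AE x in lebesgue_on \<Omega>. x \<in> boundary_layer \<Omega> \<delta> \<longrightarrow> norm (S n x - \<sigma> x) \<le> e * \<delta>)"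
    and G: "\<And>F w. F \<in> Hm1 \<Omega> \<Longrightarrow> w \<in> H10 \<Omega> \<Longrightarrow> weak_solution \<Omega> \<sigma> F w \<Longrightarrow>
      \<exists>z. (\<forall>n. z n \<in> H10 \<Omega> \<and> weak_solution \<Omega> (S n) F (z n)) \<and> weakly_converges_H10 \<Omega> z w"
begin

lemma subsequence:
  assumes r: "strict_mono r" shows "G_convergent_sequence \<Omega> K (S \<circ> r) \<sigma>"
proof
  show "(S \<circ> r) n \<in> M_K K \<Omega>" for n by (simp add: S_M_K)
  show "\<sigma> \<in> M_K K \<Omega>" by (rule \<sigma>_M_K)
  have ev: "\<forall>\<^sub>F n in sequentially. Q (r n)" if "\<forall>\<^sub>F n in sequentially. Q n" for Q
    using eventually_subseq[OF r that] .
  show "\<exists>\<delta>0>0. \<forall>\<delta>. 0 < \<delta> \<longrightarrow> \<delta> < \<delta>0 \<longrightarrow>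
      (\<forall>\<^sub>F n in sequentially. AE x in lebesgue_on \<Omega>. x \<in> boundary_layer \<Omega> \<delta> \<longrightarrow> norm ((S \<circ> r) n x - \<sigma> x) \<le> e * \<delta>)"
    if e: "e > 0" for e
  proof -
    obtain \<delta>0 where \<delta>0: "\<delta>0 > 0" "\<And>\<delta>. 0 < \<delta> \<Longrightarrow> \<delta> < \<delta>0 \<Longrightarrow>
      (\<forall>\<^sub>F n in sequentially. AE x in \<mu>. x \<in> boundary_layer \<Omega> \<delta> \<longrightarrow> norm (S n x - \<sigma> x) \<le> e * \<delta>)"
      using layer[OF e] by blast
    show ?thesis
      unfolding o_def by (intro exI[of _ \<delta>0] conjI \<delta>0(1) allI impI ev[OF \<delta>0(2)])
  qed
  fix F w assume "F \<in> Hm1 \<Omega>" "w \<in> H10 \<Omega>" "weak_solution \<Omega> \<sigma> F w"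
  from G[OF this] obtain z where z: "\<And>n. z n \<in> H10 \<Omega> \<and> weak_solution \<Omega> (S n) F (z n)" "weakly_converges_H10 \<Omega> z w"
    by blast
  have "weakly_converges_H10 \<Omega> (z \<circ> r) w"
    unfolding weakly_converges_H10_def
  proof
    fix L assume "L \<in> Hm1 \<Omega>"
    then have "(\<lambda>n. L (z n)) \<longlonglongrightarrow> L w" using z(2) by (simp add: weakly_converges_H10_def)
    from LIMSEQ_subseq_LIMSEQ[OF this r] show "(\<lambda>n. L ((z \<circ> r) n)) \<longlonglongrightarrow> L w" by (simp add: o_def)
  qed
  then show "\<exists>z. (\<forall>n. z n \<in> H10 \<Omega> \<and> weak_solution \<Omega> ((S \<circ> r) n) F (z n)) \<and> weakly_converges_H10 \<Omega> z w"
    using z(1) by (intro exI[of _ "z \<circ> r"]) simp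
qed

lemma weakly_converges_H10_wconv:
  assumes z: "weakly_converges_H10 \<Omega> z w"
  shows "wconv z w"
proof (rule wconvI)
  fix h :: "real^'n \<Rightarrow> real" and g :: "real^'n \<Rightarrow> real^'n"
  assume h: "h \<in> L2 \<Omega>" and g: "g \<in> L2 \<Omega>"
  from bspec[OF z[unfolded weakly_converges_H10_def] pairing_in_Hm1[OF h g]]
  show "(\<lambda>n. ipL2 \<Omega> (z n) h + ipL2 \<Omega> (W (z n)) g) \<longlonglongrightarrow> ipL2 \<Omega> w h + ipL2 \<Omega> (W w) g" .
qed

text \<open>
Let \<open>F\<close> be the functional \<open>energy \<Omega> \<sigma> \<phi>\<close> and \<open>z n\<close> the solution in \<open>H10\<close> for \<open>F\<close> and \<open>S n\<close>, so that \<open>z n\<close> tends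
weakly to \<open>\<phi>\<close>. By \<open>Green_cutoff\<close>, \<open>F\<close> at \<open>\<theta>\<close> times \<open>u n\<close> is an antisymmetric expression in the cutoff fluxes
of \<open>u n\<close> and \<open>z n\<close>. In a thin layer \<open>S n\<close> may be replaced by \<open>\<sigma>\<close> there, and the result tends to \<open>0\<close> because
the layer avoids the support of \<open>\<phi>\<close>.
\<close>

lemma harmonic_limit_tested:
  assumes u: "\<And>n. weak_solution \<Omega> (S n) (\<lambda>_. 0) (u n)" and R: "\<And>n. norm_H1 \<Omega> (u n) \<le> R"
    and u0: "u0 \<in> H1 \<Omega>" and lim: "wconv u u0" and \<phi>: "\<phi> \<in> test_functions \<Omega>"
  shows "energy \<Omega> \<sigma> \<phi> u0 = 0"
proof -
  have uH: "u n \<in> H1 \<Omega>" for n using u by (simp add: weak_solution_def)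
  have R0: "R \<ge> 0" by (rule order_trans[OF H1.nrm_nonneg[OF uH] R])
  note \<phi>H = test_H1[OF \<phi>]
  let ?F = "energy \<Omega> \<sigma> \<phi>"
  have F: "?F \<in> Hm1 \<Omega>" by (rule energy_in_Hm1[OF \<sigma>_M_K \<phi>H])
  have "weak_solution \<Omega> \<sigma> ?F \<phi>" by (simp add: weak_solution_def \<phi>H)
  from G[OF F test_H10[OF \<phi>] this] obtain z where
    zH: "\<And>n. z n \<in> H10 \<Omega>" and z: "\<And>n. weak_solution \<Omega> (S n) ?F (z n)" and zw: "weakly_converges_H10 \<Omega> z \<phi>"
    by blast
  have zH1: "z n \<in> H1 \<Omega>" for n by (rule H10_H1[OF zH])
  have zc: "wconv z \<phi>" by (rule weakly_converges_H10_wconv[OF zw])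
  obtain M where M: "\<And>n. norm_H1 \<Omega> (z n) \<le> M"
  proof -
    obtain C where C: "C > 0" "\<And>u. u \<in> H10 \<Omega> \<Longrightarrow> norm_H1 \<Omega> u \<le> C * norm_L2 \<Omega> (W u)" using Poincare by metis
    have B: "K * norm_L2 \<Omega> (W \<phi>) \<ge> 0" using K1 norm_L2_nonneg[of \<Omega> "W \<phi>"] by simp
    have "energy \<Omega> (S n) (z n) (z n) \<le> (K * norm_L2 \<Omega> (W \<phi>)) * norm_H1 \<Omega> (z n)" for n
    proof -
      have "energy \<Omega> (S n) (z n) (z n) = ?F (z n)" using z zH by (simp add: weak_solution_def)
      also have "\<dots> \<le> K * norm_L2 \<Omega> (W \<phi>) * norm_L2 \<Omega> (W (z n))"
        using energy_bound[OF \<sigma>_M_K \<phi>H zH1, of n] by simp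
      also have "\<dots> \<le> (K * norm_L2 \<Omega> (W \<phi>)) * norm_H1 \<Omega> (z n)"
        by (rule mult_left_mono[OF norm_L2_le_norm_H1(2) B])
      finally show ?thesis .
    qed
    then show thesis using Dirichlet_bound[OF S_M_K C zH _ B] that by blast
  qed
  have M0: "M \<ge> 0" by (rule order_trans[OF H1.nrm_nonneg[OF zH1] M])
  obtain T where T: "compact T" "T \<subseteq> \<Omega>" "\<And>x. x \<notin> T \<Longrightarrow> \<phi> x = 0" "\<And>x i. x \<notin> T \<Longrightarrow> partial_deriv i \<phi> x = 0"
    using test_functionsE[OF \<phi>] by metis
  obtain \<delta>1 where \<delta>1: "\<delta>1 > 0" "\<And>\<delta>. \<delta> \<le> \<delta>1 \<Longrightarrow> T \<inter> boundary_layer \<Omega> \<delta> = {}"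
    using compact_avoids_boundary_layer[OF T(1,2)] by metis
  have W\<phi>: "AE x in \<mu>. x \<notin> T \<longrightarrow> W \<phi> x = 0"
    using has_weak_grad_AE[OF test_has_weak_grad[OF \<phi>]]
    by eventually_elim (simp add: grad_def T(4) vec_eq_iff)
  have in\<Omega>: "AE x in \<mu>. x \<in> \<Omega>" by (intro AE_I2) simp
  have "\<bar>energy \<Omega> \<sigma> \<phi> u0\<bar> \<le> 0 + c" if c: "c > 0" for c
  proof -
    \<comment> \<open>Two cutoff fluxes, each with an error of at most \<open>e * \<delta> * (4 / \<delta>) * (R * M)\<close>, have to fit into \<open>c\<close>.\<close>
    define e where "e = c / (8 * (R * M + 1))"
    have RM: "R * M \<ge> 0" using R0 M0 by simp
    have e: "e > 0" using c RM by (simp add: e_def)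
    have "8 * e * (R * M) \<le> 8 * e * (R * M + 1)" using e by simp
    also have "\<dots> = c"
    proof -
      have "8 * (c / (8 * X)) * X = c" if "X \<noteq> 0" for X :: real using that by simp
      moreover have "R * M + 1 \<noteq> 0" using RM by simp
      ultimately show ?thesis unfolding e_def by blast
    qed
    finally have ec: "8 * e * (R * M) \<le> c" .
    obtain \<delta>0 where \<delta>0: "\<delta>0 > 0" "\<And>\<delta>. 0 < \<delta> \<Longrightarrow> \<delta> < \<delta>0 \<Longrightarrow>
      (\<forall>\<^sub>F n in sequentially. AE x in \<mu>. x \<in> boundary_layer \<Omega> \<delta> \<longrightarrow> norm (S n x - \<sigma> x) \<le> e * \<delta>)"
      using layer[OF e] by blast
    \<comment> \<open>The layer is thin enough for the hypothesis on the coefficients, and avoids the support of \<open>\<phi>\<close>.\<close>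
    define \<delta> where "\<delta> = min (\<delta>0 / 2) \<delta>1"
    have \<delta>: "\<delta> > 0" "\<delta> < \<delta>0" "\<delta> \<le> \<delta>1" using \<delta>0(1) \<delta>1(1) by (auto simp: \<delta>_def)
    obtain \<theta> where \<theta>: "\<theta> \<in> test_functions \<Omega>"
      and \<theta>1: "\<And>x. x \<in> \<Omega> \<Longrightarrow> x \<notin> boundary_layer \<Omega> \<delta> \<Longrightarrow> \<theta> x = 1 \<and> grad \<theta> x = 0"
      and \<theta>B: "\<And>x. norm (grad \<theta> x) \<le> 4 / \<delta>"
      using cutoff_exists[OF \<delta>(1)] by metis
    have \<theta>T: "\<theta> x = 1" "grad \<theta> x = 0" if "x \<in> T" for x
    proof -
      have "x \<in> \<Omega>" "x \<notin> boundary_layer \<Omega> \<delta>" using that T(2) \<delta>1(2)[OF \<delta>(3)] by blast+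
      then show "\<theta> x = 1" "grad \<theta> x = 0" using \<theta>1 by blast+
    qed
    let ?J = "\<lambda>\<tau> n. cutoff_flux \<tau> \<theta> (u n) (z n) - cutoff_flux \<tau> \<theta> (z n) (u n)"
    have P0: "cutoff_flux \<sigma> \<theta> u0 \<phi> = 0"
      unfolding cutoff_flux_def ipL2_def
    proof (rule integral_eq_zero_AE, use W\<phi> in eventually_elim)
      case (elim x) then show ?case using \<theta>T(2)[of x] by (cases "x \<in> T") (auto simp: mat_app_def)
    qed
    have P0': "cutoff_flux \<sigma> \<theta> \<phi> u0 = 0"
    proof -
      have "\<phi> x *\<^sub>R grad \<theta> x = 0" for x using \<theta>T(2)[of x] T(3)[of x] by (cases "x \<in> T") auto
      then show ?thesis unfolding cutoff_flux_def ipL2_def by (simp only: inner_zero_right Bochner_Integration.integral_zero)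
    qed
    have Jlim: "(\<lambda>n. ?J \<sigma> n) \<longlonglongrightarrow> 0"
      using tendsto_diff[OF cutoff_flux_continuous[OF \<sigma>_M_K \<theta> uH R u0 lim zH1 M \<phi>H zc] cutoff_flux_continuous[OF \<sigma>_M_K \<theta> zH1 M \<phi>H zc uH R u0 lim]]
      by (simp add: P0 P0')
    have FJ: "?F (\<lambda>x. \<theta> x * u n x) = ?J (S n) n" for n
      using Green_cutoff[OF S_M_K z u \<theta>, of n] by simp
    have Feq: "?F (\<lambda>x. \<theta> x * v x) = ipL2 \<Omega> (W v) (\<lambda>x. \<theta> x *\<^sub>R mat_app \<sigma> (W \<phi>) x) + cutoff_flux \<sigma> \<theta> v \<phi>" if v: "v \<in> H1 \<Omega>" for v
    proof -
      have "ipL2 \<Omega> (mat_app \<sigma> (W \<phi>)) (\<lambda>x. \<theta> x *\<^sub>R W v x) = ipL2 \<Omega> (W v) (\<lambda>x. \<theta> x *\<^sub>R mat_app \<sigma> (W \<phi>) x)"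
        by (simp add: ipL2_def inner_commute)
      then show ?thesis using energy_cutoff[OF \<sigma>_M_K v \<phi>H \<theta>] by simp
    qed
    have Flim: "(\<lambda>n. ?F (\<lambda>x. \<theta> x * u n x)) \<longlonglongrightarrow> ?F (\<lambda>x. \<theta> x * u0 x)"
      unfolding Feq[OF uH] Feq[OF u0]
      by (intro tendsto_add wconvD(2)[OF lim] test_scaleR_L2[OF \<theta>] mat_app_L2[OF \<sigma>_M_K] weak_grad_L2 \<phi>H
        cutoff_flux_continuous[OF \<sigma>_M_K \<theta> uH R u0 lim \<phi>H order_refl \<phi>H wconv_const])
    have F0: "?F (\<lambda>x. \<theta> x * u0 x) = ?F u0"
    proof -
      have "ipL2 \<Omega> (mat_app \<sigma> (W \<phi>)) (\<lambda>x. \<theta> x *\<^sub>R W u0 x) = ipL2 \<Omega> (mat_app \<sigma> (W \<phi>)) (W u0)"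
        unfolding ipL2_def
      proof (rule integral_cong_AE)
        show "AE x in \<mu>. mat_app \<sigma> (W \<phi>) x \<bullet> (\<theta> x *\<^sub>R W u0 x) = mat_app \<sigma> (W \<phi>) x \<bullet> W u0 x"
          using W\<phi>
        proof eventually_elim
          case (elim x) then show ?case using \<theta>T(1)[of x] by (cases "x \<in> T") (auto simp: mat_app_def)
        qed
      qed (intro borel_measurable_integrable integrable_inner_L2 mat_app_L2[OF \<sigma>_M_K] weak_grad_L2 \<phi>H u0 test_scaleR_L2[OF \<theta>])+
      then show ?thesis using energy_cutoff[OF \<sigma>_M_K u0 \<phi>H \<theta>] P0 energy_eq[OF \<sigma>_M_K] by simp
    qed
    have "\<forall>\<^sub>F n in sequentially. \<bar>?F (\<lambda>x. \<theta> x * u n x)\<bar> \<le> \<bar>?J \<sigma> n\<bar> + c"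
      using \<delta>0(2)[OF \<delta>(1,2)]
    proof eventually_elim
      case (elim n)
      have e\<delta>: "e * \<delta> \<ge> 0" using e \<delta> by simp
      have g0: "\<And>x. x \<in> \<Omega> \<Longrightarrow> x \<notin> boundary_layer \<Omega> \<delta> \<Longrightarrow> grad \<theta> x = 0" using \<theta>1 by blast
      have "\<bar>cutoff_flux (S n) \<theta> (u n) (z n) - cutoff_flux \<sigma> \<theta> (u n) (z n)\<bar> \<le> e * \<delta> * (4 / \<delta>) * (R * M)"
        by (rule cutoff_flux_layer_difference[OF S_M_K \<sigma>_M_K \<theta> elim e\<delta> g0 \<theta>B uH R zH1 M])
      moreover have "\<bar>cutoff_flux (S n) \<theta> (z n) (u n) - cutoff_flux \<sigma> \<theta> (z n) (u n)\<bar> \<le> e * \<delta> * (4 / \<delta>) * (M * R)"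
        by (rule cutoff_flux_layer_difference[OF S_M_K \<sigma>_M_K \<theta> elim e\<delta> g0 \<theta>B zH1 M uH R])
      moreover have "e * \<delta> * (4 / \<delta>) * (R * M) = 4 * e * (R * M)" "e * \<delta> * (4 / \<delta>) * (M * R) = 4 * e * (R * M)"
        using \<delta>(1) by simp_all
      ultimately show ?case unfolding FJ using ec by linarith
    qed
    moreover have "(\<lambda>n. \<bar>?F (\<lambda>x. \<theta> x * u n x)\<bar>) \<longlonglongrightarrow> \<bar>?F u0\<bar>"
      using tendsto_rabs[OF Flim] unfolding F0 .
    moreover have "(\<lambda>n. \<bar>?J \<sigma> n\<bar> + c) \<longlonglongrightarrow> \<bar>0\<bar> + c"
      by (intro tendsto_add tendsto_rabs Jlim tendsto_const)
    ultimately have "\<bar>?F u0\<bar> \<le> \<bar>0\<bar> + c" by (intro tendsto_le[OF sequentially_bot])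
    then show ?thesis by simp
  qed
  then show ?thesis using field_le_epsilon[of "\<bar>energy \<Omega> \<sigma> \<phi> u0\<bar>" 0] by simp
qed

text \<open>
Test functions are dense in \<open>H10\<close>.
\<close>

theorem harmonic_limit:
  assumes u: "\<And>n. weak_solution \<Omega> (S n) (\<lambda>_. 0) (u n)" and R: "\<And>n. norm_H1 \<Omega> (u n) \<le> R"
    and u0: "u0 \<in> H1 \<Omega>" and lim: "wconv u u0"
  shows "weak_solution \<Omega> \<sigma> (\<lambda>_. 0) u0"
  unfolding weak_solution_def
proof (intro conjI u0 ballI)
  fix v assume v: "v \<in> H10 \<Omega>"
  note vH = H10_H1[OF v]
  define B where "B = K * norm_L2 \<Omega> (W u0)"
  have B: "B \<ge> 0" using K1 norm_L2_nonneg[of \<Omega> "W u0"] by (simp add: B_def)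
  have "\<bar>energy \<Omega> \<sigma> u0 v\<bar> \<le> 0 + e" if e: "e > 0" for e
  proof -
    have "e / (B + 1) > 0" using e B by simp
    then obtain \<phi> where \<phi>: "\<phi> \<in> test_functions \<Omega>" "norm_H1 \<Omega> (v - \<phi>) < e / (B + 1)"
      by (rule H10_approx[OF v])
    note \<phi>H = test_H1[OF \<phi>(1)]
    have "energy \<Omega> \<sigma> u0 \<phi> = 0"
      using harmonic_limit_tested[OF u R u0 lim \<phi>(1)] energy_commute[OF \<sigma>_M_K u0 \<phi>H] by simp
    then have "\<bar>energy \<Omega> \<sigma> u0 v\<bar> = \<bar>energy \<Omega> \<sigma> u0 (v - \<phi>)\<bar>"
      using energy_diff_right[OF \<sigma>_M_K u0 vH \<phi>H] by simp
    also have "\<dots> \<le> B * norm_L2 \<Omega> (W (v - \<phi>))"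
      unfolding B_def by (rule energy_bound[OF \<sigma>_M_K u0 H1.V_diff[OF vH \<phi>H]])
    also have "\<dots> \<le> B * (e / (B + 1))"
      using \<phi>(2) norm_L2_le_norm_H1(2)[of "v - \<phi>"] B by (intro mult_left_mono) linarith+
    also have "\<dots> \<le> e" using e B by (simp add: field_simps)
    finally show ?thesis by simp
  qed
  then show "energy \<Omega> \<sigma> u0 v = 0" using field_le_epsilon[of "\<bar>energy \<Omega> \<sigma> u0 v\<bar>" 0] by simp
qed

text \<open>
Splitting \<open>grad v\<close> with \<open>\<theta>\<close> and \<open>1 - \<theta>\<close> and testing both equations with cut-off solutions leaves two terms
that compare \<open>S n\<close> with \<open>\<sigma>\<close> in the layer, and the antisymmetric expression \<open>J\<close> in the cutoff fluxes for
\<open>\<sigma>\<close>. The limit of \<open>J\<close> is \<open>0\<close> by \<open>Green_cutoff\<close>, since both weak limits are solutions for \<open>\<sigma>\<close>.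
\<close>

lemma energy_difference_tendsto:
  assumes u: "\<And>n. weak_solution \<Omega> (S n) (\<lambda>_. 0) (u n)" "\<And>n. norm_H1 \<Omega> (u n) \<le> R" "u0 \<in> H1 \<Omega>" "wconv u u0"
    and v: "\<And>n. weak_solution \<Omega> \<sigma> (\<lambda>_. 0) (v n)" "\<And>n. norm_H1 \<Omega> (v n) \<le> R" "v0 \<in> H1 \<Omega>" "wconv v v0"
  shows "(\<lambda>n. energy \<Omega> (S n) (u n) (v n) - energy \<Omega> \<sigma> (u n) (v n)) \<longlonglongrightarrow> 0"
proof (rule LIMSEQ_I)
  fix c :: real assume c: "c > 0"
  have uH: "u n \<in> H1 \<Omega>" and vH: "v n \<in> H1 \<Omega>" for n using u(1) v(1) by (simp_all add: weak_solution_def)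
  have R0: "R \<ge> 0" by (rule order_trans[OF H1.nrm_nonneg[OF uH] u(2)])
  have u0h: "weak_solution \<Omega> \<sigma> (\<lambda>_. 0) u0" by (rule harmonic_limit[OF u])
  have v0h: "weak_solution \<Omega> \<sigma> (\<lambda>_. 0) v0"
    unfolding weak_solution_def
  proof (intro conjI v(3) ballI)
    fix w assume w: "w \<in> H10 \<Omega>"
    note wH = H10_H1[OF w]
    have e: "energy \<Omega> \<sigma> x w = ipL2 \<Omega> (W x) (mat_app \<sigma> (W w))" if "x \<in> H1 \<Omega>" for x
      by (rule trans[OF energy_commute[OF \<sigma>_M_K that wH]
        trans[OF energy_eq[OF \<sigma>_M_K] L2.ip_commute[OF mat_app_L2[OF \<sigma>_M_K weak_grad_L2[OF wH]] weak_grad_L2[OF that]]]])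
    have "(\<lambda>n. energy \<Omega> \<sigma> (v n) w) \<longlonglongrightarrow> energy \<Omega> \<sigma> v0 w"
      unfolding e[OF vH] e[OF v(3)] by (rule wconvD(2)[OF v(4) mat_app_L2[OF \<sigma>_M_K weak_grad_L2[OF wH]]])
    moreover have "energy \<Omega> \<sigma> (v n) w = 0" for n using v(1) w by (simp add: weak_solution_def)
    ultimately show "energy \<Omega> \<sigma> v0 w = 0" by (simp add: LIMSEQ_const_iff)
  qed
  \<comment> \<open>The cutoff flux contributes \<open>4 * e * (R * R)\<close>, the term with \<open>1 - \<theta>\<close> contributes \<open>e * (R * R)\<close>, and half of
    \<open>c\<close> is reserved for \<open>J\<close>.\<close>
  define e where "e = c / (12 * (R * R + 1))"
  have e: "e > 0" using c by (simp add: e_def add_nonneg_pos)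
  have ec: "5 * e * (R * R) < c / 2"
  proof -
    have p: "R * R + 1 > 0" by (simp add: add_nonneg_pos)
    have "5 * e * (R * R) \<le> 5 * e * (R * R + 1)" using e by simp
    also have "\<dots> < 6 * e * (R * R + 1)" using e p by simp
    also have "\<dots> = c / 2"
    proof -
      have "6 * (c / (12 * X)) * X = c / 2" if "X > 0" for X :: real using that by simp
      from this[OF p] show ?thesis unfolding e_def .
    qed
    finally show ?thesis .
  qed
  obtain \<delta>0 where \<delta>0: "\<delta>0 > 0" "\<And>\<delta>. 0 < \<delta> \<Longrightarrow> \<delta> < \<delta>0 \<Longrightarrow>
      (\<forall>\<^sub>F n in sequentially. AE x in \<mu>. x \<in> boundary_layer \<Omega> \<delta> \<longrightarrow> norm (S n x - \<sigma> x) \<le> e * \<delta>)"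
    using layer[OF e] by blast
  \<comment> \<open>With \<open>\<delta> \<le> 1\<close> the bound \<open>e * \<delta>\<close> on the coefficients in the layer is also a bound \<open>e\<close>.\<close>
  define \<delta> where "\<delta> = min (\<delta>0 / 2) 1"
  have \<delta>: "\<delta> > 0" "\<delta> < \<delta>0" "\<delta> \<le> 1" using \<delta>0(1) by (auto simp: \<delta>_def)
  obtain \<theta> where \<theta>: "\<theta> \<in> test_functions \<Omega>" and \<theta>01: "\<And>x. 0 \<le> \<theta> x" "\<And>x. \<theta> x \<le> 1"
    and \<theta>1: "\<And>x. x \<in> \<Omega> \<Longrightarrow> x \<notin> boundary_layer \<Omega> \<delta> \<Longrightarrow> \<theta> x = 1 \<and> grad \<theta> x = 0"
    and \<theta>B: "\<And>x. norm (grad \<theta> x) \<le> 4 / \<delta>"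
    using cutoff_exists[OF \<delta>(1)] by metis
  define J where "J n = cutoff_flux \<sigma> \<theta> (u n) (v n) - cutoff_flux \<sigma> \<theta> (v n) (u n)" for n
  have "J \<longlonglongrightarrow> cutoff_flux \<sigma> \<theta> u0 v0 - cutoff_flux \<sigma> \<theta> v0 u0"
    unfolding J_def
    by (intro tendsto_diff cutoff_flux_continuous[OF \<sigma>_M_K \<theta> uH u(2-4) vH v(2-4)] cutoff_flux_continuous[OF \<sigma>_M_K \<theta> vH v(2-4) uH u(2-4)])
  then have Jlim: "J \<longlonglongrightarrow> 0" using Green_cutoff[OF \<sigma>_M_K v0h u0h \<theta>] by simp
  let ?q = "\<lambda>n x. (1 - \<theta> x) *\<^sub>R W (v n) x"
  have \<theta>L: "(\<lambda>x. \<theta> x *\<^sub>R W y x) \<in> L2 \<Omega>" if "y \<in> H1 \<Omega>" for y by (rule test_scaleR_L2[OF \<theta> weak_grad_L2[OF that]])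
  have qL: "?q n \<in> L2 \<Omega>" for n
    using L2_diff[OF weak_grad_L2[OF vH] \<theta>L[OF vH]] by (simp add: scaleR_diff_left)
  have qR: "norm_L2 \<Omega> (?q n) \<le> R" for n
  proof -
    have "norm_L2 \<Omega> (?q n) \<le> 1 * norm_L2 \<Omega> (W (v n))"
    proof (rule L2_dominated(2)[OF weak_grad_L2[OF vH] L2_measurable[OF qL]])
      show "AE x in \<mu>. norm (?q n x) \<le> 1 * norm (W (v n) x)"
        using \<theta>01 by (intro AE_I2) (simp add: mult_left_le_one_le)
    qed simp
    then show ?thesis using norm_L2_le_norm_H1(2)[of "v n"] v(2)[of n] by linarith
  qed
  have uR: "norm_L2 \<Omega> (W (u n)) \<le> R" for n using norm_L2_le_norm_H1(2)[of "u n"] u(2)[of n] by linarith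
  have split: "energy \<Omega> \<tau> (u n) (v n) = ipL2 \<Omega> (mat_app \<tau> (W (u n))) (\<lambda>x. \<theta> x *\<^sub>R W (v n) x) + ipL2 \<Omega> (mat_app \<tau> (W (u n))) (?q n)"
    if \<tau>: "\<tau> \<in> M_K K \<Omega>" for \<tau> n
  proof -
    have "W (v n) = (\<lambda>x. \<theta> x *\<^sub>R W (v n) x) + ?q n" by (simp add: fun_eq_iff scaleR_diff_left)
    then have "energy \<Omega> \<tau> (u n) (v n) = ipL2 \<Omega> (mat_app \<tau> (W (u n))) ((\<lambda>x. \<theta> x *\<^sub>R W (v n) x) + ?q n)"
      unfolding energy_eq[OF \<tau>] by simp
    then show ?thesis by (simp only: L2.ip_add_right[OF mat_app_L2[OF \<tau> weak_grad_L2[OF uH]] \<theta>L[OF vH] qL])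
  qed
  have diff: "energy \<Omega> (S n) (u n) (v n) - energy \<Omega> \<sigma> (u n) (v n)
    = J n - (cutoff_flux (S n) \<theta> (v n) (u n) - cutoff_flux \<sigma> \<theta> (v n) (u n))
      + (ipL2 \<Omega> (mat_app (S n) (W (u n))) (?q n) - ipL2 \<Omega> (mat_app \<sigma> (W (u n))) (?q n))" for n
  proof -
    have "energy \<Omega> (S n) (u n) (\<lambda>x. \<theta> x * v n x) = 0" "energy \<Omega> \<sigma> (v n) (\<lambda>x. \<theta> x * u n x) = 0"
      using u(1) v(1) cutoff_H10[OF vH \<theta>] cutoff_H10[OF uH \<theta>] by (simp_all add: weak_solution_def)
    then have 1: "ipL2 \<Omega> (mat_app (S n) (W (u n))) (\<lambda>x. \<theta> x *\<^sub>R W (v n) x) + cutoff_flux (S n) \<theta> (v n) (u n) = 0"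
      and 2: "ipL2 \<Omega> (mat_app \<sigma> (W (v n))) (\<lambda>x. \<theta> x *\<^sub>R W (u n) x) + cutoff_flux \<sigma> \<theta> (u n) (v n) = 0"
      using energy_cutoff[OF S_M_K vH uH \<theta>] energy_cutoff[OF \<sigma>_M_K uH vH \<theta>] by metis+
    have "ipL2 \<Omega> (mat_app \<sigma> (W (u n))) (\<lambda>x. \<theta> x *\<^sub>R W (v n) x) = ipL2 \<Omega> (mat_app \<sigma> (W (v n))) (\<lambda>x. \<theta> x *\<^sub>R W (u n) x)"
      by (intro ip_mat_app_scaleR_commute[OF \<sigma>_M_K] weak_grad_L2 uH vH \<theta>L)
    then show ?thesis using 1 2 split[OF S_M_K, of n n] split[OF \<sigma>_M_K, of n] by (simp add: J_def)
  qed
  have "\<forall>\<^sub>F n in sequentially. \<bar>J n\<bar> < c / 2"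
    using order_tendstoD(2)[OF tendsto_rabs[OF Jlim], of "c / 2"] c by simp
  with \<delta>0(2)[OF \<delta>(1,2)]
  have "\<forall>\<^sub>F n in sequentially. norm (energy \<Omega> (S n) (u n) (v n) - energy \<Omega> \<sigma> (u n) (v n) - 0) < c"
  proof eventually_elim
    case (elim n)
    have e\<delta>: "e * \<delta> \<ge> 0" using e \<delta> by simp
    have g0: "\<And>x. x \<in> \<Omega> \<Longrightarrow> x \<notin> boundary_layer \<Omega> \<delta> \<Longrightarrow> grad \<theta> x = 0" using \<theta>1 by blast
    have "\<bar>cutoff_flux (S n) \<theta> (v n) (u n) - cutoff_flux \<sigma> \<theta> (v n) (u n)\<bar> \<le> e * \<delta> * (4 / \<delta>) * (R * R)"
      by (rule cutoff_flux_layer_difference[OF S_M_K \<sigma>_M_K \<theta> elim(1) e\<delta> g0 \<theta>B vH v(2) uH u(2)])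
    also have "\<dots> = 4 * e * (R * R)" using \<delta>(1) by simp
    finally have 1: "\<bar>cutoff_flux (S n) \<theta> (v n) (u n) - cutoff_flux \<sigma> \<theta> (v n) (u n)\<bar> \<le> 4 * e * (R * R)" .
    have "\<bar>ipL2 \<Omega> (mat_app (S n) (W (u n))) (?q n) - ipL2 \<Omega> (mat_app \<sigma> (W (u n))) (?q n)\<bar>
       \<le> e * \<delta> * (norm_L2 \<Omega> (W (u n)) * norm_L2 \<Omega> (?q n))"
      by (rule layer_difference[OF S_M_K \<sigma>_M_K elim(1) e\<delta> weak_grad_L2[OF uH] qL]) (use \<theta>1 in auto)
    also have "\<dots> \<le> e * (R * R)"
    proof (rule mult_mono)
      show "e * \<delta> \<le> e" using e \<delta> by (simp add: mult_left_le)
      show "norm_L2 \<Omega> (W (u n)) * norm_L2 \<Omega> (?q n) \<le> R * R"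
        by (intro mult_mono uR qR R0 norm_L2_nonneg)
    qed (use e norm_L2_nonneg in \<open>auto intro!: mult_nonneg_nonneg norm_L2_nonneg\<close>)
    finally show ?case unfolding diff using 1 elim(2) ec by simp
  qed
  then show "\<exists>no. \<forall>n\<ge>no. norm (energy \<Omega> (S n) (u n) (v n) - energy \<Omega> \<sigma> (u n) (v n) - 0) < c"
    by (simp add: eventually_sequentially)
qed

text \<open>
Otherwise there are bounded solutions violating the estimate for infinitely many \<open>n\<close>, and weakly
convergent subsequences of them contradict \<open>energy_difference_tendsto\<close>.
\<close>

theorem energy_difference_uniform:
  assumes \<epsilon>: "\<epsilon> > 0"
  shows "\<forall>\<^sub>F n in sequentially. \<forall>u v. weak_solution \<Omega> (S n) (\<lambda>_. 0) u \<longrightarrow> weak_solution \<Omega> \<sigma> (\<lambda>_. 0) v \<longrightarrow>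
     norm_H1 \<Omega> u \<le> R \<longrightarrow> norm_H1 \<Omega> v \<le> R \<longrightarrow> \<bar>energy \<Omega> (S n) u v - energy \<Omega> \<sigma> u v\<bar> \<le> \<epsilon>"
    (is "eventually ?good _")
proof (rule ccontr)
  assume "\<not> eventually ?good sequentially"
  then have "infinite {n. \<not> ?good n}"
    unfolding eventually_sequentially infinite_nat_iff_unbounded_le by blast
  from infinite_enumerate[OF this]
  have "\<exists>r :: nat \<Rightarrow> nat. strict_mono r \<and> (\<forall>n. \<not> ?good (r n))" by (simp only: mem_Collect_eq)
  then obtain r where r: "strict_mono (r :: nat \<Rightarrow> nat)" and bad: "\<And>n. \<not> ?good (r n)" by blast
  have "\<forall>n. \<exists>u v. weak_solution \<Omega> (S (r n)) (\<lambda>_. 0) u \<and> weak_solution \<Omega> \<sigma> (\<lambda>_. 0) v \<and>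
     norm_H1 \<Omega> u \<le> R \<and> norm_H1 \<Omega> v \<le> R \<and> \<bar>energy \<Omega> (S (r n)) u v - energy \<Omega> \<sigma> u v\<bar> > \<epsilon>"
    using bad by (simp add: not_le)
  then obtain u v where u: "\<And>n. weak_solution \<Omega> (S (r n)) (\<lambda>_. 0) (u n)" "\<And>n. norm_H1 \<Omega> (u n) \<le> R"
    and v: "\<And>n. weak_solution \<Omega> \<sigma> (\<lambda>_. 0) (v n)" "\<And>n. norm_H1 \<Omega> (v n) \<le> R"
    and big: "\<And>n. \<bar>energy \<Omega> (S (r n)) (u n) (v n) - energy \<Omega> \<sigma> (u n) (v n)\<bar> > \<epsilon>"
    by metis
  have uH: "u n \<in> H1 \<Omega>" and vH: "v n \<in> H1 \<Omega>" for n using u(1) v(1) by (simp_all add: weak_solution_def)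
  obtain r1 u0 where r1: "strict_mono (r1 :: nat \<Rightarrow> nat)" and u0: "u0 \<in> H1 \<Omega>" "wconv (u \<circ> r1) u0"
    by (rule H1_bounded_wconv_subseq[of u R, OF uH u(2)])
  obtain r2 v0 where r2: "strict_mono (r2 :: nat \<Rightarrow> nat)" and v0: "v0 \<in> H1 \<Omega>" "wconv ((v \<circ> r1) \<circ> r2) v0"
    by (rule H1_bounded_wconv_subseq[of "v \<circ> r1" R]) (use vH v(2) in auto)
  define s where "s = r1 \<circ> r2"
  have us: "wconv (u \<circ> s) u0" using wconv_subseq[OF u0(2) r2] by (simp add: s_def o_assoc)
  have vs: "wconv (v \<circ> s) v0" using v0(2) by (simp add: s_def o_assoc)
  interpret T: G_convergent_sequence \<Omega> K "S \<circ> (r \<circ> s)" \<sigma>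
    by (rule subsequence) (simp add: s_def r r1 r2 strict_mono_o)
  have "(\<lambda>n. energy \<Omega> ((S \<circ> (r \<circ> s)) n) ((u \<circ> s) n) ((v \<circ> s) n) - energy \<Omega> \<sigma> ((u \<circ> s) n) ((v \<circ> s) n)) \<longlonglongrightarrow> 0"
    by (rule T.energy_difference_tendsto[where R = R, OF _ _ u0(1) us _ _ v0(1) vs]) (simp_all add: u v)
  from order_tendstoD(2)[OF tendsto_rabs[OF this], of \<epsilon>] \<epsilon>
  have "\<forall>\<^sub>F n in sequentially. \<bar>energy \<Omega> (S (r (s n))) (u (s n)) (v (s n)) - energy \<Omega> \<sigma> (u (s n)) (v (s n))\<bar> < \<epsilon>"
    by (simp add: o_def)
  then obtain n where "\<bar>energy \<Omega> (S (r (s n))) (u (s n)) (v (s n)) - energy \<Omega> \<sigma> (u (s n)) (v (s n))\<bar> < \<epsilon>"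
    by (auto simp: eventually_sequentially)
  with big[of "s n"] show False by simp
qed

end

section \<open>The Dirichlet-to-Neumann map\<close>

context elliptic
begin

lemma H_half_members:
  assumes "\<phi> \<in> H_half \<Omega>"
  shows "\<phi> \<noteq> {}" "u \<in> \<phi> \<Longrightarrow> u \<in> H1 \<Omega>" "u \<in> \<phi> \<Longrightarrow> v \<in> \<phi> \<Longrightarrow> u - v \<in> H10 \<Omega>"
    "u \<in> \<phi> \<Longrightarrow> w \<in> H10 \<Omega> \<Longrightarrow> u + w \<in> \<phi>"
proof -
  obtain p where p: "p \<in> H1 \<Omega>" "\<phi> = {v. v \<in> H1 \<Omega> \<and> p - v \<in> H10 \<Omega>}"
    using assms by (auto simp: H_half_def quotient_def trace_rel_def Image_def fun_diff_def)
  have "p - p \<in> H10 \<Omega>" using subspace_0[OF subspace_H10] by simp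
  then show "\<phi> \<noteq> {}" using p by blast
  show "u \<in> \<phi> \<Longrightarrow> u \<in> H1 \<Omega>" using p by simp
  show "u - v \<in> H10 \<Omega>" if "u \<in> \<phi>" "v \<in> \<phi>"
  proof -
    have "(p - v) - (p - u) \<in> H10 \<Omega>" by (rule subspace_diff[OF subspace_H10]) (use that p in simp_all)
    then show ?thesis by (simp add: algebra_simps)
  qed
  show "u + w \<in> \<phi>" if "u \<in> \<phi>" "w \<in> H10 \<Omega>"
  proof -
    have "(p - u) - w \<in> H10 \<Omega>" by (rule subspace_diff[OF subspace_H10]) (use that p in simp_all)
    then show ?thesis using that p H1_add[OF _ H10_H1] by (simp add: algebra_simps)
  qed
qed

lemma trace_small_representative:
  assumes \<phi>: "\<phi> \<in> H_half \<Omega>" and n: "norm_H_half \<Omega> \<phi> \<le> 1"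
  shows "\<exists>p\<in>\<phi>. norm_H1 \<Omega> p < 2"
proof -
  have "bdd_below (norm_H1 \<Omega> ` \<phi>)"
    by (rule bdd_belowI2[of _ 0]) (rule H1.nrm_nonneg[OF H_half_members(2)[OF \<phi>]])
  moreover have "(INF u\<in>\<phi>. norm_H1 \<Omega> u) < 2" using n by (simp add: norm_H_half_def)
  ultimately show ?thesis using cINF_less_iff[OF H_half_members(1)[OF \<phi>]] by blast
qed

lemma harmonic_extension_exists:
  assumes \<sigma>: "\<sigma> \<in> M_K K \<Omega>" and \<phi>: "\<phi> \<in> H_half \<Omega>"
  shows "\<exists>u. u \<in> \<phi> \<and> weak_solution \<Omega> \<sigma> (\<lambda>_. 0) u"
proof -
  obtain p where p: "p \<in> \<phi>" using H_half_members(1)[OF \<phi>] by blast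
  note pH = H_half_members(2)[OF \<phi> p]
  obtain w where w: "w \<in> H10 \<Omega>" "weak_solution \<Omega> \<sigma> (energy \<Omega> \<sigma> p) w"
    using Dirichlet_solvable[OF \<sigma> energy_in_Hm1[OF \<sigma> pH]] by blast
  have "energy \<Omega> \<sigma> (p - w) v = 0" if "v \<in> H10 \<Omega>" for v
    using energy_diff_left[OF \<sigma> pH H10_H1[OF w(1)] H10_H1[OF that]] w(2) that by (simp add: weak_solution_def)
  then have "weak_solution \<Omega> \<sigma> (\<lambda>_. 0) (p - w)" using H1.V_diff[OF pH H10_H1[OF w(1)]] by (simp add: weak_solution_def)
  moreover have "p + (- w) \<in> \<phi>" by (rule H_half_members(4)[OF \<phi> p subspace_neg[OF subspace_H10 w(1)]])
  ultimately show ?thesis by auto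
qed

text \<open>
The extension differs from a representative of norm less than 2 by the solution of a Dirichlet problem,
to which \<open>Dirichlet_bound\<close> applies.
\<close>

lemma harmonic_extension_bound:
  obtains R where "\<And>\<sigma> \<phi> u. \<sigma> \<in> M_K K \<Omega> \<Longrightarrow> \<phi> \<in> H_half \<Omega> \<Longrightarrow> norm_H_half \<Omega> \<phi> \<le> 1 \<Longrightarrow> u \<in> \<phi> \<Longrightarrow>
    weak_solution \<Omega> \<sigma> (\<lambda>_. 0) u \<Longrightarrow> norm_H1 \<Omega> u \<le> R"
proof -
  obtain C where C: "C > 0" "\<And>u. u \<in> H10 \<Omega> \<Longrightarrow> norm_H1 \<Omega> u \<le> C * norm_L2 \<Omega> (W u)" using Poincare by metis
  show thesis
  proof (rule that[of "C * (K * (2 * K) * C) + 2"])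
    fix \<sigma> \<phi> u assume \<sigma>: "\<sigma> \<in> M_K K \<Omega>" and \<phi>: "\<phi> \<in> H_half \<Omega>" "norm_H_half \<Omega> \<phi> \<le> 1" "u \<in> \<phi>"
      and u: "weak_solution \<Omega> \<sigma> (\<lambda>_. 0) u"
    obtain p where p: "p \<in> \<phi>" "norm_H1 \<Omega> p < 2" using trace_small_representative[OF \<phi>(1,2)] by blast
    note pH = H_half_members(2)[OF \<phi>(1) p(1)] and uH = H_half_members(2)[OF \<phi>(1) \<phi>(3)]
    define w where "w = u - p"
    have w: "w \<in> H10 \<Omega>" unfolding w_def by (rule H_half_members(3)[OF \<phi>(1) \<phi>(3) p(1)])
    note wH = H10_H1[OF w]
    have "energy \<Omega> \<sigma> w w = - energy \<Omega> \<sigma> p w"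
      using energy_diff_left[OF \<sigma> uH pH wH] u w by (simp add: weak_solution_def w_def)
    also have "\<dots> \<le> K * norm_L2 \<Omega> (W p) * norm_L2 \<Omega> (W w)" using energy_bound[OF \<sigma> pH wH] by linarith
    also have "\<dots> \<le> (2 * K) * norm_H1 \<Omega> w"
    proof (rule mult_mono)
      show "K * norm_L2 \<Omega> (W p) \<le> 2 * K"
        using K1 norm_L2_le_norm_H1(2)[of p] p(2) by (simp add: mult.commute)
    qed (use K1 norm_L2_le_norm_H1(2) norm_L2_nonneg[of \<Omega> "W w"] in auto)
    finally have "norm_H1 \<Omega> w \<le> C * (K * (2 * K) * C)"
      using Dirichlet_bound[OF \<sigma> C w] K1 by auto
    moreover have "norm_H1 \<Omega> u \<le> norm_H1 \<Omega> w + norm_H1 \<Omega> p"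
      unfolding w_def by (rule H1.nrm_triangle_sub[OF uH pH])
    ultimately show "norm_H1 \<Omega> u \<le> C * (K * (2 * K) * C) + 2" using p(2) by simp
  qed
qed

text \<open>
The value is independent of the representative chosen for \<open>\<psi>\<close>, as solutions have zero energy against \<open>H10\<close>.
\<close>

lemma DtN_eq_energy:
  assumes \<sigma>: "\<sigma> \<in> M_K K \<Omega>" and \<phi>: "\<phi> \<in> H_half \<Omega>" and \<psi>: "\<psi> \<in> H_half \<Omega>"
  obtains u where "u \<in> \<phi>" "weak_solution \<Omega> \<sigma> (\<lambda>_. 0) u" "\<And>w. w \<in> \<psi> \<Longrightarrow> DtN \<Omega> \<sigma> \<phi> \<psi> = energy \<Omega> \<sigma> u w"
proof -
  define u where "u = (SOME u. u \<in> \<phi> \<and> weak_solution \<Omega> \<sigma> (\<lambda>_. 0) u)"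
  have u: "u \<in> \<phi> \<and> weak_solution \<Omega> \<sigma> (\<lambda>_. 0) u"
    unfolding u_def by (rule someI_ex[OF harmonic_extension_exists[OF \<sigma> \<phi>]])
  define w0 where "w0 = (SOME w. w \<in> \<psi>)"
  have w0: "w0 \<in> \<psi>" unfolding w0_def using H_half_members(1)[OF \<psi>] by (simp add: some_in_eq)
  show thesis
  proof (rule that)
    show "u \<in> \<phi>" "weak_solution \<Omega> \<sigma> (\<lambda>_. 0) u" using u by auto
    fix w assume w: "w \<in> \<psi>"
    have "energy \<Omega> \<sigma> u w0 - energy \<Omega> \<sigma> u w = energy \<Omega> \<sigma> u (w0 - w)"
      by (rule energy_diff_right[OF \<sigma>, symmetric])
        (use H_half_members(2)[OF \<phi>] H_half_members(2)[OF \<psi>] u w w0 in auto)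
    also have "\<dots> = 0" using u H_half_members(3)[OF \<psi> w0 w] by (simp add: weak_solution_def)
    finally show "DtN \<Omega> \<sigma> \<phi> \<psi> = energy \<Omega> \<sigma> u w" by (simp add: DtN_def u_def w0_def)
  qed
qed

text \<open>
The map of \<open>\<sigma>\<close> may be evaluated with the solution \<open>u\<close> for the other coefficients \<open>\<tau>\<close>: the energy of \<open>\<sigma>\<close> is
symmetric, \<open>v\<close> is a solution for \<open>\<sigma>\<close>, and \<open>u\<close> differs by a member of \<open>H10\<close> from the solution for \<open>\<sigma>\<close> with the
same boundary class.
\<close>

lemma DtN_difference:
  assumes \<sigma>: "\<sigma> \<in> M_K K \<Omega>" and \<tau>: "\<tau> \<in> M_K K \<Omega>" and \<phi>: "\<phi> \<in> H_half \<Omega>" and \<psi>: "\<psi> \<in> H_half \<Omega>"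
  obtains u v where "u \<in> \<phi>" "v \<in> \<psi>" "weak_solution \<Omega> \<tau> (\<lambda>_. 0) u" "weak_solution \<Omega> \<sigma> (\<lambda>_. 0) v"
    "DtN \<Omega> \<tau> \<phi> \<psi> - DtN \<Omega> \<sigma> \<phi> \<psi> = energy \<Omega> \<tau> u v - energy \<Omega> \<sigma> u v"
proof -
  obtain u where u: "u \<in> \<phi>" "weak_solution \<Omega> \<tau> (\<lambda>_. 0) u" "\<And>w. w \<in> \<psi> \<Longrightarrow> DtN \<Omega> \<tau> \<phi> \<psi> = energy \<Omega> \<tau> u w"
    by (rule DtN_eq_energy[OF \<tau> \<phi> \<psi>]) blast
  obtain u' where u': "u' \<in> \<phi>" "weak_solution \<Omega> \<sigma> (\<lambda>_. 0) u'" "\<And>w. w \<in> \<psi> \<Longrightarrow> DtN \<Omega> \<sigma> \<phi> \<psi> = energy \<Omega> \<sigma> u' w"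
    by (rule DtN_eq_energy[OF \<sigma> \<phi> \<psi>]) blast
  obtain v where v: "v \<in> \<psi>" "weak_solution \<Omega> \<sigma> (\<lambda>_. 0) v"
    using harmonic_extension_exists[OF \<sigma> \<psi>] by blast
  note uH = H_half_members(2)[OF \<phi> u(1)] and uH' = H_half_members(2)[OF \<phi> u'(1)] and vH = H_half_members(2)[OF \<psi> v(1)]
  have "energy \<Omega> \<sigma> v (u - u') = 0" using v(2) H_half_members(3)[OF \<phi> u(1) u'(1)] by (simp add: weak_solution_def)
  then have "energy \<Omega> \<sigma> v u = energy \<Omega> \<sigma> v u'" using energy_diff_right[OF \<sigma> vH uH uH'] by simp
  then have "energy \<Omega> \<sigma> u v = energy \<Omega> \<sigma> u' v"
    using energy_commute[OF \<sigma> uH vH] energy_commute[OF \<sigma> uH' vH] by simp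
  then show thesis using that[OF u(1) v(1) u(2) v(2)] u(3)[OF v(1)] u'(3)[OF v(1)] by simp
qed

end

lemma (in G_convergent_sequence) boundary_op_norm_tendsto:
  "(\<lambda>n. boundary_op_norm \<Omega> (\<lambda>\<phi> \<psi>. DtN \<Omega> (S n) \<phi> \<psi> - DtN \<Omega> \<sigma> \<phi> \<psi>)) \<longlonglongrightarrow> 0"
proof (rule order_tendstoI)
  fix a :: ennreal assume "0 < a"
  then obtain \<epsilon> where \<epsilon>: "\<epsilon> > 0" "ennreal \<epsilon> < a"
  proof (cases a)
    case (real b)
    then have "b > 0" using \<open>0 < a\<close> by simp
    then show thesis using that[of "b/2"] real by (simp add: ennreal_lessI)
  next
    case top then show thesis using that[of 1] by simp
  qed
  obtain R where R: "\<And>\<tau> \<phi> u. \<tau> \<in> M_K K \<Omega> \<Longrightarrow> \<phi> \<in> H_half \<Omega> \<Longrightarrow> norm_H_half \<Omega> \<phi> \<le> 1 \<Longrightarrow> u \<in> \<phi> \<Longrightarrow>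
    weak_solution \<Omega> \<tau> (\<lambda>_. 0) u \<Longrightarrow> norm_H1 \<Omega> u \<le> R"
    by (rule harmonic_extension_bound) blast
  show "\<forall>\<^sub>F n in sequentially. boundary_op_norm \<Omega> (\<lambda>\<phi> \<psi>. DtN \<Omega> (S n) \<phi> \<psi> - DtN \<Omega> \<sigma> \<phi> \<psi>) < a"
    using energy_difference_uniform[OF \<epsilon>(1), of R]
  proof eventually_elim
    case (elim n)
    have "boundary_op_norm \<Omega> (\<lambda>\<phi> \<psi>. DtN \<Omega> (S n) \<phi> \<psi> - DtN \<Omega> \<sigma> \<phi> \<psi>) \<le> ennreal \<epsilon>"
      unfolding boundary_op_norm_def norm_H_minus_half_def
    proof (intro SUP_least ennreal_leI)
      fix \<phi> \<psi> assume "\<phi> \<in> {\<phi> \<in> H_half \<Omega>. norm_H_half \<Omega> \<phi> \<le> 1}" "\<psi> \<in> {\<psi> \<in> H_half \<Omega>. norm_H_half \<Omega> \<psi> \<le> 1}"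
      then have \<phi>: "\<phi> \<in> H_half \<Omega>" "norm_H_half \<Omega> \<phi> \<le> 1" and \<psi>: "\<psi> \<in> H_half \<Omega>" "norm_H_half \<Omega> \<psi> \<le> 1" by auto
      obtain u v where "u \<in> \<phi>" "v \<in> \<psi>" and u: "weak_solution \<Omega> (S n) (\<lambda>_. 0) u" and v: "weak_solution \<Omega> \<sigma> (\<lambda>_. 0) v"
        and eq: "DtN \<Omega> (S n) \<phi> \<psi> - DtN \<Omega> \<sigma> \<phi> \<psi> = energy \<Omega> (S n) u v - energy \<Omega> \<sigma> u v"
        by (rule DtN_difference[OF \<sigma>_M_K S_M_K \<phi>(1) \<psi>(1)])
      then have "norm_H1 \<Omega> u \<le> R" "norm_H1 \<Omega> v \<le> R"
        using R[OF S_M_K \<phi> _ u] R[OF \<sigma>_M_K \<psi> _ v] by auto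
      then show "\<bar>DtN \<Omega> (S n) \<phi> \<psi> - DtN \<Omega> \<sigma> \<phi> \<psi>\<bar> \<le> \<epsilon>" unfolding eq using elim u v by blast
    qed
    then show ?case using \<epsilon>(2) by (rule le_less_trans)
  qed
qed simp

lemma (in elliptic) Linf_layer_bound:
  assumes "norm_Linf (boundary_layer \<Omega> \<delta>) f < ennreal c" and c: "c \<ge> 0"
  shows "AE x in \<mu>. x \<in> boundary_layer \<Omega> \<delta> \<longrightarrow> norm (f x) \<le> c"
proof -
  have "continuous_on UNIV (\<lambda>x. infdist x (frontier \<Omega>))" by (intro continuous_intros)
  then have "open {x. infdist x (frontier \<Omega>) < \<delta>}" by (intro open_Collect_less continuous_on_const)
  moreover have "boundary_layer \<Omega> \<delta> = \<Omega> \<inter> {x. infdist x (frontier \<Omega>) < \<delta>}" by (auto simp: boundary_layer_def)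
  ultimately have "open (boundary_layer \<Omega> \<delta>)" using open_\<Omega> by auto
  then have m: "boundary_layer \<Omega> \<delta> \<inter> space lebesgue \<in> sets lebesgue" by simp
  have "AE x in lebesgue_on (boundary_layer \<Omega> \<delta>). ennreal (norm (f x)) \<le> norm_Linf (boundary_layer \<Omega> \<delta>) f"
    unfolding norm_Linf_def by (rule esssup_AE)
  then have "AE x in lebesgue_on (boundary_layer \<Omega> \<delta>). norm (f x) \<le> c"
    by eventually_elim (use assms in \<open>metis ennreal_le_iff less_imp_le order_trans\<close>)
  then have "AE x in lebesgue. x \<in> boundary_layer \<Omega> \<delta> \<longrightarrow> norm (f x) \<le> c"
    unfolding AE_restrict_space_iff[OF m] .
  then show ?thesis unfolding AE_restrict_space_iff[OF \<Omega>_sets(2)] by eventually_elim simp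
qed

theorem theorem1p1:
  fixes \<Omega> :: "(real^'n) set"
    and K :: real
    and \<sigma>_n :: "nat \<Rightarrow> real^'n \<Rightarrow> real^'n^'n"
    and \<sigma> :: "real^'n \<Rightarrow> real^'n^'n"
  assumes "open \<Omega>" and "connected \<Omega>" and "\<Omega> \<noteq> {}" and "bounded \<Omega>"
    and "K \<ge> 1"
    and "\<And>n. \<sigma>_n n \<in> M_K K \<Omega>" and "\<sigma> \<in> M_K K \<Omega>"
    and "((\<lambda>\<delta>. limsup (\<lambda>n. norm_Linf (boundary_layer \<Omega> \<delta>) (\<lambda>x. \<sigma>_n n x - \<sigma> x)) / ennreal \<delta>)
           \<longlongrightarrow> 0) (at_right 0)"
    and "G_converges \<Omega> \<sigma>_n \<sigma>"
  shows "(\<lambda>n. boundary_op_norm \<Omega> (\<lambda>\<phi> \<psi>. DtN \<Omega> (\<sigma>_n n) \<phi> \<psi> - DtN \<Omega> \<sigma> \<phi> \<psi>)) \<longlonglongrightarrow> 0"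
proof -
  interpret elliptic \<Omega> K by unfold_locales (use assms in auto)
  let ?N = "\<lambda>\<delta> n. norm_Linf (boundary_layer \<Omega> \<delta>) (\<lambda>x. \<sigma>_n n x - \<sigma> x)"
  interpret G_convergent_sequence \<Omega> K \<sigma>_n \<sigma>
  proof
    show "\<sigma>_n n \<in> M_K K \<Omega>" for n by fact
    show "\<sigma> \<in> M_K K \<Omega>" by fact
  next
    fix e :: real assume e: "e > 0"
    from order_tendstoD(2)[OF assms(8), of "ennreal e"] e
    obtain \<delta>0 where \<delta>0: "\<delta>0 > 0" "\<And>\<delta>. 0 < \<delta> \<Longrightarrow> \<delta> < \<delta>0 \<Longrightarrow> limsup (?N \<delta>) / ennreal \<delta> < ennreal e"
      by (auto simp: eventually_at_right_field)
    have "\<forall>\<^sub>F n in sequentially. AE x in \<mu>. x \<in> boundary_layer \<Omega> \<delta> \<longrightarrow> norm (\<sigma>_n n x - \<sigma> x) \<le> e * \<delta>"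
      if \<delta>: "0 < \<delta>" "\<delta> < \<delta>0" for \<delta>
    proof -
      have "limsup (?N \<delta>) < ennreal e * ennreal \<delta>"
      proof (rule ccontr)
        assume "\<not> limsup (?N \<delta>) < ennreal e * ennreal \<delta>"
        then have "ennreal e * ennreal \<delta> / ennreal \<delta> \<le> limsup (?N \<delta>) / ennreal \<delta>"
          by (intro divide_right_mono_ennreal) simp
        also have "\<dots> < ennreal e" by (rule \<delta>0(2)[OF \<delta>])
        also have "ennreal e * ennreal \<delta> / ennreal \<delta> = ennreal e"
          using \<delta> e by (simp add: ennreal_mult'[symmetric] divide_ennreal)
        finally show False by simp
      qed
      also have "ennreal e * ennreal \<delta> = ennreal (e * \<delta>)" using e \<delta> by (simp add: ennreal_mult)
      finally have "\<forall>\<^sub>F n in sequentially. ?N \<delta> n < ennreal (e * \<delta>)" by (rule Limsup_lessD)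
      then show ?thesis by eventually_elim (rule Linf_layer_bound, use e \<delta> in auto)
    qed
    with \<delta>0(1) show "\<exists>\<delta>0>0. \<forall>\<delta>. 0 < \<delta> \<longrightarrow> \<delta> < \<delta>0 \<longrightarrow>
      (\<forall>\<^sub>F n in sequentially. AE x in \<mu>. x \<in> boundary_layer \<Omega> \<delta> \<longrightarrow> norm (\<sigma>_n n x - \<sigma> x) \<le> e * \<delta>)" by blast
  next
    fix F w assume F: "F \<in> Hm1 \<Omega>" and w: "w \<in> H10 \<Omega>" "weak_solution \<Omega> \<sigma> F w"
    have "\<forall>n. \<exists>z. z \<in> H10 \<Omega> \<and> weak_solution \<Omega> (\<sigma>_n n) F z"
      using Dirichlet_solvable[OF assms(6) F] by blast
    then obtain z where z: "\<And>n. z n \<in> H10 \<Omega> \<and> weak_solution \<Omega> (\<sigma>_n n) F (z n)" by metis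
    then have "weakly_converges_H10 \<Omega> z w" using assms(9) F w unfolding G_converges_def by blast
    with z show "\<exists>z. (\<forall>n. z n \<in> H10 \<Omega> \<and> weak_solution \<Omega> (\<sigma>_n n) F (z n)) \<and> weakly_converges_H10 \<Omega> z w" by blast
  qed
  show ?thesis by (rule boundary_op_norm_tendsto)
qed

end
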